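(* Let $k\ge2$ be a constant integer and consider best-of-$k$ on an Erdős–Rényi graph $G(n,p)$ with vertex set $V$, $|V|=n$, $p=p(n)$. Then $G(n,p)$ w.h.p. satisfies the following. (i) Suppose that $p=\Omega(n^{-1/2})$. Then (a) for every $A\subseteq V$, $T_{\mathrm{cons}}(A)=O(\log n)$ w.h.p.; (b) for some $A\subseteq V$, $T_{\mathrm{cons}}(A)=\Omega(\log n)$ w.h.p. (ii) Suppose that $p\ge(1+\epsilon)\frac{\log n}{n}$ for an arbitrary constant $\epsilon>0$. Then for every $A\subseteq V$ satisfying $|\delta(A)|\ge C\max\left\{\frac1{np},\sqrt{\frac{\log n}{n}}\right\}$, $$T_{\mathrm{cons}}(A)=O\left(\log\log n+\log|\delta(A)|^{-1}+\frac{\log n}{\log(np)}\right)\quad\text{w.h.p.},$$ where $C>0$ is a constant depending only on $f_k(x)=\sum_{i=\lfloor k/2\rfloor+1}^k\binom ki x^i(1-x)^{k-i}$.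
   Context: $G(n,p)$ is the random graph on $n$ vertices in which each of the $\binom n2$ pairs is an edge independently with probability $p$. For a graph with edge set $E$, $\pi(v)=\deg(v)/(2|E|)$, $\pi(A)=\sum_{v\in A}\pi(v)$ and $\delta(A)=2\pi(A)-1$. Best-of-$k$: each vertex holds opinion $0$ or $1$; in each synchronous round every vertex $v$ independently samples $k$ neighbours uniformly at random with replacement, and if at least $\lfloor k/2\rfloor+1$ of the samples hold the same opinion, $v$ adopts that opinion; otherwise $v$ keeps its own. All vertices update simultaneously. $A_t$ is the set of vertices of opinion $0$ after $t$ rounds, and $T_{\mathrm{cons}}(A)=\min\{t\ge0:A_t\in\{\emptyset,V\}\}$ for the process started at $A_0=A$. ($f_k$ is the probability-of-switching function: a vertex switches to the opposite opinion with probability $f_k(x)$ when a fraction $x$ of its neighbours holds the opposite opinion.) Conventions: "w.h.p." means with probability at least $1-n^{-c}$ for a constant $c>0$, and $n$ is sufficiently large. "$G(n,p)$ w.h.p. satisfies" refers to the randomness of the graph; the inner "w.h.p." refers to the randomness of the voting process on the realized graph. Constants hidden in $O,\Omega$ and in w.h.p. do not depend on $n$, on the realized graph or on $A$. *)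

theory Defs
  imports "HOL-Probability.Probability"
begin

text \<open>Simple graphs on the vertex set \<open>{..<n}\<close> are given by their edge sets, i.e. sets of
  two-element subsets of \<open>{..<n}\<close>.\<close>

definition vertex_pairs :: "nat \<Rightarrow> nat set set" where
  "vertex_pairs n = {e. e \<subseteq> {..<n} \<and> card e = 2}"

definition gnp :: "nat \<Rightarrow> real \<Rightarrow> nat set set pmf" where
  "gnp n p = map_pmf (\<lambda>X. {e \<in> vertex_pairs n. X e})
     (Pi_pmf (vertex_pairs n) False (\<lambda>_. bernoulli_pmf p))"

definition nbrs :: "nat set set \<Rightarrow> nat \<Rightarrow> nat set" where
  "nbrs E v = {w. {v, w} \<in> E}"

definition deg :: "nat set set \<Rightarrow> nat \<Rightarrow> nat" where
  "deg E v = card (nbrs E v)"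

definition stat :: "nat set set \<Rightarrow> nat \<Rightarrow> real" where
  "stat E v = real (deg E v) / (2 * real (card E))"

definition bias :: "nat set set \<Rightarrow> nat set \<Rightarrow> real" where
  "bias E A = 2 * (\<Sum>v\<in>A. stat E v) - 1"

text \<open>An isolated vertex samples itself, so that it always keeps its opinion.\<close>

definition sample_nbr :: "nat set set \<Rightarrow> nat \<Rightarrow> nat pmf" where
  "sample_nbr E v = (if nbrs E v = {} then return_pmf v else pmf_of_set (nbrs E v))"

text \<open>The probability space of the voting process: \<open>\<omega> (t, v, i)\<close> is the \<open>i\<close>-th of the \<open>k\<close>
  neighbours sampled by vertex \<open>v\<close> in the round from time \<open>t\<close> to time \<open>t + 1\<close>; all samples are
  independent.\<close>

definition vote_space :: "nat \<Rightarrow> nat \<Rightarrow> nat set set \<Rightarrow> (nat \<times> nat \<times> nat \<Rightarrow> nat) measure" where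
  "vote_space k n E =
     (\<Pi>\<^sub>M (t, v, i) \<in> UNIV \<times> {..<n} \<times> {..<k}. measure_pmf (sample_nbr E v))"

text \<open>\<open>A\<close> is the set of vertices of opinion 0, and \<open>s v i\<close> is the \<open>i\<close>-th sample of \<open>v\<close>.\<close>

definition best_of_step ::
  "nat \<Rightarrow> nat \<Rightarrow> (nat \<Rightarrow> nat \<Rightarrow> nat) \<Rightarrow> nat set \<Rightarrow> nat set" where
  "best_of_step k n s A =
     {v \<in> {..<n}.
        if card {i \<in> {..<k}. s v i \<in> A} \<ge> k div 2 + 1 then True
        else if card {i \<in> {..<k}. s v i \<notin> A} \<ge> k div 2 + 1 then False
        else v \<in> A}"

primrec best_of ::
  "nat \<Rightarrow> nat \<Rightarrow> nat set \<Rightarrow> (nat \<times> nat \<times> nat \<Rightarrow> nat) \<Rightarrow> nat \<Rightarrow> nat set" where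
  "best_of k n A \<omega> 0 = A"
| "best_of k n A \<omega> (Suc t) = best_of_step k n (\<lambda>v i. \<omega> (t, v, i)) (best_of k n A \<omega> t)"

text \<open>The consensus time is \<open>\<infinity>\<close> if consensus is never reached.\<close>

definition T_cons :: "nat \<Rightarrow> nat \<Rightarrow> nat set \<Rightarrow> (nat \<times> nat \<times> nat \<Rightarrow> nat) \<Rightarrow> enat" where
  "T_cons k n A \<omega> = Inf {enat t | t. best_of k n A \<omega> t \<in> {{}, {..<n}}}"

definition vote_fun :: "nat \<Rightarrow> real \<Rightarrow> real" where
  "vote_fun k x = (\<Sum>i = k div 2 + 1..k. real (k choose i) * x ^ i * (1 - x) ^ (k - i))"

definition prob_T_le :: "nat \<Rightarrow> nat \<Rightarrow> nat set set \<Rightarrow> nat set \<Rightarrow> real \<Rightarrow> real" where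
  "prob_T_le k n E A b =
     measure (vote_space k n E)
       {\<omega> \<in> space (vote_space k n E). ereal_of_enat (T_cons k n A \<omega>) \<le> ereal b}"

definition prob_T_ge :: "nat \<Rightarrow> nat \<Rightarrow> nat set set \<Rightarrow> nat set \<Rightarrow> real \<Rightarrow> real" where
  "prob_T_ge k n E A b =
     measure (vote_space k n E)
       {\<omega> \<in> space (vote_space k n E). ereal_of_enat (T_cons k n A \<omega>) \<ge> ereal b}"

end

theory Submission
  imports Defs "HOL-Computational_Algebra.Polynomial" "HOL-Real_Asymp.Real_Asymp"
begin

text \<open>
  Given the set \<open>A\<close> of vertices of opinion 0, the next one has independent elements, so every
  tail bound reduces to the moment generating function of a random subset with independent elements.
  The graph itself is such a random subset of the pairs.

  Write \<open>D = n p\<close> and \<open>x = \<pi>(A)\<close>, and let \<open>y v\<close> be the fraction of neighbours of \<open>v\<close> in \<open>A\<close>. No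
  spectral theory is needed: a union bound over all \<open>A\<close> gives \<open>\<Sum>v. \<pi>(v) (y v - x)\<^sup>2 = O(1/D)\<close>
  simultaneously for all \<open>A\<close>, because a mixture of exponential moments controls the sum of squared
  degree deviations up to probability \<open>exp (- 2 n)\<close>. Since \<open>y\<close> has mean \<open>x\<close> under \<open>\<pi>\<close>, the expected
  new value of \<open>\<pi>(A)\<close> differs from the mean-field value
  \<open>F x = x (1 - f (1 - x)) + (1 - x) f x\<close> only by \<open>O(1/D + \<bar>1 - 2 x\<bar> / sqrt D)\<close>. As
  \<open>x - F x \<ge> c x (1 - x) (1 - 2 x)\<close> for \<open>x \<le> 1/2\<close> and \<open>F x = O(x\<^sup>2)\<close>, the bias first grows
  geometrically, then the minority decays doubly exponentially. Finally a
  sparsity property of the graph shows that a minority of at most \<open>n D powr (-1/8)\<close> vertices loses in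
  each round a factor that is a fixed power of \<open>D\<close>, which takes \<open>O(log n / log D)\<close> rounds.

  If \<open>D = \<Omega>(sqrt n)\<close>, all error terms are of the order of the random fluctuations \<open>1 / sqrt n\<close>. Then a
  truncated exponential of the bias is a supermartingale-type potential, which gives the escape from
  a vanishing bias in \<open>O(log n)\<close> rounds; and as the bias is multiplied by at most a constant
  per round, a balanced start needs \<open>\<Omega>(log n)\<close> rounds.
\<close>

section \<open>Random subsets with independent elements\<close>

text \<open>The chain chooses its own configurations, so the estimate on y must hold for all
  \<open>A\<close> at once; taking \<open>A\<close> to be the neighbourhood of v makes y v = 1, so
  for D much smaller than n it cannot hold at every vertex. The weighted second moment is what
  survives. Squared degree deviations of different vertices are dependent, because two vertices
  share a pair; the mixture replaces the square by linear exponents, whose moments factor over the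
  pairs. The second obstacle is the order of quantifiers. The constant C may depend on f only,
  whereas the ratio \<eta> of the minimum degree to D depends on \<epsilon>. In \<pi>(v) (y v - x)^2
  the weight cancels one of the two inverse degrees, and vertices of degree below D/2 are paid for
  by their own degree deviation, so the variance bound and every quantity entering C are free of
  \<eta>. It returns only in requirements on the size of n and in the lower bound on the one-round
  variance used for (i). Finally, C is to be a function of f and not of k; this is consistent
  because k can be read off from f.\<close>

definition rand_subset :: "'a set \<Rightarrow> ('a \<Rightarrow> real) \<Rightarrow> 'a set pmf" where
  "rand_subset I q = map_pmf (\<lambda>X. {i \<in> I. X i}) (Pi_pmf I False (\<lambda>i. bernoulli_pmf (q i)))"

lemma gnp_eq_rand_subset: "gnp n p = rand_subset (vertex_pairs n) (\<lambda>_. p)"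
  by (simp add: gnp_def rand_subset_def)

lemma map_pmf_bool: "map_pmf P M = bernoulli_pmf (measure_pmf.prob M {x. P x})"
proof (rule pmf_eqI)
  fix b
  have 1: "measure_pmf.prob M {x. \<not> P x} = 1 - measure_pmf.prob M {x. P x}"
    using measure_pmf.prob_compl[of "{x. P x}" M] by (simp add: Compl_eq_Diff_UNIV[symmetric] Collect_neg_eq)
  have T: "P -` {True} = {x. P x}" and F: "P -` {False} = {x. \<not> P x}" by auto
  show "pmf (map_pmf P M) b = pmf (bernoulli_pmf (measure_pmf.prob M {x. P x})) b"
    by (cases b) (simp_all add: pmf_map T F 1)
qed

lemma rand_subset_cong:
  "(\<And>i. i \<in> I \<Longrightarrow> q i = q' i) \<Longrightarrow> finite I \<Longrightarrow> rand_subset I q = rand_subset I q'"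
  unfolding rand_subset_def by (intro map_pmf_cong Pi_pmf_cong) auto

lemma rand_subset_insert:
  assumes "finite I" "v \<notin> I"
  shows "rand_subset (insert v I) q =
    map_pmf (\<lambda>(b, S). if b then insert v S else S) (pair_pmf (bernoulli_pmf (q v)) (rand_subset I q))"
proof -
  have *: "pair_pmf (bernoulli_pmf (q v)) (rand_subset I q) =
     map_pmf (\<lambda>(b, X). (b, {i \<in> I. X i})) (pair_pmf (bernoulli_pmf (q v)) (Pi_pmf I False (\<lambda>i. bernoulli_pmf (q i))))"
    unfolding rand_subset_def by (simp add: pair_map_pmf2 apsnd_def map_prod_def)
  show ?thesis
    unfolding * unfolding rand_subset_def Pi_pmf_insert[OF assms] pmf.map_comp
    by (intro map_pmf_cong) (use assms in \<open>auto simp: fun_eq_iff split: if_splits\<close>)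
qed

text \<open>The events of different vertices read disjoint blocks of coordinates, so they are
  independent; the induction splits off the block of one vertex.\<close>

lemma blocks_rand_subset:
  fixes M :: "nat \<Rightarrow> 'a pmf" and t :: nat and V K :: "nat set"
  assumes "finite V" "finite K"
  shows "map_pmf (\<lambda>\<omega>. {v \<in> V. P v (\<lambda>i. \<omega> (t, v, i))}) (Pi_pmf ({t} \<times> V \<times> K) d (\<lambda>(t, v, i). M v))
    = rand_subset V (\<lambda>v. measure_pmf.prob (Pi_pmf K d (\<lambda>_. M v)) {s. P v s})"
  using assms(1)
proof induction
  case empty
  show ?case by (simp add: rand_subset_def)
next
  case (insert v V)
  let ?M = "\<lambda>(t::nat, v::nat, i::nat). M v"
  let ?q = "\<lambda>v. measure_pmf.prob (Pi_pmf K d (\<lambda>_. M v)) {s. P v s}"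
  have eq: "{t} \<times> insert v V \<times> K = ({t} \<times> {v} \<times> K) \<union> ({t} \<times> V \<times> K)" by auto
  have bl: "map_pmf (\<lambda>f. P v (\<lambda>i. f (t, v, i))) (Pi_pmf ({t} \<times> {v} \<times> K) d ?M) = bernoulli_pmf (?q v)"
  proof -
    have "Pi_pmf K d (\<lambda>_. M v) = map_pmf (\<lambda>g. g \<circ> (\<lambda>i. (t, v, i))) (Pi_pmf ({t} \<times> {v} \<times> K) d (\<lambda>_. M v))"
      by (rule Pi_pmf_bij_betw) (use assms in \<open>auto simp: bij_betw_def inj_on_def\<close>)
    also have "Pi_pmf ({t} \<times> {v} \<times> K) d (\<lambda>_. M v) = Pi_pmf ({t} \<times> {v} \<times> K) d ?M"
      by (rule Pi_pmf_cong) auto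
    finally have "map_pmf (P v) (Pi_pmf K d (\<lambda>_. M v)) =
        map_pmf (\<lambda>f. P v (\<lambda>i. f (t, v, i))) (Pi_pmf ({t} \<times> {v} \<times> K) d ?M)"
      by (simp add: pmf.map_comp o_def)
    thus ?thesis using map_pmf_bool[of "P v" "Pi_pmf K d (\<lambda>_. M v)"] by simp
  qed
  have "map_pmf (\<lambda>\<omega>. {w \<in> insert v V. P w (\<lambda>i. \<omega> (t, w, i))}) (Pi_pmf ({t} \<times> insert v V \<times> K) d ?M)
     = map_pmf (\<lambda>(f, g). {w \<in> insert v V. P w (\<lambda>i. if (t, w, i) \<in> {t} \<times> {v} \<times> K then f (t, w, i) else g (t, w, i))})
         (pair_pmf (Pi_pmf ({t} \<times> {v} \<times> K) d ?M) (Pi_pmf ({t} \<times> V \<times> K) d ?M))"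
    unfolding eq
    by (subst Pi_pmf_union) (use insert assms in \<open>auto simp: pmf.map_comp o_def case_prod_unfold\<close>)
  also have "\<dots> = map_pmf (\<lambda>(f, g). if P v (\<lambda>i. f (t, v, i)) then insert v {w \<in> V. P w (\<lambda>i. g (t, w, i))}
         else {w \<in> V. P w (\<lambda>i. g (t, w, i))})
         (pair_pmf (Pi_pmf ({t} \<times> {v} \<times> K) d ?M) (Pi_pmf ({t} \<times> V \<times> K) d ?M))"
  proof (rule map_pmf_cong[OF refl], clarify)
    fix f g assume "(f, g) \<in> set_pmf (pair_pmf (Pi_pmf ({t} \<times> {v} \<times> K) d ?M) (Pi_pmf ({t} \<times> V \<times> K) d ?M))"
    hence f: "f \<in> set_pmf (Pi_pmf ({t} \<times> {v} \<times> K) d ?M)" and g: "g \<in> set_pmf (Pi_pmf ({t} \<times> V \<times> K) d ?M)"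
      by auto
    \<comment> \<open>\<open>P v\<close> may look at indices outside \<open>K\<close>. There both
      the joint sample and the sample of a single block have the default value \<open>d\<close>, so
      the two agree everywhere.\<close>
    have f0: "f (t, v, i) = d" if "i \<notin> K" for i
      using f that set_Pi_pmf_subset[of "{t} \<times> {v} \<times> K" d ?M] assms by auto
    have g0: "g (t, v, i) = d" for i
      using g insert set_Pi_pmf_subset[of "{t} \<times> V \<times> K" d ?M] assms by auto
    have 1: "(\<lambda>i. if (t, v, i) \<in> {t} \<times> {v} \<times> K then f (t, v, i) else g (t, v, i)) = (\<lambda>i. f (t, v, i))"
      using f0 g0 by auto
    have 2: "(\<lambda>i. if (t, w, i) \<in> {t} \<times> {v} \<times> K then f (t, w, i) else g (t, w, i)) = (\<lambda>i. g (t, w, i))"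
      if "w \<in> V" for w using that insert by auto
    have "{w \<in> insert v V. P w (\<lambda>i. if (t, w, i) \<in> {t} \<times> {v} \<times> K then f (t, w, i) else g (t, w, i))}
      = {w. w = v \<and> P v (\<lambda>i. f (t, v, i))} \<union> {w \<in> V. P w (\<lambda>i. g (t, w, i))}"
      (is "?L = ?R")
    proof (rule set_eqI)
      fix w show "w \<in> ?L \<longleftrightarrow> w \<in> ?R"
        using 1 2[of w] insert.hyps by (cases "w = v") auto
    qed
    thus "{w \<in> insert v V. P w (\<lambda>i. if (t, w, i) \<in> {t} \<times> {v} \<times> K then f (t, w, i) else g (t, w, i))} =
      (if P v (\<lambda>i. f (t, v, i)) then insert v {w \<in> V. P w (\<lambda>i. g (t, w, i))}
         else {w \<in> V. P w (\<lambda>i. g (t, w, i))})" by auto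
  qed
  also have "\<dots> = map_pmf (\<lambda>(b, S). if b then insert v S else S)
     (pair_pmf (map_pmf (\<lambda>f. P v (\<lambda>i. f (t, v, i))) (Pi_pmf ({t} \<times> {v} \<times> K) d ?M))
        (map_pmf (\<lambda>g. {w \<in> V. P w (\<lambda>i. g (t, w, i))}) (Pi_pmf ({t} \<times> V \<times> K) d ?M)))"
    by (simp add: pair_map_pmf1 pair_map_pmf2 pmf.map_comp o_def case_prod_unfold apfst_def apsnd_def map_prod_def cong: if_cong)
  also have "\<dots> = rand_subset (insert v V) ?q"
    unfolding bl insert.IH rand_subset_insert[OF insert.hyps] ..
  finally show ?case .
qed

lemma prob_binomial_ge:
  assumes "0 \<le> x" "x \<le> 1"
  shows "measure_pmf.prob (binomial_pmf k x) {k div 2 + 1..} = vote_fun k x"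
proof -
  have "measure_pmf.prob (binomial_pmf k x) {k div 2 + 1..} = measure_pmf.prob (binomial_pmf k x) {k div 2 + 1..k}"
  proof (rule measure_prob_cong_0)
    fix i assume "i \<in> {k div 2 + 1..} - {k div 2 + 1..k}"
    hence "i > k" by auto
    thus "pmf (binomial_pmf k x) i = 0" using assms by (simp add: pmf_binomial binomial_eq_0)
  qed auto
  also have "\<dots> = (\<Sum>i = k div 2 + 1..k. pmf (binomial_pmf k x) i)"
    by (simp add: measure_measure_pmf_finite)
  also have "\<dots> = vote_fun k x"
    using assms by (simp add: pmf_binomial vote_fun_def)
  finally show ?thesis .
qed

lemma prob_samples_ge:
  fixes M :: "'a pmf"
  shows "measure_pmf.prob (Pi_pmf {..<k} d (\<lambda>_. M)) {s. card {i \<in> {..<k}. s i \<in> A} \<ge> k div 2 + 1}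
    = vote_fun k (measure_pmf.prob M A)"
proof -
  let ?x = "measure_pmf.prob M A"
  have 1: "Pi_pmf {..<k} (d \<in> A) (\<lambda>_. bernoulli_pmf ?x) = map_pmf (\<lambda>h. (\<lambda>a. a \<in> A) \<circ> h) (Pi_pmf {..<k} d (\<lambda>_. M))"
    by (subst Pi_pmf_map[symmetric]) (auto simp: map_pmf_bool)
  have "binomial_pmf k ?x = map_pmf (\<lambda>f. card {i \<in> {..<k}. f i}) (Pi_pmf {..<k} (d \<in> A) (\<lambda>_. bernoulli_pmf ?x))"
    by (rule binomial_pmf_altdef') auto
  also have "\<dots> = map_pmf (\<lambda>s. card {i \<in> {..<k}. s i \<in> A}) (Pi_pmf {..<k} d (\<lambda>_. M))"
    unfolding 1 by (simp add: pmf.map_comp o_def)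
  finally have "vote_fun k ?x = measure_pmf.prob (map_pmf (\<lambda>s. card {i \<in> {..<k}. s i \<in> A}) (Pi_pmf {..<k} d (\<lambda>_. M))) {k div 2 + 1..}"
    using prob_binomial_ge[of ?x k] by simp
  thus ?thesis by (simp add: vimage_def)
qed

section \<open>The voting process as a Markov chain\<close>

definition nfrac :: "nat set set \<Rightarrow> nat set \<Rightarrow> nat \<Rightarrow> real" where
  "nfrac E A v = card (nbrs E v \<inter> A) / deg E v"

text \<open>Ties keep the old opinion. A vertex of \<open>A\<close> therefore leaves only on a
  strict majority of samples outside \<open>A\<close>, which gives \<open>vote_fun k\<close> at one
  minus the fraction and not at the fraction itself.\<close>

definition next_prob :: "nat \<Rightarrow> nat set set \<Rightarrow> nat set \<Rightarrow> nat \<Rightarrow> real" where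
  "next_prob k E A v =
     (if v \<in> A then 1 - vote_fun k (1 - nfrac E A v) else vote_fun k (nfrac E A v))"

definition kern :: "nat \<Rightarrow> nat \<Rightarrow> nat set set \<Rightarrow> nat set \<Rightarrow> nat set pmf" where
  "kern k n E A = rand_subset {..<n} (next_prob k E A)"

primrec chain :: "nat \<Rightarrow> nat \<Rightarrow> nat set set \<Rightarrow> nat \<Rightarrow> nat set \<Rightarrow> nat set pmf" where
  "chain k n E 0 A = return_pmf A"
| "chain k n E (Suc t) A = bind_pmf (chain k n E t A) (kern k n E)"

text \<open>An isolated vertex of \<open>A\<close> samples itself and stays, while
  \<open>nfrac\<close> gives it the value 0 and \<open>next_prob\<close> would make it leave (for
  positive \<open>k\<close>). The two descriptions of a round agree on graphs without such
  vertices.\<close>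

definition nonisolated :: "nat \<Rightarrow> nat set set \<Rightarrow> bool" where
  "nonisolated n E \<longleftrightarrow> E \<subseteq> vertex_pairs n \<and> (\<forall>v<n. nbrs E v \<noteq> {})"

lemma nbrs_subset: "E \<subseteq> vertex_pairs n \<Longrightarrow> nbrs E v \<subseteq> {..<n}"
  by (auto simp: nbrs_def vertex_pairs_def)

lemma finite_nbrs: "E \<subseteq> vertex_pairs n \<Longrightarrow> finite (nbrs E v)"
  by (rule finite_subset[OF nbrs_subset]) auto

lemma best_of_step_kern:
  fixes t :: nat
  assumes "nonisolated n E"
  shows "map_pmf (\<lambda>\<omega>. best_of_step k n (\<lambda>v i. \<omega> (t, v, i)) A)
      (Pi_pmf ({t} \<times> {..<n} \<times> {..<k}) 0 (\<lambda>(t, v, i). sample_nbr E v)) = kern k n E A"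
proof -
  let ?P = "\<lambda>v s. if card {i \<in> {..<k}. s i \<in> A} \<ge> k div 2 + 1 then True
        else if card {i \<in> {..<k}. s i \<notin> A} \<ge> k div 2 + 1 then False
        else v \<in> A"
  have "map_pmf (\<lambda>\<omega>. best_of_step k n (\<lambda>v i. \<omega> (t, v, i)) A)
      (Pi_pmf ({t} \<times> {..<n} \<times> {..<k}) 0 (\<lambda>(t, v, i). sample_nbr E v)) =
      rand_subset {..<n} (\<lambda>v. measure_pmf.prob (Pi_pmf {..<k} 0 (\<lambda>_. sample_nbr E v)) {s. ?P v s})"
    unfolding best_of_step_def by (rule blocks_rand_subset[where P = ?P]) auto
  also have "\<dots> = rand_subset {..<n} (next_prob k E A)"
  proof (rule rand_subset_cong)
    fix v assume v: "v \<in> {..<n}"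
    have ne: "nbrs E v \<noteq> {}" and fin: "finite (nbrs E v)"
      using v assms finite_nbrs[of E n v] by (auto simp: nonisolated_def)
    have pA: "measure_pmf.prob (sample_nbr E v) A = nfrac E A v"
      using ne fin by (simp add: sample_nbr_def measure_pmf_of_set nfrac_def deg_def Int_commute)
    have "measure_pmf.prob (sample_nbr E v) (- A) = 1 - nfrac E A v"
      using measure_pmf.prob_compl[of A "sample_nbr E v"] by (simp add: pA Compl_eq_Diff_UNIV)
    note pC = this
    have card_sum: "card {i \<in> {..<k}. s i \<in> A} + card {i \<in> {..<k}. s i \<notin> A} = k" for s :: "nat \<Rightarrow> nat"
    proof -
      have "card ({i \<in> {..<k}. s i \<in> A} \<union> {i \<in> {..<k}. s i \<notin> A}) =
        card {i \<in> {..<k}. s i \<in> A} + card {i \<in> {..<k}. s i \<notin> A}"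
        by (rule card_Un_disjoint) auto
      moreover have "{i \<in> {..<k}. s i \<in> A} \<union> {i \<in> {..<k}. s i \<notin> A} = {..<k}" by auto
      ultimately show ?thesis by simp
    qed
    show "measure_pmf.prob (Pi_pmf {..<k} 0 (\<lambda>_. sample_nbr E v)) {s. ?P v s} = next_prob k E A v"
    proof (cases "v \<in> A")
      case False
      hence "{s. ?P v s} = {s. card {i \<in> {..<k}. s i \<in> A} \<ge> k div 2 + 1}" by auto
      thus ?thesis using False prob_samples_ge[of k 0 "sample_nbr E v" A] by (simp add: next_prob_def pA)
    next
      case True
      \<comment> \<open>The two counts add up to \<open>k\<close>, so both majorities cannot occur
        together; for \<open>v\<close> in \<open>A\<close> the nested conditional means that there
        is no opposing majority.\<close>
      have P: "?P v s \<longleftrightarrow> \<not> card {i \<in> {..<k}. s i \<in> - A} \<ge> k div 2 + 1" for s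
        using True card_sum[of s] by auto
      have "measure_pmf.prob (Pi_pmf {..<k} 0 (\<lambda>_. sample_nbr E v)) {s. ?P v s} =
        measure_pmf.prob (Pi_pmf {..<k} 0 (\<lambda>_. sample_nbr E v)) (UNIV - {s. card {i \<in> {..<k}. s i \<in> - A} \<ge> k div 2 + 1})"
        unfolding P by (rule arg_cong[where f = "measure_pmf.prob _"]) auto
      also have "\<dots> = 1 - vote_fun k (1 - nfrac E A v)"
        using measure_pmf.prob_compl[of "{s. card {i \<in> {..<k}. s i \<in> - A} \<ge> k div 2 + 1}" "Pi_pmf {..<k} 0 (\<lambda>_. sample_nbr E v)"]
          prob_samples_ge[of k 0 "sample_nbr E v" "- A"] by (simp add: pC)
      finally show ?thesis using True by (simp add: next_prob_def)
    qed
  qed auto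
  finally show ?thesis by (simp add: kern_def)
qed

lemma best_of_cong:
  "(\<And>x. x \<in> {..<t} \<times> {..<n} \<times> {..<k} \<Longrightarrow> \<omega> x = \<omega>' x) \<Longrightarrow> best_of k n A \<omega> t = best_of k n A \<omega>' t"
proof (induction t)
  case (Suc t)
  have IH: "best_of k n A \<omega> t = best_of k n A \<omega>' t"
    by (rule Suc.IH) (use Suc.prems in auto)
  have 1: "{i \<in> {..<k}. \<omega> (t, v, i) \<in> B} = {i \<in> {..<k}. \<omega>' (t, v, i) \<in> B}" if "v < n" for v B
    using Suc.prems that by auto
  have 2: "{i \<in> {..<k}. \<omega> (t, v, i) \<notin> B} = {i \<in> {..<k}. \<omega>' (t, v, i) \<notin> B}" if "v < n" for v B
    using Suc.prems that by auto
  show ?case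
    unfolding best_of.simps IH unfolding best_of_step_def
    by (rule Collect_cong, rule conj_cong[OF refl]) (simp only: lessThan_iff 1[unfolded lessThan_iff] 2[unfolded lessThan_iff])
qed simp

text \<open>The state at time \<open>t\<close> reads only samples of rounds before \<open>t\<close>,
  and those of round \<open>t\<close> are independent of them: this is the Markov property.\<close>

lemma best_of_chain:
  assumes "nonisolated n E"
  shows "map_pmf (\<lambda>\<omega>. best_of k n A \<omega> t)
      (Pi_pmf ({..<t} \<times> {..<n} \<times> {..<k}) 0 (\<lambda>(t, v, i). sample_nbr E v)) = chain k n E t A"
proof (induction t)
  case 0
  show ?case by simp
next
  case (Suc t)
  let ?q = "\<lambda>(t::nat, v, i::nat). sample_nbr E v" and ?S = "{..<n} \<times> {..<k}"
  have eq: "{..<Suc t} \<times> ?S = ({..<t} \<times> ?S) \<union> ({t} \<times> ?S)" by (auto simp: less_Suc_eq)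
  let ?J = "{..<t} \<times> ?S"
  have "map_pmf (\<lambda>\<omega>. best_of k n A \<omega> (Suc t)) (Pi_pmf ({..<Suc t} \<times> ?S) 0 ?q) =
     map_pmf (\<lambda>(f, g). best_of k n A (\<lambda>x. if x \<in> ?J then f x else g x) (Suc t))
       (pair_pmf (Pi_pmf ?J 0 ?q) (Pi_pmf ({t} \<times> ?S) 0 ?q))"
    unfolding eq by (subst Pi_pmf_union) (auto simp: pmf.map_comp o_def case_prod_unfold)
  also have "\<dots> = map_pmf (\<lambda>(f, g). best_of_step k n (\<lambda>v i. g (t, v, i)) (best_of k n A f t))
       (pair_pmf (Pi_pmf ?J 0 ?q) (Pi_pmf ({t} \<times> ?S) 0 ?q))"
  proof (rule map_pmf_cong[OF refl], clarify)
    fix f g :: "nat \<times> nat \<times> nat \<Rightarrow> nat"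
    have "best_of k n A (\<lambda>x. if x \<in> ?J then f x else g x) t = best_of k n A f t"
      by (rule best_of_cong) auto
    thus "best_of k n A (\<lambda>x. if x \<in> ?J then f x else g x) (Suc t) =
      best_of_step k n (\<lambda>v i. g (t, v, i)) (best_of k n A f t)" by simp
  qed
  also have "\<dots> = bind_pmf (map_pmf (\<lambda>f. best_of k n A f t) (Pi_pmf ?J 0 ?q))
      (\<lambda>B. map_pmf (\<lambda>g. best_of_step k n (\<lambda>v i. g (t, v, i)) B) (Pi_pmf ({t} \<times> ?S) 0 ?q))"
    by (simp add: map_pmf_def pair_pmf_def bind_assoc_pmf bind_return_pmf)
  also have "\<dots> = chain k n E (Suc t) A"
    unfolding Suc.IH best_of_step_kern[OF assms] by simp
  finally show ?case .
qed

text \<open>The process lives on an infinite product, but the first \<open>t\<close> rounds read the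
  finitely many coordinates in \<open>J\<close>. Overwriting the others by 0 gives a map with
  countably many values, so measurability and the law can be checked at single points, where both
  sides are products over \<open>J\<close>.\<close>

lemma vote_space_restrict:
  fixes k n t :: nat and X :: "(nat \<times> nat \<times> nat \<Rightarrow> nat) set"
  defines "J \<equiv> {..<t} \<times> {..<n} \<times> {..<k}"
  defines "r \<equiv> (\<lambda>\<omega> x. if x \<in> J then \<omega> x else 0)"
  shows "{\<omega> \<in> space (vote_space k n E). r \<omega> \<in> X} \<in> sets (vote_space k n E)" (is ?A)
    and "measure (vote_space k n E) {\<omega> \<in> space (vote_space k n E). r \<omega> \<in> X} =
      measure_pmf.prob (Pi_pmf J 0 (\<lambda>(t, v, i). sample_nbr E v)) X" (is ?B)
proof -
  let ?I = "(UNIV :: nat set) \<times> {..<n} \<times> {..<k}"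
  let ?q = "\<lambda>(t::nat, v, i::nat). sample_nbr E v"
  let ?M = "\<lambda>x. measure_pmf (?q x)"
  interpret product_prob_space ?M ?I
    by (rule product_prob_spaceI) (rule measure_pmf.prob_space_axioms)
  have V: "vote_space k n E = PiM ?I ?M" unfolding vote_space_def by (simp add: case_prod_unfold)
  \<comment> \<open>\<open>F\<close> contains the range of \<open>r\<close>; it is countable because
    its members vanish off the finite set \<open>J\<close>.\<close>
  define F where "F = {h :: nat \<times> nat \<times> nat \<Rightarrow> nat. \<forall>x. x \<notin> J \<longrightarrow> h x = 0}"
  have J: "finite J" "J \<subseteq> ?I" by (auto simp: J_def)
  have "F \<subseteq> PiE_dflt J 0 (\<lambda>_. UNIV)" by (auto simp: F_def PiE_dflt_def)
  moreover have "countable (PiE_dflt J 0 (\<lambda>_. UNIV :: nat set))"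
  proof -
    have "PiE_dflt J 0 (\<lambda>_. UNIV :: nat set) \<subseteq> (\<lambda>f x. if x \<in> J then f x else 0) ` (PiE J (\<lambda>_. UNIV))"
    proof
      fix h :: "nat \<times> nat \<times> nat \<Rightarrow> nat" assume "h \<in> PiE_dflt J 0 (\<lambda>_. UNIV)"
      hence "h = (\<lambda>x. if x \<in> J then restrict h J x else 0)" by (auto simp: PiE_dflt_def fun_eq_iff)
      thus "h \<in> (\<lambda>f x. if x \<in> J then f x else 0) ` (PiE J (\<lambda>_. UNIV))" by (intro image_eqI[of _ _ "restrict h J"]) auto
    qed
    thus ?thesis by (rule countable_subset) (use J in \<open>auto intro!: countable_image countable_PiE\<close>)
  qed
  ultimately have cF: "countable F" by (rule countable_subset)
  have rF: "r \<omega> \<in> F" for \<omega> by (auto simp: r_def F_def)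
  have pt: "{\<omega> \<in> space (PiM ?I ?M). r \<omega> = h} = {\<omega> \<in> space (PiM ?I ?M). \<forall>x\<in>J. \<omega> x \<in> {h x}}" if "h \<in> F" for h
    using that by (auto simp: r_def F_def fun_eq_iff)
  have ptm: "{\<omega> \<in> space (PiM ?I ?M). r \<omega> = h} \<in> sets (PiM ?I ?M)" if "h \<in> F" for h
    unfolding pt[OF that] by (rule sets.sets_Collect_finite_All) (use J in \<open>auto intro!: sets_Collect_single\<close>)
  have meas: "r \<in> measurable (PiM ?I ?M) (count_space F)"
    unfolding measurable_count_space_eq_countable[OF cF]
  proof (intro conjI ballI)
    fix h assume h: "h \<in> F"
    have "r -` {h} \<inter> space (PiM ?I ?M) = {\<omega> \<in> space (PiM ?I ?M). r \<omega> = h}" by auto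
    thus "r -` {h} \<inter> space (PiM ?I ?M) \<in> sets (PiM ?I ?M)" using ptm[OF h] by simp
  qed (use rF in auto)
  have eqm: "distr (PiM ?I ?M) (count_space F) r = restrict_space (measure_pmf (Pi_pmf J 0 ?q)) F"
  proof (rule measure_eqI_countable)
    show "sets (distr (PiM ?I ?M) (count_space F) r) = Pow F" by simp
    show "sets (restrict_space (measure_pmf (Pi_pmf J 0 ?q)) F) = Pow F"
      by (auto simp: sets_restrict_space)
    show "countable F" by (fact cF)
    fix h assume h: "h \<in> F"
    have "emeasure (distr (PiM ?I ?M) (count_space F) r) {h} = emeasure (PiM ?I ?M) {\<omega> \<in> space (PiM ?I ?M). r \<omega> = h}"
      using h meas by (subst emeasure_distr) (auto intro!: arg_cong[where f = "emeasure _"])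
    also have "\<dots> = (\<Prod>x\<in>J. emeasure (?M x) {h x})"
      unfolding pt[OF h] by (rule emeasure_PiM_Collect) (use J in auto)
    also have "\<dots> = (\<Prod>x\<in>J. ennreal (pmf (?q x) (h x)))"
      by (rule prod.cong) (auto simp: emeasure_pmf_single)
    also have "\<dots> = ennreal (pmf (Pi_pmf J 0 ?q) h)"
      using h J by (subst pmf_Pi') (auto simp: F_def prod_ennreal)
    also have "\<dots> = emeasure (restrict_space (measure_pmf (Pi_pmf J 0 ?q)) F) {h}"
      using h by (subst emeasure_restrict_space) (auto simp: emeasure_pmf_single)
    finally show "emeasure (distr (PiM ?I ?M) (count_space F) r) {h} =
      emeasure (restrict_space (measure_pmf (Pi_pmf J 0 ?q)) F) {h}" .
  qed
  have eqX: "{\<omega> \<in> space (PiM ?I ?M). r \<omega> \<in> X} = r -` (X \<inter> F) \<inter> space (PiM ?I ?M)"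
    using rF by auto
  show ?A unfolding V eqX by (rule measurable_sets[OF meas]) auto
  have "measure (PiM ?I ?M) {\<omega> \<in> space (PiM ?I ?M). r \<omega> \<in> X} = measure (distr (PiM ?I ?M) (count_space F) r) (X \<inter> F)"
    unfolding eqX by (subst measure_distr[OF meas]) auto
  also have "\<dots> = measure_pmf.prob (Pi_pmf J 0 ?q) (X \<inter> F)"
    unfolding eqm by (subst measure_restrict_space) auto
  also have "\<dots> = measure_pmf.prob (Pi_pmf J 0 ?q) X"
    by (rule measure_prob_cong_0) (use J in \<open>auto simp: F_def intro!: pmf_Pi_outside\<close>)
  finally show ?B unfolding V .
qed

lemma best_of_prob:
  assumes "nonisolated n E"
  shows "{\<omega> \<in> space (vote_space k n E). best_of k n A \<omega> t \<in> X} \<in> sets (vote_space k n E)"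
    and "measure (vote_space k n E) {\<omega> \<in> space (vote_space k n E). best_of k n A \<omega> t \<in> X} =
      measure_pmf.prob (chain k n E t A) X"
proof -
  let ?J = "{..<t} \<times> {..<n} \<times> {..<k}"
  let ?X = "{\<omega>. best_of k n A \<omega> t \<in> X}"
  have *: "{\<omega> \<in> space (vote_space k n E). best_of k n A \<omega> t \<in> X} =
     {\<omega> \<in> space (vote_space k n E). (\<lambda>x. if x \<in> ?J then \<omega> x else 0) \<in> ?X}"
  proof (rule Collect_cong)
    fix \<omega>
    have "best_of k n A \<omega> t = best_of k n A (\<lambda>x. if x \<in> ?J then \<omega> x else 0) t"
      by (rule best_of_cong) simp
    thus "(\<omega> \<in> space (vote_space k n E) \<and> best_of k n A \<omega> t \<in> X) \<longleftrightarrow>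
       (\<omega> \<in> space (vote_space k n E) \<and> (\<lambda>x. if x \<in> ?J then \<omega> x else 0) \<in> ?X)"
      by simp
  qed
  show "{\<omega> \<in> space (vote_space k n E). best_of k n A \<omega> t \<in> X} \<in> sets (vote_space k n E)"
    by (subst *, rule vote_space_restrict(1))
  have "measure (vote_space k n E) {\<omega> \<in> space (vote_space k n E). best_of k n A \<omega> t \<in> X} =
      measure_pmf.prob (Pi_pmf ?J 0 (\<lambda>(t, v, i). sample_nbr E v)) ?X"
    by (subst *, rule vote_space_restrict(2))
  also have "\<dots> = measure_pmf.prob (chain k n E t A) X"
    by (simp only: best_of_chain[OF assms, symmetric] measure_map_pmf vimage_def)
  finally show "measure (vote_space k n E) {\<omega> \<in> space (vote_space k n E). best_of k n A \<omega> t \<in> X} =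
      measure_pmf.prob (chain k n E t A) X" .
qed

lemma prob_space_vote_space: "prob_space (vote_space k n E)"
  unfolding vote_space_def by (rule prob_space_PiM) (auto simp: case_prod_unfold intro: measure_pmf.prob_space_axioms)

section \<open>Events about the consensus time in terms of the chain\<close>

lemma T_cons_le_iff: "T_cons k n A \<omega> \<le> enat t \<longleftrightarrow> (\<exists>s\<le>t. best_of k n A \<omega> s \<in> {{}, {..<n}})"
proof
  let ?S = "{enat t | t. best_of k n A \<omega> t \<in> {{}, {..<n}}}"
  assume le: "T_cons k n A \<omega> \<le> enat t"
  have "?S \<noteq> {}"
  proof
    assume "?S = {}"
    hence "T_cons k n A \<omega> = Inf {}" unfolding T_cons_def by simp
    thus False using le by (simp add: top_enat_def)
  qed
  then obtain x where "x \<in> ?S" by (rule ex_in_conv[THEN iffD2, THEN exE])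
  hence "Inf ?S \<in> ?S" by (rule wellorder_InfI)
  then obtain s where "Inf ?S = enat s" "best_of k n A \<omega> s \<in> {{}, {..<n}}" by auto
  thus "\<exists>s\<le>t. best_of k n A \<omega> s \<in> {{}, {..<n}}" using le by (auto simp: T_cons_def)
next
  assume "\<exists>s\<le>t. best_of k n A \<omega> s \<in> {{}, {..<n}}"
  then obtain s where s: "s \<le> t" "best_of k n A \<omega> s \<in> {{}, {..<n}}" by auto
  have "T_cons k n A \<omega> \<le> enat s" unfolding T_cons_def by (rule Inf_lower) (use s in auto)
  thus "T_cons k n A \<omega> \<le> enat t" using s by (meson enat_ord_simps(1) order_trans)
qed

lemma ereal_of_enat_le_iff:
  assumes "b \<ge> 0"
  shows "ereal_of_enat x \<le> ereal b \<longleftrightarrow> x \<le> enat (nat \<lfloor>b\<rfloor>)"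
proof (cases x)
  case (enat j)
  have "real j \<le> b \<longleftrightarrow> j \<le> nat \<lfloor>b\<rfloor>"
    using assms by (metis le_nat_floor of_nat_floor of_nat_le_iff order_trans)
  thus ?thesis using enat by simp
qed auto

lemma T_cons_le_sets:
  assumes "nonisolated n E"
  shows "{\<omega> \<in> space (vote_space k n E). T_cons k n A \<omega> \<le> enat t} \<in> sets (vote_space k n E)"
  unfolding T_cons_le_iff
  using best_of_prob(1)[OF assms, of k A _ "{{}, {..<n}}"] by (intro sets.sets_Collect_countable_Ex) (auto intro!: sets.sets_Collect_conj)

lemma prob_T_le_ge:
  assumes "nonisolated n E" "b \<ge> real t"
  shows "prob_T_le k n E A b \<ge> measure_pmf.prob (chain k n E t A) {{}, {..<n}}"
proof -
  interpret prob_space "vote_space k n E" by (rule prob_space_vote_space)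
  have b: "b \<ge> 0" using assms(2) by linarith
  have "t \<le> nat \<lfloor>b\<rfloor>" using assms(2) by (simp add: le_nat_floor)
  hence "{\<omega> \<in> space (vote_space k n E). best_of k n A \<omega> t \<in> {{}, {..<n}}} \<subseteq>
    {\<omega> \<in> space (vote_space k n E). T_cons k n A \<omega> \<le> enat (nat \<lfloor>b\<rfloor>)}"
    unfolding T_cons_le_iff by auto
  from finite_measure_mono[OF this T_cons_le_sets[OF assms(1)]]
  show ?thesis
    unfolding prob_T_le_def ereal_of_enat_le_iff[OF b] best_of_prob(2)[OF assms(1)] .
qed

text \<open>Union bound over the rounds before \<open>t\<close> at which consensus could be
  present.\<close>

lemma prob_T_ge_ge:
  assumes "nonisolated n E" "b \<le> real t"
  shows "prob_T_ge k n E A b \<ge> 1 - (\<Sum>s<t. measure_pmf.prob (chain k n E s A) {{}, {..<n}})"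
proof -
  interpret prob_space "vote_space k n E" by (rule prob_space_vote_space)
  let ?C = "\<lambda>s. {\<omega> \<in> space (vote_space k n E). best_of k n A \<omega> s \<in> {{}, {..<n}}}"
  let ?G = "{\<omega> \<in> space (vote_space k n E). ereal_of_enat (T_cons k n A \<omega>) \<ge> ereal b}"
  have C: "?C s \<in> sets (vote_space k n E)" for s by (rule best_of_prob(1)[OF assms(1)])
  have G: "?G \<in> sets (vote_space k n E)"
  proof (cases "\<exists>m. b \<le> real m")
    case True
    \<comment> \<open>Rounding the real bound up to the least admissible natural number exhibits the
      event as the complement of a finite union of measurable ones.\<close>
    define m where "m = (LEAST m. b \<le> real m)"
    have m1: "b \<le> real m" unfolding m_def by (rule LeastI_ex[OF True])
    have m2: "b \<le> real j \<longleftrightarrow> m \<le> j" for j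
      using m1 Least_le[of "\<lambda>m. b \<le> real m" j] by (auto simp: m_def)
    have "ereal_of_enat x \<ge> ereal b \<longleftrightarrow> x \<ge> enat m" for x
      by (cases x) (auto simp: m2)
    hence G': "?G = {\<omega> \<in> space (vote_space k n E). T_cons k n A \<omega> \<ge> enat m}" by simp
    have "T_cons k n A \<omega> \<ge> enat m \<longleftrightarrow> \<not> (\<exists>j<m. T_cons k n A \<omega> \<le> enat j)" for \<omega>
    proof (cases "T_cons k n A \<omega>")
      case (enat j) thus ?thesis by (auto simp: not_less[symmetric])
    qed auto
    hence "?G = space (vote_space k n E) - (\<Union>j<m. {\<omega> \<in> space (vote_space k n E). T_cons k n A \<omega> \<le> enat j})"
      unfolding G' by auto
    thus ?thesis using T_cons_le_sets[OF assms(1)] by auto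
  next
    case False
    thus ?thesis using real_arch_simple by blast
  qed
  have "space (vote_space k n E) - (\<Union>s<t. ?C s) \<subseteq> ?G"
  proof
    fix \<omega> assume w: "\<omega> \<in> space (vote_space k n E) - (\<Union>s<t. ?C s)"
    hence nT: "\<not> T_cons k n A \<omega> \<le> enat s" if "s < t" for s
      using that unfolding T_cons_le_iff by auto
    have "ereal b \<le> ereal_of_enat (T_cons k n A \<omega>)"
    proof (cases "T_cons k n A \<omega>")
      case (enat j)
      hence "\<not> j < t" using nT[of j] by auto
      thus ?thesis using enat assms(2) by simp
    qed auto
    thus "\<omega> \<in> ?G" using w by auto
  qed
  hence "prob (space (vote_space k n E) - (\<Union>s<t. ?C s)) \<le> prob ?G"
    by (rule finite_measure_mono[OF _ G])
  moreover have "prob (space (vote_space k n E) - (\<Union>s<t. ?C s)) = 1 - prob (\<Union>s<t. ?C s)"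
    by (rule prob_compl) (use C in auto)
  moreover have "prob (\<Union>s<t. ?C s) \<le> (\<Sum>s<t. prob (?C s))"
    by (rule finite_measure_subadditive_finite) (use C in auto)
  ultimately show ?thesis
    unfolding prob_T_ge_def using best_of_prob(2)[OF assms(1), of k A _ "{{}, {..<n}}"] by simp
qed

section \<open>Exponential moments and tail bounds\<close>

lemma expectation_mono_pmf:
  fixes f g :: "'a \<Rightarrow> real"
  assumes "finite (set_pmf M)" "\<And>x. x \<in> set_pmf M \<Longrightarrow> f x \<le> g x"
  shows "measure_pmf.expectation M f \<le> measure_pmf.expectation M g"
  using assms by (intro integral_mono_AE) (auto simp: AE_measure_pmf_iff integrable_measure_pmf_finite)

lemma expectation_cong_pmf:
  fixes f g :: "'a \<Rightarrow> real"
  assumes "\<And>x. x \<in> set_pmf M \<Longrightarrow> f x = g x"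
  shows "measure_pmf.expectation M f = measure_pmf.expectation M g"
  using assms by (intro integral_cong_AE) (auto simp: AE_measure_pmf_iff)

lemma prob_eq_expectation: "measure_pmf.prob M S = measure_pmf.expectation M (indicat_real S)"
  by simp

lemma prob_le_expectation:
  fixes f :: "'a \<Rightarrow> real"
  assumes "finite (set_pmf M)" "\<And>x. x \<in> set_pmf M \<Longrightarrow> 0 \<le> f x"
    and "\<And>x. x \<in> set_pmf M \<Longrightarrow> x \<in> S \<Longrightarrow> 1 \<le> f x"
  shows "measure_pmf.prob M S \<le> measure_pmf.expectation M f"
  unfolding prob_eq_expectation using assms
  by (intro expectation_mono_pmf) (auto split: split_indicator)

lemma prob_mono_support:
  assumes "\<And>x. x \<in> set_pmf M \<Longrightarrow> x \<in> S \<Longrightarrow> x \<in> T"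
  shows "measure_pmf.prob M S \<le> measure_pmf.prob M T"
proof -
  have "measure_pmf.prob M S = measure_pmf.prob M (S \<inter> set_pmf M)"
    by (simp add: measure_Int_set_pmf)
  also have "\<dots> \<le> measure_pmf.prob M T"
    by (rule measure_pmf.finite_measure_mono) (use assms in auto)
  finally show ?thesis .
qed

lemma prob_Un_le: "measure_pmf.prob M (S \<union> T) \<le> measure_pmf.prob M S + measure_pmf.prob M T"
  by (rule measure_Un_le) auto

lemma prob_not: "measure_pmf.prob M {x. \<not> P x} = 1 - measure_pmf.prob M {x. P x}"
  using measure_pmf.prob_compl[of "{x. P x}" M] by (simp add: Compl_eq_Diff_UNIV[symmetric] Collect_neg_eq)

lemma prob_bind_pmf:
  assumes "finite (set_pmf M)"
  shows "measure_pmf.prob (bind_pmf M N) S = measure_pmf.expectation M (\<lambda>x. measure_pmf.prob (N x) S)"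
proof -
  have "ennreal (measure_pmf.prob (bind_pmf M N) S) = (\<integral>\<^sup>+x. emeasure (N x) S \<partial>M)"
    by (simp flip: measure_pmf.emeasure_eq_measure)
  also have "\<dots> = (\<integral>\<^sup>+x. ennreal (measure_pmf.prob (N x) S) \<partial>M)"
    by (simp add: measure_pmf.emeasure_eq_measure)
  also have "\<dots> = ennreal (measure_pmf.expectation M (\<lambda>x. measure_pmf.prob (N x) S))"
    by (rule nn_integral_eq_integral) (use assms in \<open>auto intro: integrable_measure_pmf_finite\<close>)
  finally show ?thesis by (subst (asm) ennreal_inj) (auto intro!: integral_nonneg_AE)
qed

lemma set_rand_subset: "finite I \<Longrightarrow> set_pmf (rand_subset I q) \<subseteq> Pow I"
  unfolding rand_subset_def by auto

lemma finite_set_rand_subset: "finite I \<Longrightarrow> finite (set_pmf (rand_subset I q))"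
  by (rule finite_subset[OF set_rand_subset]) auto

lemma rand_subset_mgf:
  fixes c :: "'a \<Rightarrow> real"
  assumes I: "finite I" and q: "\<forall>i\<in>I. 0 \<le> q i \<and> q i \<le> 1"
  shows "measure_pmf.expectation (rand_subset I q) (\<lambda>B. exp (\<Sum>i\<in>B. c i)) =
    (\<Prod>i\<in>I. 1 - q i + q i * exp (c i))"
proof -
  have "measure_pmf.expectation (rand_subset I q) (\<lambda>B. exp (\<Sum>i\<in>B. c i)) =
     measure_pmf.expectation (Pi_pmf I False (\<lambda>i. bernoulli_pmf (q i))) (\<lambda>X. exp (\<Sum>i\<in>{i\<in>I. X i}. c i))"
    unfolding rand_subset_def by simp
  also have "(\<lambda>X. exp (\<Sum>i\<in>{i\<in>I. X i}. c i)) = (\<lambda>X. \<Prod>i\<in>I. (if X i then exp (c i) else 1))"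
  proof
    fix X
    have "(\<Sum>i\<in>{i\<in>I. X i}. c i) = (\<Sum>i\<in>I. if X i then c i else 0)"
      using I by (simp add: sum.inter_filter)
    thus "exp (\<Sum>i\<in>{i\<in>I. X i}. c i) = (\<Prod>i\<in>I. (if X i then exp (c i) else 1))"
      using I by (simp add: exp_sum if_distrib cong: if_cong)
  qed
  also have "measure_pmf.expectation (Pi_pmf I False (\<lambda>i. bernoulli_pmf (q i))) (\<lambda>X. \<Prod>i\<in>I. (if X i then exp (c i) else 1))
     = (\<Prod>i\<in>I. measure_pmf.expectation (bernoulli_pmf (q i)) (\<lambda>b. if b then exp (c i) else 1))"
    using I by (intro expectation_prod_Pi_pmf[of I _ "\<lambda>i b. if b then exp (c i) else 1"])
      (auto intro: integrable_measure_pmf_finite)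
  also have "\<dots> = (\<Prod>i\<in>I. 1 - q i + q i * exp (c i))"
    using q by (intro prod.cong refl) (auto simp: algebra_simps)
  finally show ?thesis .
qed

lemma rand_subset_mgf_le:
  fixes c :: "'a \<Rightarrow> real"
  assumes I: "finite I" and q: "\<forall>i\<in>I. 0 \<le> q i \<and> q i \<le> 1"
  shows "measure_pmf.expectation (rand_subset I q) (\<lambda>B. exp (\<Sum>i\<in>B. c i)) \<le> exp (\<Sum>i\<in>I. q i * (exp (c i) - 1))"
proof -
  have "(\<Prod>i\<in>I. 1 - q i + q i * exp (c i)) \<le> (\<Prod>i\<in>I. exp (q i * (exp (c i) - 1)))"
  proof (rule prod_mono, safe)
    fix i assume i: "i \<in> I"
    show "0 \<le> 1 - q i + q i * exp (c i)" using bspec[OF q i] by simp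
    show "1 - q i + q i * exp (c i) \<le> exp (q i * (exp (c i) - 1))"
      using exp_ge_add_one_self[of "q i * (exp (c i) - 1)"] by (simp add: algebra_simps)
  qed
  thus ?thesis unfolding rand_subset_mgf[OF assms] using I by (simp add: exp_sum)
qed

lemma exp_le_quadratic:
  fixes y :: real
  assumes "\<bar>y\<bar> \<le> 1"
  shows "exp y \<le> 1 + y + y\<^sup>2"
proof (cases "y \<ge> 0")
  case True
  thus ?thesis using exp_bound[of y] assms by simp
next
  case False
  define s where "s = - y"
  have s: "0 \<le> s" "s \<le> 1" using False assms by (auto simp: s_def)
  have "1 + s \<le> exp s" by (rule exp_ge_add_one_self)
  have "1 \<le> (1 + s) * (1 - s + s\<^sup>2)"
    using s by (simp add: algebra_simps power2_eq_square)
  also have "\<dots> \<le> exp s * (1 - s + s\<^sup>2)"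
    using s by (intro mult_right_mono) (auto intro: exp_ge_add_one_self)
  finally have "exp (- s) \<le> 1 - s + s\<^sup>2" by (simp add: exp_minus field_simps)
  thus ?thesis by (simp add: s_def)
qed

text \<open>The Taylor coefficient 1/2 fails for negative \<open>y\<close>; the coefficient 1/4
  works for both signs down to -1.\<close>

lemma exp_ge_quadratic:
  fixes y :: real
  assumes "- 1 \<le> y"
  shows "1 + y + y\<^sup>2 / 4 \<le> exp y"
proof (cases "y \<ge> 0")
  case True
  have "1 + y + y\<^sup>2 / 2 \<le> exp y" by (rule exp_lower_Taylor_quadratic[OF True])
  thus ?thesis using zero_le_power2[of y] by linarith
next
  case False
  let ?h = "\<lambda>y::real. exp y - 1 - y - y\<^sup>2 / 4"
  have "?h y \<ge> ?h 0"
  proof (rule DERIV_nonpos_imp_nonincreasing[of y 0 ?h])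
    fix x :: real assume x: "y \<le> x" "x \<le> 0"
    define s where "s = - x"
    have s: "0 \<le> s" "s \<le> 1" using x assms by (auto simp: s_def)
    have "1 \<le> (1 + s) * (1 - s / 2)"
      using s mult_left_le[of s s] by (simp add: algebra_simps)
    also have "\<dots> \<le> exp s * (1 - s / 2)"
      using s by (intro mult_right_mono) (auto intro: exp_ge_add_one_self)
    finally have "exp (- s) \<le> 1 - s / 2" by (simp add: exp_minus field_simps)
    hence le: "exp x - 1 - x / 2 \<le> 0" by (simp add: s_def)
    have "(?h has_real_derivative (exp x - 1 - x / 2)) (at x)"
      by (auto intro!: derivative_eq_intros)
    thus "\<exists>d. (?h has_real_derivative d) (at x) \<and> d \<le> 0" using le by blast
  qed (use False in auto)
  thus ?thesis by simp
qed

lemma rand_subset_mgf_centered: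
  fixes c :: "'a \<Rightarrow> real"
  assumes I: "finite I" and q: "\<forall>i\<in>I. 0 \<le> q i \<and> q i \<le> 1"
    and c: "\<forall>i\<in>I. \<bar>c i\<bar> \<le> 1"
  shows "measure_pmf.expectation (rand_subset I q) (\<lambda>B. exp (\<Sum>i\<in>B. c i))
     \<le> exp ((\<Sum>i\<in>I. q i * c i) + (\<Sum>i\<in>I. q i * (c i)\<^sup>2))"
proof -
  have "(\<Sum>i\<in>I. q i * (exp (c i) - 1)) \<le> (\<Sum>i\<in>I. q i * (c i + (c i)\<^sup>2))"
  proof (intro sum_mono mult_left_mono)
    fix i assume "i \<in> I"
    thus "exp (c i) - 1 \<le> c i + (c i)\<^sup>2" "0 \<le> q i" using exp_le_quadratic[of "c i"] q c by auto
  qed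
  also have "\<dots> = (\<Sum>i\<in>I. q i * c i) + (\<Sum>i\<in>I. q i * (c i)\<^sup>2)"
    by (simp add: distrib_left sum.distrib)
  finally show ?thesis using rand_subset_mgf_le[OF I q, of c] by (meson exp_le_cancel_iff order_trans)
qed

text \<open>Each factor is centred by pulling out exp (q c). Averaging the quadratic lower bound
  over the two centred values gives 1 + v/4, where v = q (1 - q) c^2 is the variance, and exp (v/5)
  \<le> 1 + v/4 for v \<le> 1.\<close>

lemma rand_subset_mgf_lower:
  fixes c :: "'a \<Rightarrow> real"
  assumes I: "finite I" and q: "\<forall>i\<in>I. 0 \<le> q i \<and> q i \<le> 1"
    and c: "\<forall>i\<in>I. \<bar>c i\<bar> \<le> 1"
  shows "measure_pmf.expectation (rand_subset I q) (\<lambda>B. exp (\<Sum>i\<in>B. c i))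
     \<ge> exp ((\<Sum>i\<in>I. q i * c i) + (\<Sum>i\<in>I. q i * (1 - q i) * (c i)\<^sup>2) / 5)"
proof -
  have "(\<Prod>i\<in>I. exp (q i * c i + q i * (1 - q i) * (c i)\<^sup>2 / 5)) \<le> (\<Prod>i\<in>I. 1 - q i + q i * exp (c i))"
  proof (rule prod_mono, safe)
    fix i assume i: "i \<in> I"
    let ?q = "q i" and ?c = "c i"
    have q0: "0 \<le> ?q" "?q \<le> 1" using bspec[OF q i] by auto
    define v where "v = ?q * (1 - ?q) * ?c\<^sup>2"
    have c2: "?c\<^sup>2 \<le> 1" using bspec[OF c i] by (simp add: abs_square_le_1)
    have qq: "0 \<le> ?q * (1 - ?q)" "?q * (1 - ?q) \<le> 1" using q0 by (auto intro: mult_le_one)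
    have v: "0 \<le> v" "v \<le> 1" using qq c2 unfolding v_def by (auto intro: mult_le_one)
    have a1: "\<bar>?q * ?c\<bar> \<le> 1" "\<bar>(1 - ?q) * ?c\<bar> \<le> 1"
      using q0 bspec[OF c i] by (auto simp: abs_mult intro: mult_le_one)
    have "exp (v / 5) \<le> 1 + v / 5 + (v / 5)\<^sup>2" by (rule exp_le_quadratic) (use v in auto)
    also have "(v / 5)\<^sup>2 \<le> v / 25" using v by (simp add: power2_eq_square mult_left_le)
    finally have "exp (v / 5) \<le> 1 + v / 4" using v by simp
    also have "1 + v / 4 = (1 - ?q) * (1 + (- (?q * ?c)) + (- (?q * ?c))\<^sup>2 / 4) +
        ?q * (1 + (1 - ?q) * ?c + ((1 - ?q) * ?c)\<^sup>2 / 4)"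
      unfolding v_def by (simp add: power2_eq_square field_simps)
    also have "\<dots> \<le> (1 - ?q) * exp (- (?q * ?c)) + ?q * exp ((1 - ?q) * ?c)"
      using a1 q0 by (intro add_mono mult_left_mono exp_ge_quadratic) auto
    finally have "exp (v / 5) \<le> (1 - ?q) * exp (- (?q * ?c)) + ?q * exp ((1 - ?q) * ?c)" .
    hence "exp (?q * ?c) * exp (v / 5) \<le> exp (?q * ?c) * ((1 - ?q) * exp (- (?q * ?c)) + ?q * exp ((1 - ?q) * ?c))"
      by (rule mult_left_mono) simp
    also have "\<dots> = 1 - ?q + ?q * exp ?c"
      by (simp add: exp_minus distrib_left exp_diff algebra_simps exp_add[symmetric] flip: mult_exp_exp)
    finally show "exp (?q * ?c + ?q * (1 - ?q) * ?c\<^sup>2 / 5) \<le> 1 - ?q + ?q * exp ?c"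
      by (simp add: exp_add v_def)
  qed simp
  thus ?thesis unfolding rand_subset_mgf[OF I q]
    using I by (simp add: exp_sum[symmetric] sum.distrib sum_divide_distrib)
qed

text \<open>Chernoff bound with a tilt \<open>l\<close> of either sign; a negative \<open>l\<close>
  yields lower tails. The number \<open>r\<close> is the gap after multiplication by
  \<open>l\<close>.\<close>

lemma rand_subset_upper_tail:
  fixes w :: "'a \<Rightarrow> real"
  assumes I: "finite I" and q: "\<forall>i\<in>I. 0 \<le> q i \<and> q i \<le> 1"
    and c: "\<forall>i\<in>I. \<bar>l * w i\<bar> \<le> 1"
    and S: "\<And>B. B \<in> S \<Longrightarrow> B \<subseteq> I \<Longrightarrow> l * (\<Sum>i\<in>B. w i) \<ge> l * (\<Sum>i\<in>I. q i * w i) + r"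
  shows "measure_pmf.prob (rand_subset I q) S \<le> exp (l\<^sup>2 * (\<Sum>i\<in>I. (w i)\<^sup>2) - r)"
proof -
  let ?M = "rand_subset I q" and ?m = "l * (\<Sum>i\<in>I. q i * w i)"
  have "measure_pmf.prob ?M S \<le> measure_pmf.expectation ?M (\<lambda>B. exp (\<Sum>i\<in>B. l * w i) * exp (- ?m - r))"
  proof (rule prob_le_expectation[OF finite_set_rand_subset[OF I]])
    fix B assume "B \<in> set_pmf ?M" "B \<in> S"
    hence "B \<subseteq> I" using set_rand_subset[OF I] by auto
    thus "1 \<le> exp (\<Sum>i\<in>B. l * w i) * exp (- ?m - r)"
      using S[OF \<open>B \<in> S\<close>] by (simp add: exp_add[symmetric] sum_distrib_left)
  qed auto
  also have "\<dots> = measure_pmf.expectation ?M (\<lambda>B. exp (\<Sum>i\<in>B. l * w i)) * exp (- ?m - r)" by simp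
  also have "\<dots> \<le> exp ((\<Sum>i\<in>I. q i * (l * w i)) + (\<Sum>i\<in>I. q i * (l * w i)\<^sup>2)) * exp (- ?m - r)"
    by (intro mult_right_mono rand_subset_mgf_centered I q c) auto
  also have "\<dots> = exp ((\<Sum>i\<in>I. q i * (l * w i)\<^sup>2) - r)"
    by (simp add: exp_add[symmetric] sum_distrib_left mult.left_commute)
  also have "(\<Sum>i\<in>I. q i * (l * w i)\<^sup>2) \<le> (\<Sum>i\<in>I. (l * w i)\<^sup>2)"
    using q by (intro sum_mono mult_left_le_one_le) auto
  also have "\<dots> = l\<^sup>2 * (\<Sum>i\<in>I. (w i)\<^sup>2)" by (simp add: power_mult_distrib sum_distrib_left)
  finally show ?thesis by simp
qed

lemma expectation_rand_subset_sum:
  fixes w :: "'a \<Rightarrow> real"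
  assumes I: "finite I" and q: "\<forall>i\<in>I. 0 \<le> q i \<and> q i \<le> 1"
  shows "measure_pmf.expectation (rand_subset I q) (\<lambda>B. \<Sum>i\<in>B. w i) = (\<Sum>i\<in>I. q i * w i)"
proof -
  let ?P = "Pi_pmf I False (\<lambda>i. bernoulli_pmf (q i))"
  have fin: "finite (set_pmf ?P)"
    by (rule finite_subset[OF set_Pi_pmf_subset'[OF I]]) (auto intro!: finite_PiE_dflt I)
  have "measure_pmf.expectation (rand_subset I q) (\<lambda>B. \<Sum>i\<in>B. w i) =
    measure_pmf.expectation ?P (\<lambda>X. \<Sum>i\<in>{i\<in>I. X i}. w i)"
    unfolding rand_subset_def by simp
  also have "(\<lambda>X. \<Sum>i\<in>{i\<in>I. X i}. w i) = (\<lambda>X. \<Sum>i\<in>I. if X i then w i else 0)"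
    using I by (simp add: sum.inter_filter)
  also have "measure_pmf.expectation ?P \<dots> = (\<Sum>i\<in>I. measure_pmf.expectation ?P (\<lambda>X. if X i then w i else 0))"
    by (rule Bochner_Integration.integral_sum) (auto intro: integrable_measure_pmf_finite fin)
  also have "\<dots> = (\<Sum>i\<in>I. q i * w i)"
  proof (rule sum.cong[OF refl])
    fix i assume i: "i \<in> I"
    have "measure_pmf.expectation ?P (\<lambda>X. if X i then w i else 0) =
      measure_pmf.expectation (map_pmf (\<lambda>X. X i) ?P) (\<lambda>b. if b then w i else 0)" by simp
    also have "map_pmf (\<lambda>X. X i) ?P = bernoulli_pmf (q i)" using i I by (simp add: Pi_pmf_component)
    finally show "measure_pmf.expectation ?P (\<lambda>X. if X i then w i else 0) = q i * w i"
      using bspec[OF q i] by simp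
  qed
  finally show ?thesis .
qed

text \<open>Paley--Zygmund applied to an exponential moment.\<close>

lemma exp_tilt_lower_tail:
  fixes S :: "'a \<Rightarrow> real"
  assumes fin: "finite (set_pmf M)"
    and lower: "measure_pmf.expectation M (\<lambda>x. exp (S x)) \<ge> exp a"
    and upper: "measure_pmf.expectation M (\<lambda>x. exp (2 * S x)) \<le> exp b"
  shows "measure_pmf.prob M {x. S x \<ge> a - 1} \<ge> exp (2 * a - b) / 4"
proof -
  let ?E = "measure_pmf.expectation M" and ?T = "{x. S x \<ge> a - 1}"
  note int = integrable_measure_pmf_finite[OF fin]
  define P where "P = measure_pmf.prob M ?T"
  \<comment> \<open>Off the event, exp (S) \<le> exp (a) / 2. On it, the AM-GM inequality bounds exp
    (S) by t exp (2 S) / 2 + 1 / (2 t); this \<open>t\<close> makes the first term contribute at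
    most exp (a) / 4 in expectation.\<close>
  define t where "t = exp (a - b) / 2"
  have t: "t > 0" by (simp add: t_def)
  have e1: "exp (- 1 :: real) \<le> 1 / 2"
    using exp_ge_add_one_self[of "1::real"] by (simp add: exp_minus field_simps)
  have "exp (S x) \<le> exp a / 2 + (t * exp (2 * S x) / 2 + indicat_real ?T x / (2 * t))" for x
  proof (cases "x \<in> ?T")
    case False
    hence "exp (S x) \<le> exp (a - 1)" by simp
    also have "\<dots> = exp a * exp (- 1)" by (simp add: exp_diff exp_minus field_simps)
    also have "\<dots> \<le> exp a / 2" using mult_left_mono[OF e1, of "exp a"] by simp
    finally have "exp (S x) \<le> exp a / 2" .
    moreover have "0 \<le> t * exp (2 * S x) / 2 + indicat_real ?T x / (2 * t)" using t by simp
    ultimately show ?thesis by linarith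
  next
    case True
    have "0 \<le> (t * exp (S x) - 1)\<^sup>2 / (2 * t)" using t by simp
    also have "\<dots> = t * exp (S x) ^ 2 / 2 + 1 / (2 * t) - exp (S x)"
      using t by (simp add: power2_diff power_mult_distrib field_simps power2_eq_square)
    finally have "exp (S x) \<le> t * exp (2 * S x) / 2 + 1 / (2 * t)"
      by (simp add: exp_double)
    thus ?thesis using True by (simp add: add_increasing)
  qed
  hence "?E (\<lambda>x. exp (S x)) \<le> ?E (\<lambda>x. exp a / 2 + (t * exp (2 * S x) / 2 + indicat_real ?T x / (2 * t)))"
    by (intro expectation_mono_pmf fin)
  also have "\<dots> = exp a / 2 + (t * ?E (\<lambda>x. exp (2 * S x)) / 2 + P / (2 * t))"
    unfolding P_def by (simp add: int)
  also have "\<dots> \<le> exp a / 2 + (t * exp b / 2 + P / (2 * t))"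
    using upper t by simp
  also have "t * exp b / 2 = exp a / 4" by (simp add: t_def exp_diff)
  finally have "exp a / 4 \<le> P / (2 * t)" using lower by simp
  hence "exp a * exp (a - b) / 4 \<le> P" by (simp add: t_def field_simps)
  thus ?thesis by (simp add: P_def exp_add[symmetric])
qed

section \<open>Reaching consensus from a set of configurations\<close>

lemma vote_fun_nonneg: "0 \<le> x \<Longrightarrow> x \<le> 1 \<Longrightarrow> 0 \<le> vote_fun k x"
  and vote_fun_le_1: "0 \<le> x \<Longrightarrow> x \<le> 1 \<Longrightarrow> vote_fun k x \<le> 1"
  using prob_binomial_ge[of x k, symmetric] by simp_all

lemma nfrac_range: "0 \<le> nfrac E A v" "E \<subseteq> vertex_pairs n \<Longrightarrow> nfrac E A v \<le> 1"
proof -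
  show "0 \<le> nfrac E A v" by (simp add: nfrac_def)
  assume "E \<subseteq> vertex_pairs n"
  hence "card (nbrs E v \<inter> A) \<le> deg E v" unfolding deg_def by (intro card_mono finite_nbrs) auto
  thus "nfrac E A v \<le> 1" unfolding nfrac_def by (cases "deg E v = 0") auto
qed

lemma next_prob_range:
  assumes "E \<subseteq> vertex_pairs n"
  shows "0 \<le> next_prob k E A v \<and> next_prob k E A v \<le> 1"
  using nfrac_range(1)[where E = E and A = A and v = v] nfrac_range(2)[where E = E and A = A and v = v, OF assms]
  by (auto simp: next_prob_def vote_fun_nonneg vote_fun_le_1)

lemma set_kern: "set_pmf (kern k n E A) \<subseteq> Pow {..<n}"
  unfolding kern_def by (rule set_rand_subset) simp

lemma finite_set_kern: "finite (set_pmf (kern k n E A))"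
  by (rule finite_subset[OF set_kern]) simp

lemma finite_set_chain: "finite (set_pmf (chain k n E t A))"
  by (induction t) (auto intro: finite_set_kern)

text \<open>\<open>chain\<close> appends rounds, as \<open>best_of\<close> does; the bounds on
  reaching consensus condition on the first round instead.\<close>

lemma chain_Suc_left: "chain k n E (Suc t) A = bind_pmf (kern k n E A) (chain k n E t)"
proof (induction t)
  case 0
  show ?case by (simp add: bind_return_pmf bind_return_pmf')
next
  case (Suc t)
  have "chain k n E (Suc (Suc t)) A = bind_pmf (bind_pmf (kern k n E A) (chain k n E t)) (kern k n E)"
    by (simp only: chain.simps(2)[of k n E "Suc t"] Suc.IH)
  also have "\<dots> = bind_pmf (kern k n E A) (chain k n E (Suc t))"
    unfolding bind_assoc_pmf by (rule bind_pmf_cong) auto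
  finally show ?case .
qed

definition cons_prob :: "nat \<Rightarrow> nat \<Rightarrow> nat set set \<Rightarrow> nat \<Rightarrow> nat set \<Rightarrow> real" where
  "cons_prob k n E t A = measure_pmf.prob (chain k n E t A) {{}, {..<n}}"

lemma cons_prob_range: "0 \<le> cons_prob k n E t A" "cons_prob k n E t A \<le> 1"
  by (auto simp: cons_prob_def)

lemma cons_prob_Suc:
  "cons_prob k n E (Suc t) A = measure_pmf.expectation (kern k n E A) (cons_prob k n E t)"
  unfolding cons_prob_def[abs_def] chain_Suc_left by (rule prob_bind_pmf[OF finite_set_kern])

lemma cons_prob_ge_step:
  assumes "measure_pmf.prob (kern k n E A) G \<ge> 1 - \<eta>"
    and "\<And>B. B \<subseteq> {..<n} \<Longrightarrow> B \<in> G \<Longrightarrow> cons_prob k n E t B \<ge> 1 - \<theta>" "0 \<le> \<theta>"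
  shows "cons_prob k n E (Suc t) A \<ge> 1 - (\<eta> + \<theta>)"
proof -
  have "1 - cons_prob k n E (Suc t) A = measure_pmf.expectation (kern k n E A) (\<lambda>B. 1 - cons_prob k n E t B)"
    unfolding cons_prob_Suc by (simp add: integrable_measure_pmf_finite finite_set_kern)
  also have "\<dots> \<le> measure_pmf.expectation (kern k n E A) (\<lambda>B. indicat_real (- G) B + \<theta>)"
  proof (rule expectation_mono_pmf[OF finite_set_kern])
    fix B assume "B \<in> set_pmf (kern k n E A)"
    hence "B \<subseteq> {..<n}" using set_kern by blast
    thus "1 - cons_prob k n E t B \<le> indicat_real (- G) B + \<theta>"
      using assms(2)[of B] assms(3) cons_prob_range(1)[of k n E t B] by (auto split: split_indicator)
  qed
  also have "\<dots> = measure_pmf.prob (kern k n E A) (- G) + \<theta>"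
    by (simp add: integrable_measure_pmf_finite finite_set_kern)
  also have "measure_pmf.prob (kern k n E A) (- G) \<le> \<eta>"
    using assms(1) measure_pmf.prob_compl[of G "kern k n E A"] by (simp add: Compl_eq_Diff_UNIV)
  finally show ?thesis by simp
qed

text \<open>Union bound over the stages \<open>G i\<close>. The induction removes the first stage by
  shifting the sequence \<open>G\<close>.\<close>

lemma cons_prob_phases:
  fixes \<eta> \<theta> :: real
  assumes step: "\<And>i B. i < t \<Longrightarrow> B \<subseteq> {..<n} \<Longrightarrow> B \<in> G i \<Longrightarrow> measure_pmf.prob (kern k n E B) (G (Suc i)) \<ge> 1 - \<eta>"
    and last: "\<And>B. B \<subseteq> {..<n} \<Longrightarrow> B \<in> G t \<Longrightarrow> cons_prob k n E s B \<ge> 1 - \<theta>"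
    and "0 \<le> \<theta>" "0 \<le> \<eta>" "A \<subseteq> {..<n}" "A \<in> G 0"
  shows "cons_prob k n E (t + s) A \<ge> 1 - (t * \<eta> + \<theta>)"
  using assms(1,2,5,6)
proof (induction t arbitrary: G A)
  case 0
  thus ?case by simp
next
  case (Suc t)
  have "cons_prob k n E (Suc (t + s)) A \<ge> 1 - (\<eta> + (t * \<eta> + \<theta>))"
  proof (rule cons_prob_ge_step)
    show "measure_pmf.prob (kern k n E A) (G (Suc 0)) \<ge> 1 - \<eta>"
      using Suc.prems by auto
    fix B assume B: "B \<subseteq> {..<n}" "B \<in> G (Suc 0)"
    show "cons_prob k n E (t + s) B \<ge> 1 - (t * \<eta> + \<theta>)"
      by (rule Suc.IH[of "\<lambda>i. G (Suc i)"]) (use Suc.prems B in auto)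
  qed (use assms in auto)
  thus ?case by (simp add: algebra_simps)
qed

text \<open>Markov's inequality for the size: a nonempty set has at least one element. The size
  contracts only inside \<open>R\<close>, and each round pays \<eta> for a possible exit from
  \<open>R\<close>.\<close>

lemma cons_prob_contraction:
  fixes \<eta> \<rho> :: real
  assumes drift: "\<And>B. B \<subseteq> {..<n} \<Longrightarrow> B \<in> R \<Longrightarrow> measure_pmf.expectation (kern k n E B) (\<lambda>B. real (card B)) \<le> \<rho> * card B"
    and stay: "\<And>B. B \<subseteq> {..<n} \<Longrightarrow> B \<in> R \<Longrightarrow> measure_pmf.prob (kern k n E B) R \<ge> 1 - \<eta>"
    and "0 \<le> \<rho>" "0 \<le> \<eta>" "A \<subseteq> {..<n}" "A \<in> R"
  shows "cons_prob k n E t A \<ge> 1 - (t * \<eta> + \<rho> ^ t * card A)"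
  using assms(5,6)
proof (induction t arbitrary: A)
  case 0
  show ?case
  proof (cases "A = {}")
    case False
    hence "real (card A) \<ge> 1" using finite_subset[OF 0(1)] by (simp add: Suc_leI card_gt_0_iff)
    thus ?thesis using cons_prob_range(1)[of k n E 0 A] by simp
  qed (simp add: cons_prob_def)
next
  case (Suc t)
  let ?K = "kern k n E A"
  note int = integrable_measure_pmf_finite[OF finite_set_kern]
  have "1 - cons_prob k n E (Suc t) A = measure_pmf.expectation ?K (\<lambda>B. 1 - cons_prob k n E t B)"
    unfolding cons_prob_Suc by (simp add: int)
  also have "\<dots> \<le> measure_pmf.expectation ?K (\<lambda>B. indicat_real (- R) B + (t * \<eta> + \<rho> ^ t * card B))"
  proof (rule expectation_mono_pmf[OF finite_set_kern])
    fix B assume "B \<in> set_pmf ?K"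
    hence B: "B \<subseteq> {..<n}" using set_kern by blast
    show "1 - cons_prob k n E t B \<le> indicat_real (- R) B + (t * \<eta> + \<rho> ^ t * card B)"
    proof (cases "B \<in> R")
      case True thus ?thesis using Suc.IH[OF B True] by simp
    next
      case False
      have "0 \<le> t * \<eta> + \<rho> ^ t * card B" using assms by simp
      thus ?thesis using False cons_prob_range(1)[of k n E t B] by simp
    qed
  qed
  also have "\<dots> = measure_pmf.prob ?K (- R) + (t * \<eta> + \<rho> ^ t * measure_pmf.expectation ?K (\<lambda>B. real (card B)))"
    by (simp add: int)
  also have "measure_pmf.prob ?K (- R) \<le> \<eta>"
    using stay[OF Suc.prems] measure_pmf.prob_compl[of R ?K] by (simp add: Compl_eq_Diff_UNIV)
  also have "\<rho> ^ t * measure_pmf.expectation ?K (\<lambda>B. real (card B)) \<le> \<rho> ^ t * (\<rho> * card A)"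
    using assms(3) by (intro mult_left_mono drift Suc.prems) auto
  finally show ?case by (simp add: algebra_simps)
qed

text \<open>The probability of staying outside \<open>G\<close> decays like \<rho>^t because the
  potential there is at least \<phi>. The hypothesis on \<open>G\<close> covers all later times,
  since an early entry into \<open>G\<close> leaves more than \<open>s\<close> rounds.\<close>

lemma cons_prob_potential:
  fixes \<Phi> :: "nat set \<Rightarrow> real" and \<eta> \<rho> :: real
  assumes drift: "\<And>B. B \<subseteq> {..<n} \<Longrightarrow> B \<notin> G \<Longrightarrow>
        measure_pmf.expectation (kern k n E B) (\<lambda>B. if B \<in> G then 0 else \<Phi> B) \<le> \<rho> * \<Phi> B"
    and low: "\<And>B. B \<subseteq> {..<n} \<Longrightarrow> B \<notin> G \<Longrightarrow> \<Phi> B \<ge> \<phi>"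
    and G: "\<And>B t. B \<subseteq> {..<n} \<Longrightarrow> B \<in> G \<Longrightarrow> cons_prob k n E (s + t) B \<ge> 1 - \<eta>"
    and "\<phi> > 0" "0 \<le> \<rho>" "0 \<le> \<eta>" "A \<subseteq> {..<n}" "A \<notin> G"
  shows "cons_prob k n E (s + t) A \<ge> 1 - (\<eta> + \<rho> ^ t * \<Phi> A / \<phi>)"
  using assms(7,8)
proof (induction t arbitrary: A)
  case 0
  have "\<Phi> A / \<phi> \<ge> 1" using low[OF 0] \<open>\<phi> > 0\<close> by simp
  thus ?case using cons_prob_range(1)[of k n E "s + 0" A] assms(6) by simp
next
  case (Suc t)
  let ?K = "kern k n E A" and ?\<Psi> = "\<lambda>B. if B \<in> G then 0 else \<Phi> B"
  note int = integrable_measure_pmf_finite[OF finite_set_kern]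
  have "1 - cons_prob k n E (s + Suc t) A = measure_pmf.expectation ?K (\<lambda>B. 1 - cons_prob k n E (s + t) B)"
    by (simp add: cons_prob_Suc int)
  also have "\<dots> \<le> measure_pmf.expectation ?K (\<lambda>B. \<eta> + \<rho> ^ t / \<phi> * ?\<Psi> B)"
  proof (rule expectation_mono_pmf[OF finite_set_kern])
    fix B assume "B \<in> set_pmf ?K"
    hence B: "B \<subseteq> {..<n}" using set_kern by blast
    show "1 - cons_prob k n E (s + t) B \<le> \<eta> + \<rho> ^ t / \<phi> * ?\<Psi> B"
      using Suc.IH[OF B] G[OF B, of t] by auto
  qed
  also have "\<dots> = \<eta> + \<rho> ^ t / \<phi> * measure_pmf.expectation ?K ?\<Psi>"
    by (simp add: int)
  also have "\<rho> ^ t / \<phi> * measure_pmf.expectation ?K ?\<Psi> \<le> \<rho> ^ t / \<phi> * (\<rho> * \<Phi> A)"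
    using assms(4,5) by (intro mult_left_mono drift Suc.prems) auto
  finally show ?case by (simp add: algebra_simps)
qed

section \<open>The probability-of-switching function\<close>

lemma poly_bounded_unit:
  fixes q :: "real poly"
  shows "\<exists>L\<ge>0. \<forall>x. 0 \<le> x \<and> x \<le> 1 \<longrightarrow> \<bar>poly q x\<bar> \<le> L"
proof (induction q)
  case 0
  show ?case by (intro exI[of _ 0]) auto
next
  case (pCons a q)
  then obtain L where L: "L \<ge> 0" "\<And>x. 0 \<le> x \<Longrightarrow> x \<le> 1 \<Longrightarrow> \<bar>poly q x\<bar> \<le> L" by auto
  have "\<bar>poly (pCons a q) x\<bar> \<le> \<bar>a\<bar> + L" if x: "0 \<le> x" "x \<le> 1" for x
  proof -
    have "\<bar>x * poly q x\<bar> \<le> 1 * L"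
      unfolding abs_mult using x L by (intro mult_mono) auto
    thus ?thesis by simp
  qed
  thus ?case using L by (intro exI[of _ "\<bar>a\<bar> + L"]) auto
qed

text \<open>Induction along the coefficients: the remainder of a + X q is y times the remainder of q
  plus q'(x) (y - x)^2.\<close>

lemma poly_taylor_unit:
  fixes q :: "real poly"
  shows "\<exists>L\<ge>0. \<forall>x y. 0 \<le> x \<and> x \<le> 1 \<and> 0 \<le> y \<and> y \<le> 1 \<longrightarrow>
    \<bar>poly q y - poly q x - poly (pderiv q) x * (y - x)\<bar> \<le> L * (y - x)\<^sup>2"
proof (induction q)
  case 0
  show ?case by (intro exI[of _ 0]) auto
next
  case (pCons a q)
  then obtain L where L: "L \<ge> 0" "\<And>x y. 0 \<le> x \<Longrightarrow> x \<le> 1 \<Longrightarrow> 0 \<le> y \<Longrightarrow> y \<le> 1 \<Longrightarrow>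
    \<bar>poly q y - poly q x - poly (pderiv q) x * (y - x)\<bar> \<le> L * (y - x)\<^sup>2" by auto
  obtain M where M: "M \<ge> 0" "\<And>x. 0 \<le> x \<Longrightarrow> x \<le> 1 \<Longrightarrow> \<bar>poly (pderiv q) x\<bar> \<le> M"
    using poly_bounded_unit[of "pderiv q"] by auto
  have "\<bar>poly (pCons a q) y - poly (pCons a q) x - poly (pderiv (pCons a q)) x * (y - x)\<bar> \<le> (L + M) * (y - x)\<^sup>2"
    if x: "0 \<le> x" "x \<le> 1" "0 \<le> y" "y \<le> 1" for x y
  proof -
    let ?r = "poly q y - poly q x - poly (pderiv q) x * (y - x)"
    have "poly (pCons a q) y - poly (pCons a q) x - poly (pderiv (pCons a q)) x * (y - x)
       = y * ?r + poly (pderiv q) x * (y - x)\<^sup>2"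
      by (simp add: pderiv_pCons algebra_simps power2_eq_square)
    moreover have "\<bar>y * ?r\<bar> \<le> 1 * (L * (y - x)\<^sup>2)"
      unfolding abs_mult using x L by (intro mult_mono) auto
    moreover have "\<bar>poly (pderiv q) x * (y - x)\<^sup>2\<bar> \<le> M * (y - x)\<^sup>2"
      unfolding abs_mult using x M by (intro mult_mono) auto
    ultimately show ?thesis by (simp add: distrib_right)
  qed
  thus ?case using L M by (intro exI[of _ "L + M"]) auto
qed

lemma poly_lipschitz_unit:
  fixes q :: "real poly"
  shows "\<exists>L\<ge>0. \<forall>x y. 0 \<le> x \<and> x \<le> 1 \<and> 0 \<le> y \<and> y \<le> 1 \<longrightarrow> \<bar>poly q y - poly q x\<bar> \<le> L * \<bar>y - x\<bar>"
proof -
  obtain L where L: "L \<ge> 0" "\<And>x y. 0 \<le> x \<Longrightarrow> x \<le> 1 \<Longrightarrow> 0 \<le> y \<Longrightarrow> y \<le> 1 \<Longrightarrow>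
    \<bar>poly q y - poly q x - poly (pderiv q) x * (y - x)\<bar> \<le> L * (y - x)\<^sup>2"
    using poly_taylor_unit[of q] by auto
  obtain M where M: "M \<ge> 0" "\<And>x. 0 \<le> x \<Longrightarrow> x \<le> 1 \<Longrightarrow> \<bar>poly (pderiv q) x\<bar> \<le> M"
    using poly_bounded_unit[of "pderiv q"] by auto
  have "\<bar>poly q y - poly q x\<bar> \<le> (L + M) * \<bar>y - x\<bar>" if x: "0 \<le> x" "x \<le> 1" "0 \<le> y" "y \<le> 1" for x y
  proof -
    have "(y - x)\<^sup>2 = \<bar>y - x\<bar> * \<bar>y - x\<bar>" by (simp add: power2_eq_square)
    also have "\<dots> \<le> 1 * \<bar>y - x\<bar>" using x by (intro mult_right_mono) auto
    finally have "L * (y - x)\<^sup>2 \<le> L * \<bar>y - x\<bar>" using L by (intro mult_left_mono) auto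
    moreover have "\<bar>poly (pderiv q) x * (y - x)\<bar> \<le> M * \<bar>y - x\<bar>"
      unfolding abs_mult using x M by (intro mult_mono) auto
    ultimately show ?thesis using L(2)[OF x] by (simp add: distrib_right)
  qed
  thus ?thesis using L M by (intro exI[of _ "L + M"]) auto
qed

lemma vote_fun_poly: "\<exists>q. \<forall>x. vote_fun k x = poly q x"
proof
  show "\<forall>x. vote_fun k x = poly (\<Sum>i = k div 2 + 1..k. [:real (k choose i):] * [:0, 1:] ^ i * [:1, - 1:] ^ (k - i)) x"
    by (simp add: vote_fun_def poly_sum mult.assoc)
qed

lemma vote_fun_smooth:
  "\<exists>f' L. L \<ge> 0 \<and> (\<forall>x y. 0 \<le> x \<and> x \<le> 1 \<and> 0 \<le> y \<and> y \<le> 1 \<longrightarrow>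
     \<bar>vote_fun k y - vote_fun k x - f' x * (y - x)\<bar> \<le> L * (y - x)\<^sup>2 \<and>
     \<bar>f' y - f' x\<bar> \<le> L * \<bar>y - x\<bar> \<and> \<bar>vote_fun k y - vote_fun k x\<bar> \<le> L * \<bar>y - x\<bar>)"
proof -
  obtain q where q: "\<And>x. vote_fun k x = poly q x" using vote_fun_poly by metis
  obtain L1 where L1: "L1 \<ge> 0" "\<And>x y. 0 \<le> x \<Longrightarrow> x \<le> 1 \<Longrightarrow> 0 \<le> y \<Longrightarrow> y \<le> 1 \<Longrightarrow>
    \<bar>poly q y - poly q x - poly (pderiv q) x * (y - x)\<bar> \<le> L1 * (y - x)\<^sup>2"
    using poly_taylor_unit[of q] by auto
  obtain L2 where L2: "L2 \<ge> 0" "\<And>x y. 0 \<le> x \<Longrightarrow> x \<le> 1 \<Longrightarrow> 0 \<le> y \<Longrightarrow> y \<le> 1 \<Longrightarrow>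
    \<bar>poly (pderiv q) y - poly (pderiv q) x\<bar> \<le> L2 * \<bar>y - x\<bar>"
    using poly_lipschitz_unit[of "pderiv q"] by auto
  obtain L3 where L3: "L3 \<ge> 0" "\<And>x y. 0 \<le> x \<Longrightarrow> x \<le> 1 \<Longrightarrow> 0 \<le> y \<Longrightarrow> y \<le> 1 \<Longrightarrow>
    \<bar>poly q y - poly q x\<bar> \<le> L3 * \<bar>y - x\<bar>"
    using poly_lipschitz_unit[of q] by auto
  let ?L = "L1 + L2 + L3"
  have "L1 * z \<le> ?L * z" "L2 * z \<le> ?L * z" "L3 * z \<le> ?L * z" if "z \<ge> 0" for z
    using L1(1) L2(1) L3(1) that by (auto intro!: mult_right_mono)
  note mono = this
  show ?thesis unfolding q
  proof (intro exI[of _ "poly (pderiv q)"] exI[of _ ?L] conjI allI impI)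
    show "0 \<le> ?L" using L1(1) L2(1) L3(1) by simp
    fix x y :: real assume "0 \<le> x \<and> x \<le> 1 \<and> 0 \<le> y \<and> y \<le> 1"
    hence xy: "0 \<le> x" "x \<le> 1" "0 \<le> y" "y \<le> 1" by auto
    show "\<bar>poly q y - poly q x - poly (pderiv q) x * (y - x)\<bar> \<le> ?L * (y - x)\<^sup>2"
      using L1(2)[OF xy] mono(1)[of "(y - x)\<^sup>2"] by simp
    show "\<bar>poly (pderiv q) y - poly (pderiv q) x\<bar> \<le> ?L * \<bar>y - x\<bar>"
      using L2(2)[OF xy] mono(2)[of "\<bar>y - x\<bar>"] by simp
    show "\<bar>poly q y - poly q x\<bar> \<le> ?L * \<bar>y - x\<bar>"
      using L3(2)[OF xy] mono(3)[of "\<bar>y - x\<bar>"] by simp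
  qed
qed

section \<open>Elementary bounds on the switching function and on the mean-field map\<close>

lemma binomial_sum_1:
  fixes x :: real
  shows "(\<Sum>i\<le>k. real (k choose i) * x ^ i * (1 - x) ^ (k - i)) = 1"
  using binomial_ring[of x "1 - x" k] by simp

lemma vote_fun_ge_power:
  assumes "0 \<le> x" "x \<le> 1" "k \<ge> 1"
  shows "x ^ k \<le> vote_fun k x"
proof -
  have "(\<Sum>i\<in>{k}. real (k choose i) * x ^ i * (1 - x) ^ (k - i)) \<le> vote_fun k x"
    unfolding vote_fun_def by (rule sum_mono2) (use assms in \<open>auto intro!: mult_nonneg_nonneg\<close>)
  thus ?thesis by simp
qed

lemma vote_fun_le_power:
  assumes "0 \<le> x" "x \<le> 1"
  shows "vote_fun k x \<le> 1 - (1 - x) ^ k"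
proof -
  have "vote_fun k x + (1 - x) ^ k = (\<Sum>i\<in>insert 0 {k div 2 + 1..k}. real (k choose i) * x ^ i * (1 - x) ^ (k - i))"
    by (simp add: vote_fun_def)
  also have "\<dots> \<le> (\<Sum>i\<le>k. real (k choose i) * x ^ i * (1 - x) ^ (k - i))"
    by (rule sum_mono2) (use assms in \<open>auto intro!: mult_nonneg_nonneg\<close>)
  finally show ?thesis by (simp add: binomial_sum_1)
qed

lemma vote_fun_1: "k \<ge> 1 \<Longrightarrow> vote_fun k 1 = 1"
  using vote_fun_ge_power[of 1 k] vote_fun_le_1[of 1 k] by simp

lemma vote_fun_le_two_power:
  assumes "0 \<le> x" "x \<le> 1"
  shows "vote_fun k x \<le> 2 ^ k * x ^ (k div 2 + 1)"
proof -
  have "vote_fun k x \<le> (\<Sum>i = k div 2 + 1..k. real (k choose i) * x ^ (k div 2 + 1))"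
    unfolding vote_fun_def
  proof (rule sum_mono)
    fix i assume "i \<in> {k div 2 + 1..k}"
    hence "x ^ i * (1 - x) ^ (k - i) \<le> x ^ (k div 2 + 1) * 1"
      using assms by (intro mult_mono power_decreasing power_le_one) auto
    from mult_left_mono[OF this, of "real (k choose i)"]
    show "real (k choose i) * x ^ i * (1 - x) ^ (k - i) \<le> real (k choose i) * x ^ (k div 2 + 1)"
      by (simp add: mult.assoc)
  qed
  also have "\<dots> = (\<Sum>i = k div 2 + 1..k. real (k choose i)) * x ^ (k div 2 + 1)"
    by (simp add: sum_distrib_right)
  also have "(\<Sum>i = k div 2 + 1..k. real (k choose i)) \<le> (\<Sum>i\<le>k. real (k choose i))"
    by (rule sum_mono2) auto
  also have "(\<Sum>i\<le>k. real (k choose i)) = 2 ^ k"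
    using choose_row_sum[of k] by (metis of_nat_numeral of_nat_power of_nat_sum)
  finally show ?thesis using assms by (simp add: mult_right_mono)
qed

lemma vote_fun_le_quadratic:
  assumes "0 \<le> x" "x \<le> 1" "k \<ge> 2"
  shows "vote_fun k x \<le> 2 ^ k * x\<^sup>2"
proof -
  have "x ^ (k div 2 + 1) \<le> x\<^sup>2" using assms by (intro power_decreasing) auto
  hence "2 ^ k * x ^ (k div 2 + 1) \<le> 2 ^ k * x\<^sup>2" by (intro mult_left_mono) auto
  thus ?thesis using vote_fun_le_two_power[of x k] assms by linarith
qed

text \<open>The mean-field map: the new minority fraction when every vertex sees the global fraction.\<close>

definition mean_map :: "nat \<Rightarrow> real \<Rightarrow> real" where
  "mean_map k x = x * (1 - vote_fun k (1 - x)) + (1 - x) * vote_fun k x"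

text \<open>The difference x f(1 - x) - (1 - x) f(x) splits by the number i of majority samples. As
  i > k/2, a factor (x (1 - x))^(k-i+1) comes out of each term and leaves a difference of equal
  powers of 1 - x and x, which is nonnegative. The unanimous term i = k alone gives the stated
  bound.\<close>

lemma mean_map_drift:
  assumes x: "0 \<le> x" "x \<le> 1 / 2" and k: "k \<ge> 2"
  shows "mean_map k x \<le> x - x * (1 - x) * (1 - 2 * x) / 2 ^ (k - 2)"
proof -
  let ?y = "1 - x" and ?I = "{k div 2 + 1..k}"
  define D where "D = (\<lambda>i. real (k choose i) * (x * ?y ^ i * x ^ (k - i) - ?y * x ^ i * ?y ^ (k - i)))"
  have eq: "x * vote_fun k ?y - ?y * vote_fun k x = (\<Sum>i\<in>?I. D i)"
    by (simp add: vote_fun_def D_def sum_distrib_left sum_subtractf[symmetric] algebra_simps)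
  have nonneg: "D i \<ge> 0" if "i \<in> ?I" for i
  proof -
    define a where "a = k - i + 1"
    define j where "j = i - a"
    have "a \<le> i" using that by (auto simp: a_def)
    hence i: "i = a + j" and ki: "k - i + 1 = a" by (auto simp: j_def a_def)
    have "x * ?y ^ i * x ^ (k - i) - ?y * x ^ i * ?y ^ (k - i) = x ^ a * ?y ^ i - ?y ^ a * x ^ i"
      by (simp add: ki[symmetric] mult_ac)
    also have "\<dots> = (x * ?y) ^ a * (?y ^ j - x ^ j)"
    proof -
      have "u ^ a * w ^ (a + j) - w ^ a * u ^ (a + j) = (u * w) ^ a * (w ^ j - u ^ j)" for u w :: real
        by (simp add: power_add power_mult_distrib algebra_simps)
      thus ?thesis unfolding i .
    qed
    also have "\<dots> \<ge> 0"
      using x power_mono[of x ?y j] by simp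
    finally show ?thesis by (simp add: D_def)
  qed
  have "D k \<le> (\<Sum>i\<in>?I. D i)"
    by (rule member_le_sum) (use k nonneg in auto)
  moreover have "x * ?y * (1 - 2 * x) / 2 ^ (k - 2) \<le> D k"
  proof -
    define m where "m = k - 2"
    have m: "k = Suc (Suc m)" using k by (simp add: m_def)
    have "D k = x * ?y * (?y ^ Suc m - x ^ Suc m)"
      by (simp add: D_def m algebra_simps)
    also have "?y ^ Suc m - x ^ Suc m \<ge> (1 - 2 * x) / 2 ^ m"
    proof -
      have "(1 / 2) ^ m \<le> ?y ^ m" using x by (intro power_mono) auto
      hence "(1 - 2 * x) * (1 / 2) ^ m \<le> (?y - x) * ?y ^ m" using x by (intro mult_mono) auto
      also have "\<dots> \<le> ?y ^ Suc m - x ^ Suc m"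
        using mult_left_mono[OF power_mono[of x ?y m], of x] x by (simp add: algebra_simps)
      finally show ?thesis by (simp only: power_one_over times_divide_eq_right mult_1_right)
    qed
    hence "x * ?y * (?y ^ Suc m - x ^ Suc m) \<ge> x * ?y * ((1 - 2 * x) / 2 ^ m)"
      using x by (intro mult_left_mono) auto
    finally show ?thesis by (simp add: m)
  qed
  ultimately show ?thesis using eq by (simp add: mean_map_def algebra_simps)
qed

text \<open>A minority vertex stays with probability O(x), as f(1) = 1 and f is Lipschitz, and a
  majority vertex defects with probability O(x^2), as a strict majority of at least two samples
  needs two minority samples. The bound on the bias, which says that it grows by at most a constant
  factor, serves the lower bound on the consensus time.\<close>

lemma mean_map_bounds:
  assumes k: "k \<ge> 2"
  shows "\<exists>Q\<ge>1. \<forall>x. 0 \<le> x \<and> x \<le> 1 \<longrightarrow> mean_map k x \<le> Q * x\<^sup>2 \<and>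
    \<bar>1 - 2 * mean_map k x\<bar> \<le> Q * \<bar>1 - 2 * x\<bar> \<and> 1 - vote_fun k (1 - x) \<le> Q * x \<and> vote_fun k x \<le> Q * x\<^sup>2"
proof -
  obtain L f' where L: "L \<ge> 0" "\<And>x y. 0 \<le> x \<Longrightarrow> x \<le> 1 \<Longrightarrow> 0 \<le> y \<Longrightarrow> y \<le> 1 \<Longrightarrow>
     \<bar>vote_fun k y - vote_fun k x\<bar> \<le> L * \<bar>y - x\<bar>"
    using vote_fun_smooth[of k] by auto
  define Q where "Q = L + 2 ^ k + 2"
  have Q1: "Q \<ge> 1" using L(1) by (simp add: Q_def add_increasing)
  have "mean_map k x \<le> Q * x\<^sup>2 \<and> \<bar>1 - 2 * mean_map k x\<bar> \<le> Q * \<bar>1 - 2 * x\<bar> \<and>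
      1 - vote_fun k (1 - x) \<le> Q * x \<and> vote_fun k x \<le> Q * x\<^sup>2" if x: "0 \<le> x" "x \<le> 1" for x
  proof (intro conjI)
    let ?u = "vote_fun k (1 - x)" and ?w = "vote_fun k x"
    have u: "1 - ?u \<le> L * x" using L(2)[of "1 - x" 1] x vote_fun_1[of k] k by simp
    have w: "?w \<le> 2 ^ k * x\<^sup>2" using vote_fun_le_quadratic[OF x k] .
    have rng: "0 \<le> ?u" "?u \<le> 1" "0 \<le> ?w" "?w \<le> 1" using x by (auto intro: vote_fun_nonneg vote_fun_le_1)
    have "L * x \<le> Q * x" using x unfolding Q_def by (intro mult_right_mono) auto
    thus "1 - ?u \<le> Q * x" using u by simp
    have "2 ^ k * x\<^sup>2 \<le> Q * x\<^sup>2" unfolding Q_def using L(1) by (intro mult_right_mono) auto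
    thus "?w \<le> Q * x\<^sup>2" using w by simp
    have "x * (1 - ?u) \<le> x * (L * x)" using u x by (intro mult_left_mono) auto
    moreover have "(1 - x) * ?w \<le> 1 * ?w" using x rng by (intro mult_right_mono) auto
    ultimately have "mean_map k x \<le> L * x\<^sup>2 + 2 ^ k * x\<^sup>2"
      using w by (simp add: mean_map_def power2_eq_square algebra_simps)
    also have "\<dots> \<le> Q * x\<^sup>2" by (simp add: Q_def distrib_right)
    finally show "mean_map k x \<le> Q * x\<^sup>2" .
    have uw: "\<bar>?u - ?w\<bar> \<le> L * \<bar>1 - 2 * x\<bar>" using L(2)[of x "1 - x"] x by simp
    have "1 - 2 * mean_map k x = (1 - 2 * x) * (1 - (?u + ?w)) + (?u - ?w)"
      by (simp add: mean_map_def algebra_simps)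
    moreover have "\<bar>(1 - 2 * x) * (1 - (?u + ?w))\<bar> \<le> \<bar>1 - 2 * x\<bar> * 1"
      unfolding abs_mult using rng by (intro mult_left_mono) auto
    ultimately have "\<bar>1 - 2 * mean_map k x\<bar> \<le> (L + 1) * \<bar>1 - 2 * x\<bar>"
      using uw by (simp add: distrib_right)
    also have "\<dots> \<le> Q * \<bar>1 - 2 * x\<bar>" unfolding Q_def by (intro mult_right_mono) auto
    finally show "\<bar>1 - 2 * mean_map k x\<bar> \<le> Q * \<bar>1 - 2 * x\<bar>" .
  qed
  thus ?thesis using Q1 by blast
qed

text \<open>Reflecting i to k - i turns f(1 - x) into the sum over minority counts; for even
  \<open>k\<close> only the tie is missing from the full binomial sum. The tie term reveals the
  parity of \<open>k\<close>.\<close>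

lemma vote_fun_complement:
  assumes "0 \<le> x" "x \<le> 1"
  shows "vote_fun k x + vote_fun k (1 - x) =
    1 - (if even k then real (k choose (k div 2)) * (x * (1 - x)) ^ (k div 2) else 0)"
proof -
  let ?m = "k div 2" and ?t = "\<lambda>i. real (k choose i) * x ^ i * (1 - x) ^ (k - i)"
  have "vote_fun k (1 - x) = (\<Sum>i = ?m + 1..k. ?t (k - i))"
    unfolding vote_fun_def by (intro sum.cong) (auto simp: binomial_symmetric[symmetric] mult_ac)
  also have "\<dots> = (\<Sum>i<k - ?m. ?t i)"
    by (rule sum.reindex_bij_witness[of _ "\<lambda>i. k - i" "\<lambda>i. k - i"]) auto
  finally have 1: "vote_fun k (1 - x) = (\<Sum>i<k - ?m. ?t i)" .
  have 2: "vote_fun k x = (\<Sum>i = ?m + 1..k. ?t i)" by (simp add: vote_fun_def)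
  show ?thesis
  proof (cases "even k")
    case True
    hence k: "k = 2 * ?m" by simp
    have "{..k} = insert ?m ({..<k - ?m} \<union> {?m + 1..k})" using k by auto
    moreover have "{..<k - ?m} \<inter> {?m + 1..k} = {}" "?m \<notin> {..<k - ?m} \<union> {?m + 1..k}" using k by auto
    ultimately have "(\<Sum>i\<le>k. ?t i) = ?t ?m + (\<Sum>i\<in>{..<k - ?m} \<union> {?m + 1..k}. ?t i)"
      by (metis (no_types, lifting) finite_UnI finite_lessThan finite_atLeastAtMost sum.insert)
    also have "(\<Sum>i\<in>{..<k - ?m} \<union> {?m + 1..k}. ?t i) = (\<Sum>i<k - ?m. ?t i) + (\<Sum>i = ?m + 1..k. ?t i)"
      by (rule sum.union_disjoint) (use k in auto)
    finally have "(\<Sum>i\<le>k. ?t i) = ?t ?m + ((\<Sum>i<k - ?m. ?t i) + (\<Sum>i = ?m + 1..k. ?t i))" .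
    moreover have "?t ?m = real (k choose ?m) * (x * (1 - x)) ^ ?m"
      using k by (metis add_diff_cancel_left' mult.assoc mult_2 power_mult_distrib)
    ultimately show ?thesis using True 1 2 binomial_sum_1[of k x] by simp
  next
    case False
    hence "k = 2 * ?m + 1" by (metis odd_two_times_div_two_succ)
    hence "{..k} = {..<k - ?m} \<union> {?m + 1..k}" "{..<k - ?m} \<inter> {?m + 1..k} = {}" by auto
    hence "(\<Sum>i\<le>k. ?t i) = (\<Sum>i<k - ?m. ?t i) + (\<Sum>i = ?m + 1..k. ?t i)"
      by (simp add: sum.union_disjoint)
    thus ?thesis using False 1 2 binomial_sum_1[of k x] by simp
  qed
qed

text \<open>Near 0 the function vanishes to the order k div 2 + 1, so the function determines this
  number.\<close>

lemma vote_fun_div2_le: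
  assumes k: "k \<ge> 2" and "k' \<ge> 2" and eq: "vote_fun k = vote_fun k'"
  shows "k' div 2 \<le> k div 2"
proof (rule ccontr)
  assume "\<not> k' div 2 \<le> k div 2"
  hence lt: "k div 2 + 2 \<le> k' div 2 + 1" by simp
  let ?m = "k div 2"
  \<comment> \<open>Small enough that 2^k' x = 2^(-k-1), which is less than the lower coefficient
    2^(-k) of the leading power.\<close>
  define x where "x = (1 / 2 :: real) ^ (k + k' + 1)"
  have x: "0 < x" "x \<le> 1 / 2" using power_decreasing[of 1 "k + k' + 1" "1 / 2 :: real"] by (auto simp: x_def)
  have kx: "2 ^ k' * x = (1 / 2) ^ (k + 1)" by (simp add: x_def power_add power_one_over)
  have "real (k choose (?m + 1)) * x ^ (?m + 1) * (1 - x) ^ (k - (?m + 1)) \<le> vote_fun k x"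
    unfolding vote_fun_def by (rule member_le_sum) (use k x in \<open>auto intro!: mult_nonneg_nonneg\<close>)
  moreover have "x ^ (?m + 1) * (1 / 2) ^ k \<le> real (k choose (?m + 1)) * x ^ (?m + 1) * (1 - x) ^ (k - (?m + 1))"
  proof -
    have "(1 / 2 :: real) ^ k \<le> (1 / 2) ^ (k - (?m + 1))" by (rule power_decreasing) auto
    also have "\<dots> \<le> (1 - x) ^ (k - (?m + 1))" using x by (intro power_mono) auto
    finally have "1 * x ^ (?m + 1) * (1 / 2) ^ k \<le> real (k choose (?m + 1)) * x ^ (?m + 1) * (1 - x) ^ (k - (?m + 1))"
      using x k by (intro mult_mono) (auto simp: Suc_le_eq simp del: binomial_Suc_Suc)
    thus ?thesis by simp
  qed
  moreover have "vote_fun k' x \<le> 2 ^ k' * x ^ (?m + 2)"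
  proof -
    have "2 ^ k' * x ^ (k' div 2 + 1) \<le> 2 ^ k' * x ^ (?m + 2)"
      using x lt by (intro mult_left_mono power_decreasing) auto
    moreover have "vote_fun k' x \<le> 2 ^ k' * x ^ (k' div 2 + 1)"
      by (rule vote_fun_le_two_power) (use x in linarith)+
    ultimately show ?thesis by (rule order_trans[rotated])
  qed
  ultimately have "x ^ (?m + 1) * (1 / 2) ^ k \<le> x ^ (?m + 1) * (2 ^ k' * x)"
    using eq by (simp add: mult_ac)
  hence "(1 / 2) ^ k \<le> 2 ^ k' * x" using x by simp
  thus False unfolding kx by simp
qed

text \<open>The order of vanishing at 0 gives k div 2, and the tie term at 1/2 gives the parity.
  This makes it legitimate to choose constants from \<open>k\<close> and to present them as a
  function of f.\<close>

lemma vote_fun_inj: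
  assumes "k \<ge> 2" "k' \<ge> 2" "vote_fun k = vote_fun k'"
  shows "k = k'"
proof (rule ccontr)
  assume ne: "k \<noteq> k'"
  have m: "k div 2 = k' div 2"
    using vote_fun_div2_le[of k k'] vote_fun_div2_le[of k' k] assms by simp
  hence par: "even k \<noteq> even k'" using ne by (metis dvd_mult_div_cancel odd_two_times_div_two_succ)
  have pos: "real (j choose (j div 2)) * (1 / 2 * (1 - 1 / 2)) ^ (j div 2) > 0" for j
    by simp
  show False
    using vote_fun_complement[of "1 / 2" k] vote_fun_complement[of "1 / 2" k'] par assms(3) pos[of k] pos[of k']
    by (cases "even k") simp_all
qed

section \<open>Degrees and densities in the random graph\<close>

lemma finite_vertex_pairs: "finite (vertex_pairs n)"
  by (rule finite_subset[of _ "Pow {..<n}"]) (auto simp: vertex_pairs_def)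

lemma set_gnp: "E \<in> set_pmf (gnp n p) \<Longrightarrow> E \<subseteq> vertex_pairs n"
  using set_rand_subset[OF finite_vertex_pairs, of n] by (auto simp: gnp_eq_rand_subset)

lemma finite_set_gnp: "finite (set_pmf (gnp n p))"
  unfolding gnp_eq_rand_subset by (rule finite_set_rand_subset[OF finite_vertex_pairs])

section \<open>Weighted degree sums as linear functions of the edge set\<close>

lemma card_nbrs_Int:
  assumes "E \<subseteq> vertex_pairs n"
  shows "card (nbrs E v \<inter> A) = card {e \<in> E. v \<in> e \<and> e - {v} \<subseteq> A}"
proof (rule bij_betw_same_card[of "\<lambda>w. {v, w}"])
  have ne: "v \<noteq> w" if "{v, w} \<in> E" for w
    using that assms by (auto simp: vertex_pairs_def)
  show "bij_betw (\<lambda>w. {v, w}) (nbrs E v \<inter> A) {e \<in> E. v \<in> e \<and> e - {v} \<subseteq> A}"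
    unfolding bij_betw_def
  proof
    show "inj_on (\<lambda>w. {v, w}) (nbrs E v \<inter> A)" by (auto simp: inj_on_def doubleton_eq_iff)
    show "(\<lambda>w. {v, w}) ` (nbrs E v \<inter> A) = {e \<in> E. v \<in> e \<and> e - {v} \<subseteq> A}"
    proof safe
      fix e assume e: "e \<in> E" "v \<in> e" "e - {v} \<subseteq> A"
      hence "card e = 2" using assms by (auto simp: vertex_pairs_def)
      then obtain a b where "e = {a, b}" "a \<noteq> b" by (auto simp: card_2_iff)
      then obtain w where w: "e = {v, w}" "w \<noteq> v" using e(2) by auto
      thus "e \<in> (\<lambda>w. {v, w}) ` (nbrs E v \<inter> A)" using e by (auto simp: nbrs_def)
    qed (use ne in \<open>auto simp: nbrs_def\<close>)
  qed
qed

text \<open>Exchanging the sums gives every edge one coefficient, the form to which the exponential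
  moments of a random subset apply.\<close>

lemma sum_nbrs_Int:
  fixes l :: "nat \<Rightarrow> real"
  assumes "E \<subseteq> vertex_pairs n"
  shows "(\<Sum>v\<in>V. l v * real (card (nbrs E v \<inter> A))) = (\<Sum>e\<in>E. \<Sum>v\<in>V. l v * of_bool (v \<in> e \<and> e - {v} \<subseteq> A))"
proof -
  have fE: "finite E" using assms finite_vertex_pairs finite_subset by blast
  have "real (card (nbrs E v \<inter> A)) = (\<Sum>e\<in>E. of_bool (v \<in> e \<and> e - {v} \<subseteq> A))" for v
    unfolding card_nbrs_Int[OF assms] using fE by (simp add: sum_of_bool_eq Int_def)
  thus ?thesis by (simp add: sum_distrib_left) (rule sum.swap)
qed

lemma nbrs_complete: "v < n \<Longrightarrow> nbrs (vertex_pairs n) v = {..<n} - {v}"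
  by (auto simp: nbrs_def vertex_pairs_def card_insert_if)

text \<open>The preceding identity for the complete graph; multiplied by p it is the expectation in
  the random graph.\<close>

lemma sum_complete:
  fixes l :: "nat \<Rightarrow> real"
  assumes "A \<subseteq> {..<n}" "V \<subseteq> {..<n}"
  shows "(\<Sum>e\<in>vertex_pairs n. \<Sum>v\<in>V. l v * of_bool (v \<in> e \<and> e - {v} \<subseteq> A)) = (\<Sum>v\<in>V. l v * real (card (A - {v})))"
proof -
  have "(\<Sum>v\<in>V. l v * real (card (nbrs (vertex_pairs n) v \<inter> A))) = (\<Sum>v\<in>V. l v * real (card (A - {v})))"
  proof (rule sum.cong[OF refl])
    fix v assume "v \<in> V"
    hence "nbrs (vertex_pairs n) v \<inter> A = A - {v}" using assms nbrs_complete[of v n] by auto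
    thus "l v * real (card (nbrs (vertex_pairs n) v \<inter> A)) = l v * real (card (A - {v}))" by simp
  qed
  thus ?thesis using sum_nbrs_Int[of "vertex_pairs n" n l A V] by simp
qed

text \<open>A pair collects the weights of at most two end points. Weights up to 1/2 keep its
  coefficient within [-1, 1], and (a + b)^2 \<le> 2 a^2 + 2 b^2 accounts for the dependence between
  the end points by a factor 2.\<close>

lemma gnp_mgf_degrees:
  fixes l :: "nat \<Rightarrow> real" and p :: real
  assumes p: "0 \<le> p" "p \<le> 1" and A: "A \<subseteq> {..<n}" and l: "\<And>v. v < n \<Longrightarrow> \<bar>l v\<bar> \<le> 1 / 2"
  shows "measure_pmf.expectation (gnp n p)
      (\<lambda>E. exp (\<Sum>v<n. l v * (real (card (nbrs E v \<inter> A)) - p * card (A - {v})))) \<le> exp (2 * (n * p) * (\<Sum>v<n. (l v)\<^sup>2))"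
proof -
  let ?f = "\<lambda>e v. of_bool (v \<in> e \<and> e - {v} \<subseteq> A) :: real"
  define c where "c = (\<lambda>e. \<Sum>v<n. l v * ?f e v)"
  define m where "m = (\<Sum>v<n. l v * (p * card (A - {v})))"
  have fA: "finite A" using A finite_subset by blast
  have ce: "\<bar>c e\<bar> \<le> 1 \<and> (c e)\<^sup>2 \<le> (\<Sum>v<n. 2 * (l v)\<^sup>2 * ?f e v)" if e: "e \<in> vertex_pairs n" for e
  proof -
    obtain a b where ab: "e = {a, b}" "a \<noteq> b" "a < n" "b < n"
      using e by (auto simp: vertex_pairs_def card_2_iff)
    have red: "(\<Sum>v<n. g v * ?f e v) = g a * ?f e a + g b * ?f e b" for g
    proof -
      have "(\<Sum>v<n. g v * ?f e v) = (\<Sum>v\<in>{a, b}. g v * ?f e v)"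
        by (rule sum.mono_neutral_right) (use ab in auto)
      thus ?thesis using ab by simp
    qed
    let ?x = "l a * ?f e a" and ?y = "l b * ?f e b"
    have x: "\<bar>?x\<bar> \<le> 1 / 2" "\<bar>?y\<bar> \<le> 1 / 2" using l ab by (auto split: split_of_bool)
    have "(?x + ?y)\<^sup>2 \<le> 2 * ?x\<^sup>2 + 2 * ?y\<^sup>2"
      using zero_le_power2[of "?x - ?y"] by (simp add: power2_eq_square algebra_simps)
    also have "\<dots> = 2 * (l a)\<^sup>2 * ?f e a + 2 * (l b)\<^sup>2 * ?f e b"
      by (auto simp: power_mult_distrib split: split_of_bool)
    finally show ?thesis unfolding c_def red using x by auto
  qed
  have "measure_pmf.expectation (gnp n p) (\<lambda>E. exp (\<Sum>v<n. l v * (real (card (nbrs E v \<inter> A)) - p * card (A - {v}))))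
    = measure_pmf.expectation (gnp n p) (\<lambda>E. exp (\<Sum>e\<in>E. c e) * exp (- m))"
    by (rule expectation_cong_pmf, drule set_gnp)
      (simp add: c_def m_def right_diff_distrib sum_subtractf sum_nbrs_Int exp_diff exp_minus field_simps)
  also have "\<dots> = measure_pmf.expectation (gnp n p) (\<lambda>E. exp (\<Sum>e\<in>E. c e)) * exp (- m)" by simp
  also have "\<dots> \<le> exp ((\<Sum>e\<in>vertex_pairs n. p * c e) + (\<Sum>e\<in>vertex_pairs n. p * (c e)\<^sup>2)) * exp (- m)"
    unfolding gnp_eq_rand_subset
    by (intro mult_right_mono rand_subset_mgf_centered finite_vertex_pairs) (use p ce in auto)
  also have "(\<Sum>e\<in>vertex_pairs n. p * c e) = m"
    unfolding c_def m_def sum_distrib_left[symmetric]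
    by (subst sum_complete[OF A]) (auto simp: sum_distrib_left mult_ac)
  also have "exp (m + (\<Sum>e\<in>vertex_pairs n. p * (c e)\<^sup>2)) * exp (- m) = exp (\<Sum>e\<in>vertex_pairs n. p * (c e)\<^sup>2)"
    by (simp add: exp_add[symmetric])
  also have "(\<Sum>e\<in>vertex_pairs n. p * (c e)\<^sup>2) \<le> (\<Sum>e\<in>vertex_pairs n. p * (\<Sum>v<n. 2 * (l v)\<^sup>2 * ?f e v))"
    using ce p by (intro sum_mono mult_left_mono) auto
  also have "\<dots> = p * (\<Sum>v<n. 2 * (l v)\<^sup>2 * card (A - {v}))"
    unfolding sum_distrib_left[symmetric] by (subst sum_complete[OF A]) auto
  also have "\<dots> \<le> p * (\<Sum>v<n. 2 * (l v)\<^sup>2 * n)"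
  proof (intro mult_left_mono sum_mono)
    fix v
    have "card (A - {v}) \<le> card {..<n}" by (rule card_mono) (use A in auto)
    thus "real (card (A - {v})) \<le> real n" by simp
  qed (use p in auto)
  also have "\<dots> = 2 * (n * p) * (\<Sum>v<n. (l v)\<^sup>2)"
    by (simp add: sum_distrib_left mult_ac)
  finally show ?thesis by simp
qed

text \<open>A finite mixture of exponentials \<open>exp (l z - 3 D l\<^sup>2)\<close> dominates the Gaussian-type moment
  \<open>exp (z\<^sup>2 / (50 D))\<close> on the range \<open>\<bar>z\<bar> \<le> 10 D\<close>, while its expectation only needs the
  moment generating function on \<open>\<bar>l\<bar> \<le> 1/2\<close>.\<close>

definition mix_set :: "real \<Rightarrow> (real \<times> nat) set" where
  "mix_set D = {-1, 1} \<times> {..nat \<lfloor>sqrt D\<rfloor>}"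

definition mix_rate :: "real \<Rightarrow> real \<times> nat \<Rightarrow> real" where
  "mix_rate D \<tau> = fst \<tau> * real (snd \<tau>) / (2 * sqrt D)"

definition mix :: "real \<Rightarrow> real \<Rightarrow> real" where
  "mix D z = (\<Sum>\<tau>\<in>mix_set D. exp (mix_rate D \<tau> * z - 3 * D * (mix_rate D \<tau>)\<^sup>2))"

lemma finite_mix_set: "finite (mix_set D)"
  by (simp add: mix_set_def)

lemma mix_nonneg: "0 \<le> mix D z"
  unfolding mix_def by (intro sum_nonneg) auto

lemma mix_rate_square: "D > 0 \<Longrightarrow> \<tau> \<in> mix_set D \<Longrightarrow> D * (mix_rate D \<tau>)\<^sup>2 = (real (snd \<tau>))\<^sup>2 / 4"
  by (auto simp: mix_rate_def mix_set_def power_mult_distrib power_divide)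

lemma mix_rate_le:
  assumes "D \<ge> 1" "\<tau> \<in> mix_set D"
  shows "\<bar>mix_rate D \<tau>\<bar> \<le> 1 / 2"
proof -
  have "real (snd \<tau>) \<le> sqrt D"
    using assms by (auto simp: mix_set_def le_nat_iff le_floor_iff)
  thus ?thesis using assms by (auto simp: mix_rate_def mix_set_def field_simps)
qed

lemma mix_lower:
  assumes D: "D \<ge> 1" and z: "\<bar>z\<bar> \<le> 10 * D"
  shows "exp (z\<^sup>2 / (50 * D) - 4) \<le> mix D z"
proof -
  define r where "r = sqrt D"
  have r: "r \<ge> 1" "r * r = D" using D by (auto simp: r_def)
  \<comment> \<open>The grid point matching z: with y = |z| / sqrt D one has 10 j \<le> y \<le> 10
    (j + 1). The linear part j y / 2 \<ge> 5 j^2 exceeds the penalty 3 j^2 / 4 by at least 4 j^2,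
    while z^2 / (50 D) \<le> 4 j^2 + 4; this is the origin of the 4 in the exponent.\<close>
  define j where "j = nat \<lfloor>\<bar>z\<bar> / (10 * r)\<rfloor>"
  define s :: real where "s = (if z \<ge> 0 then 1 else -1)"
  have rj: "real j = of_int \<lfloor>\<bar>z\<bar> / (10 * r)\<rfloor>" using r by (simp add: j_def)
  have j1: "real j \<le> \<bar>z\<bar> / (10 * r)" "\<bar>z\<bar> / (10 * r) < real j + 1" unfolding rj by linarith+
  have "\<bar>z\<bar> / (10 * r) \<le> r" using z r by (simp add: field_simps)
  hence "j \<le> nat \<lfloor>sqrt D\<rfloor>" unfolding j_def r_def[symmetric] by (intro nat_mono floor_mono)
  hence mem: "(s, j) \<in> mix_set D" by (simp add: mix_set_def s_def)
  have "exp (z\<^sup>2 / (50 * D) - 4) \<le> exp (mix_rate D (s, j) * z - 3 * D * (mix_rate D (s, j))\<^sup>2)"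
  proof -
    define y where "y = \<bar>z\<bar> / r"
    have y: "10 * real j \<le> y" "y \<le> 10 * (real j + 1)" using j1 r by (auto simp: y_def field_simps)
    have "z\<^sup>2 / D = y\<^sup>2" unfolding y_def r(2)[symmetric] by (simp add: power_divide power2_eq_square)
    also have "\<dots> \<le> (10 * (real j + 1))\<^sup>2" using y by (intro power_mono) auto
    also have "\<dots> \<le> 200 * (real j)\<^sup>2 + 200"
      using zero_le_power2[of "real j - 1"] by (simp add: power2_eq_square algebra_simps)
    finally have 1: "z\<^sup>2 / (50 * D) \<le> 4 * (real j)\<^sup>2 + 4" by simp
    have e1: "mix_rate D (s, j) * z = real j * y / 2"
      by (auto simp: mix_rate_def s_def y_def r_def)
    have "real j * (10 * real j) \<le> real j * y" using y by (intro mult_left_mono) auto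
    hence e2: "10 * (real j)\<^sup>2 \<le> real j * y" by (simp add: power2_eq_square)
    have e3: "3 * D * (mix_rate D (s, j))\<^sup>2 = 3 * (real j)\<^sup>2 / 4"
      using mix_rate_square[OF _ mem] D by simp
    have "mix_rate D (s, j) * z - 3 * D * (mix_rate D (s, j))\<^sup>2 \<ge> 4 * (real j)\<^sup>2"
      using e1 e2 e3 zero_le_power2[of "real j"] by linarith
    thus ?thesis using 1 by simp
  qed
  also have "\<dots> \<le> mix D z"
    unfolding mix_def by (rule member_le_sum[OF mem]) (auto simp: finite_mix_set)
  finally show ?thesis .
qed

lemma exp_1_ge_2: "exp (1::real) \<ge> 2"
  using exp_ge_add_one_self[of "1::real"] by simp

lemma exp_1_ge: "exp (1::real) \<ge> 5 / 2"
  using exp_lower_Taylor_quadratic[of "1::real"] by simp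

text \<open>The penalty 3 D l^2 minus the cost 2 D l^2 of the exponential moment leaves D l^2 = j^2
  / 4. Both signs together give at most twice a geometric series of sum 5, and 10 \<le> exp
  3.\<close>

lemma mix_weight:
  assumes "D > 0"
  shows "(\<Sum>\<tau>\<in>mix_set D. exp (- D * (mix_rate D \<tau>)\<^sup>2)) \<le> exp 3"
proof -
  let ?r = "exp (- 1 / 4 :: real)"
  have r: "?r \<le> 4 / 5" using exp_ge_add_one_self[of "1 / 4 :: real"] by (simp add: exp_minus field_simps)
  have "(\<Sum>\<tau>\<in>mix_set D. exp (- D * (mix_rate D \<tau>)\<^sup>2)) \<le> (\<Sum>\<tau>\<in>mix_set D. (4 / 5) ^ snd \<tau>)"
  proof (rule sum_mono)
    fix \<tau> assume \<tau>: "\<tau> \<in> mix_set D"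
    have "exp (- D * (mix_rate D \<tau>)\<^sup>2) = exp (- ((real (snd \<tau>))\<^sup>2 / 4))"
      using mix_rate_square[OF assms \<tau>] by simp
    also have "\<dots> \<le> exp (real (snd \<tau>) * (- 1 / 4))"
    proof -
      have "real (snd \<tau>) \<le> real (snd \<tau> * snd \<tau>)" by (simp only: of_nat_le_iff le_square)
      thus ?thesis by (simp add: power2_eq_square)
    qed
    also have "\<dots> = ?r ^ snd \<tau>" by (rule exp_of_nat_mult)
    also have "\<dots> \<le> (4 / 5) ^ snd \<tau>" by (intro power_mono r) simp
    finally show "exp (- D * (mix_rate D \<tau>)\<^sup>2) \<le> (4 / 5) ^ snd \<tau>" .
  qed
  also have "\<dots> = 2 * (\<Sum>j\<le>nat \<lfloor>sqrt D\<rfloor>. (4 / 5 :: real) ^ j)"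
    unfolding mix_set_def by (subst sum.cartesian_product[symmetric, of "\<lambda>s j. (4 / 5) ^ j", unfolded split_def]) simp
  also have "(\<Sum>j\<le>nat \<lfloor>sqrt D\<rfloor>. (4 / 5 :: real) ^ j) \<le> (\<Sum>j. (4 / 5) ^ j)"
    by (rule sum_le_suminf) (auto intro: summable_geometric)
  also have "(\<Sum>j. (4 / 5 :: real) ^ j) = 5" by (subst suminf_geometric) auto
  also have "2 * 5 \<le> (5 / 2 :: real) ^ 3" by (simp add: power3_eq_cube)
  also have "\<dots> \<le> exp 1 ^ 3" by (intro power_mono exp_1_ge) simp
  also have "\<dots> = exp (3 :: real)" by (simp add: exp_of_nat_mult[symmetric])
  finally show ?thesis by simp
qed

text \<open>Multiplying out the product gives one summand for each choice of a rate at every vertex,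
  and each summand is the exponential of a linear degree statistic. After the expectation is taken
  the sum factors again over the vertices.\<close>

lemma gnp_mix_expectation:
  fixes p :: real
  assumes p: "0 \<le> p" "p \<le> 1" and A: "A \<subseteq> {..<n}" and D: "n * p \<ge> 1"
  shows "measure_pmf.expectation (gnp n p)
      (\<lambda>E. \<Prod>v<n. mix (n * p) (real (card (nbrs E v \<inter> A)) - p * card (A - {v}))) \<le> exp (3 * real n)"
proof -
  let ?D = "n * p" and ?z = "\<lambda>E v. real (card (nbrs E v \<inter> A)) - p * card (A - {v})"
  let ?G = "PiE {..<n} (\<lambda>_. mix_set ?D)"
  have fG: "finite ?G" by (intro finite_PiE) (auto simp: finite_mix_set)
  note int = integrable_measure_pmf_finite[OF finite_set_gnp]
  have "(\<Prod>v<n. mix ?D (?z E v)) = (\<Sum>g\<in>?G. \<Prod>v<n. exp (mix_rate ?D (g v) * ?z E v - 3 * ?D * (mix_rate ?D (g v))\<^sup>2))" for E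
    unfolding mix_def by (rule prod_sum_PiE) (auto simp: finite_mix_set)
  also have "(\<Sum>g\<in>?G. \<Prod>v<n. exp (mix_rate ?D (g v) * ?z E v - 3 * ?D * (mix_rate ?D (g v))\<^sup>2)) =
     (\<Sum>g\<in>?G. exp (\<Sum>v<n. mix_rate ?D (g v) * ?z E v) * exp (- 3 * ?D * (\<Sum>v<n. (mix_rate ?D (g v))\<^sup>2)))" for E
    by (intro sum.cong refl) (simp add: exp_sum[symmetric] exp_add[symmetric] sum_subtractf sum_distrib_left sum_negf)
  finally have "measure_pmf.expectation (gnp n p) (\<lambda>E. \<Prod>v<n. mix ?D (?z E v)) =
     (\<Sum>g\<in>?G. measure_pmf.expectation (gnp n p) (\<lambda>E. exp (\<Sum>v<n. mix_rate ?D (g v) * ?z E v)) * exp (- 3 * ?D * (\<Sum>v<n. (mix_rate ?D (g v))\<^sup>2)))"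
    by (simp add: int)
  also have "\<dots> \<le> (\<Sum>g\<in>?G. \<Prod>v<n. exp (- ?D * (mix_rate ?D (g v))\<^sup>2))"
  proof (rule sum_mono)
    fix g assume g: "g \<in> ?G"
    have "measure_pmf.expectation (gnp n p) (\<lambda>E. exp (\<Sum>v<n. mix_rate ?D (g v) * ?z E v)) \<le> exp (2 * ?D * (\<Sum>v<n. (mix_rate ?D (g v))\<^sup>2))"
      by (rule gnp_mgf_degrees[OF p A]) (rule mix_rate_le[OF D], use g in auto)
    hence "measure_pmf.expectation (gnp n p) (\<lambda>E. exp (\<Sum>v<n. mix_rate ?D (g v) * ?z E v)) * exp (- 3 * ?D * (\<Sum>v<n. (mix_rate ?D (g v))\<^sup>2))
      \<le> exp (2 * ?D * (\<Sum>v<n. (mix_rate ?D (g v))\<^sup>2)) * exp (- 3 * ?D * (\<Sum>v<n. (mix_rate ?D (g v))\<^sup>2))"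
      by (rule mult_right_mono) simp
    also have "\<dots> = exp (- ?D * (\<Sum>v<n. (mix_rate ?D (g v))\<^sup>2))"
      by (simp add: exp_add[symmetric])
    also have "\<dots> = (\<Prod>v<n. exp (- ?D * (mix_rate ?D (g v))\<^sup>2))"
      by (simp add: exp_sum[symmetric] sum_distrib_left sum_negf)
    finally show "measure_pmf.expectation (gnp n p) (\<lambda>E. exp (\<Sum>v<n. mix_rate ?D (g v) * ?z E v)) * exp (- 3 * ?D * (\<Sum>v<n. (mix_rate ?D (g v))\<^sup>2))
      \<le> (\<Prod>v<n. exp (- ?D * (mix_rate ?D (g v))\<^sup>2))" .
  qed
  also have "\<dots> = (\<Prod>v<n. \<Sum>\<tau>\<in>mix_set ?D. exp (- ?D * (mix_rate ?D \<tau>)\<^sup>2))"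
    by (rule prod_sum_PiE[symmetric]) (auto simp: finite_mix_set)
  also have "\<dots> \<le> (\<Prod>v<n. exp 3)"
    by (intro prod_mono conjI sum_nonneg mix_weight) (use D in auto)
  also have "\<dots> = exp (3 * real n)" by (simp add: exp_of_nat_mult[symmetric] mult.commute)
  finally show ?thesis .
qed

text \<open>The degree bound places every deviation in the range of \<open>mix_lower\<close>. On the
  event the product of mixtures is then at least exp (10 n - 4 n), against an expectation of at most
  exp (3 n).\<close>

lemma gnp_deviation_one:
  fixes p :: real
  assumes p: "0 \<le> p" "p \<le> 1" and A: "A \<subseteq> {..<n}" and D: "n * p \<ge> 1"
  shows "measure_pmf.prob (gnp n p) {E. (\<forall>v<n. deg E v \<le> 10 * (n * p)) \<and>
      (\<Sum>v<n. (real (card (nbrs E v \<inter> A)) - p * card (A - {v}))\<^sup>2) > 500 * real n * (n * p)} \<le> exp (- 3 * real n)"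
    (is "measure_pmf.prob _ ?S \<le> _")
proof -
  let ?D = "n * p" and ?z = "\<lambda>E v. real (card (nbrs E v \<inter> A)) - p * card (A - {v})"
  have "measure_pmf.prob (gnp n p) ?S \<le> measure_pmf.expectation (gnp n p) (\<lambda>E. (\<Prod>v<n. mix ?D (?z E v)) * exp (- 6 * real n))"
  proof (rule prob_le_expectation[OF finite_set_gnp])
    fix E assume E: "E \<in> set_pmf (gnp n p)" "E \<in> ?S"
    hence Ev: "E \<subseteq> vertex_pairs n" using set_gnp by blast
    have z: "\<bar>?z E v\<bar> \<le> 10 * ?D" if v: "v < n" for v
    proof -
      have "card (nbrs E v \<inter> A) \<le> deg E v"
        unfolding deg_def by (intro card_mono finite_nbrs[OF Ev]) auto
      hence 1: "real (card (nbrs E v \<inter> A)) \<le> 10 * ?D" using E v by force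
      have "card (A - {v}) \<le> card {..<n}" by (rule card_mono) (use A in auto)
      hence "p * card (A - {v}) \<le> p * n" using p by (intro mult_left_mono) auto
      moreover have "0 \<le> p * card (A - {v})" using p by simp
      ultimately show ?thesis using 1 D unfolding abs_le_iff mult.commute[of p] by linarith
    qed
    have "exp (6 * real n) \<le> exp ((\<Sum>v<n. (?z E v)\<^sup>2) / (50 * ?D) - 4 * n)"
    proof -
      have "500 * real n * ?D / (50 * ?D) \<le> (\<Sum>v<n. (?z E v)\<^sup>2) / (50 * ?D)"
        using E D by (intro divide_right_mono) auto
      moreover have eq: "500 * real n * d / (50 * d) = 10 * n" if "d \<ge> 1" for d :: real using that by (simp add: field_simps)
      ultimately have "10 * real n \<le> (\<Sum>v<n. (?z E v)\<^sup>2) / (50 * ?D)" unfolding eq[OF D] by simp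
      thus ?thesis by simp
    qed
    also have "\<dots> = (\<Prod>v<n. exp ((?z E v)\<^sup>2 / (50 * ?D) - 4))"
      by (simp add: exp_sum[symmetric] sum_subtractf sum_divide_distrib mult.commute)
    also have "\<dots> \<le> (\<Prod>v<n. mix ?D (?z E v))"
      by (intro prod_mono conjI mix_lower) (use z D in auto)
    finally show "1 \<le> (\<Prod>v<n. mix ?D (?z E v)) * exp (- 6 * real n)"
      by (simp add: exp_minus field_simps)
  qed (auto intro!: mult_nonneg_nonneg prod_nonneg mix_nonneg)
  also have "\<dots> = measure_pmf.expectation (gnp n p) (\<lambda>E. \<Prod>v<n. mix ?D (?z E v)) * exp (- 6 * real n)"
    by simp
  also have "\<dots> \<le> exp (3 * real n) * exp (- 6 * real n)"
    by (intro mult_right_mono gnp_mix_expectation assms) auto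
  finally show ?thesis by (simp add: exp_add[symmetric])
qed

lemma prob_UNION_le:
  fixes b :: real
  assumes "finite I" "\<And>i. i \<in> I \<Longrightarrow> measure_pmf.prob M (F i) \<le> b"
  shows "measure_pmf.prob M (\<Union>i\<in>I. F i) \<le> card I * b"
proof -
  have "measure_pmf.prob M (\<Union>i\<in>I. F i) \<le> (\<Sum>i\<in>I. measure_pmf.prob M (F i))"
    by (rule measure_UNION_le) (use assms in auto)
  also have "\<dots> \<le> (\<Sum>i\<in>I. b)" by (rule sum_mono) (use assms in auto)
  finally show ?thesis by simp
qed

text \<open>The union over all vertex sets costs 2^n \<le> exp n. The degree bound is kept inside
  the event because its failure has only polynomially small probability and is charged once, outside
  the union.\<close>

lemma gnp_deviation_all:
  fixes p :: real
  assumes p: "0 \<le> p" "p \<le> 1" and D: "n * p \<ge> 1"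
  shows "measure_pmf.prob (gnp n p) {E. (\<forall>v<n. deg E v \<le> 10 * (n * p)) \<and>
      (\<exists>A\<subseteq>{..<n}. (\<Sum>v<n. (real (card (nbrs E v \<inter> A)) - p * card (A - {v}))\<^sup>2) > 500 * real n * (n * p))} \<le> exp (- 2 * real n)"
    (is "measure_pmf.prob _ ?S \<le> _")
proof -
  let ?F = "\<lambda>A. {E. (\<forall>v<n. deg E v \<le> 10 * (n * p)) \<and>
      (\<Sum>v<n. (real (card (nbrs E v \<inter> A)) - p * card (A - {v}))\<^sup>2) > 500 * real n * (n * p)}"
  have "measure_pmf.prob (gnp n p) ?S \<le> measure_pmf.prob (gnp n p) (\<Union>A\<in>Pow {..<n}. ?F A)"
    by (rule measure_pmf.finite_measure_mono) auto
  also have "\<dots> \<le> card (Pow {..<n}) * exp (- 3 * real n)"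
    by (rule prob_UNION_le, simp, rule gnp_deviation_one[OF p _ D], simp)
  also have "\<dots> = 2 ^ n * exp (- 3 * real n)" by (simp add: card_Pow)
  also have "\<dots> \<le> exp 1 ^ n * exp (- 3 * real n)" by (intro mult_right_mono power_mono exp_1_ge_2) auto
  also have "\<dots> = exp (- 2 * real n)" by (simp add: exp_of_nat_mult[symmetric] exp_add[symmetric])
  finally show ?thesis .
qed

section \<open>Extreme degrees and dense pairs of vertex sets\<close>

lemma gnp_mgf_degree:
  fixes p l :: real
  assumes p: "0 \<le> p" "p \<le> 1" and v: "v < n"
  shows "measure_pmf.expectation (gnp n p) (\<lambda>E. exp (l * deg E v)) \<le> exp (p * (real n - 1) * (exp l - 1))"
proof -
  let ?c = "\<lambda>e. l * of_bool (v \<in> e) :: real"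
  have cardv: "card {e \<in> vertex_pairs n. v \<in> e} = n - 1"
  proof -
    have "card {e \<in> vertex_pairs n. v \<in> e \<and> e - {v} \<subseteq> UNIV} = card (nbrs (vertex_pairs n) v \<inter> UNIV)"
      by (rule card_nbrs_Int[symmetric, of _ n]) simp
    thus ?thesis using nbrs_complete[OF v] v by simp
  qed
  have "measure_pmf.expectation (gnp n p) (\<lambda>E. exp (l * deg E v)) = measure_pmf.expectation (gnp n p) (\<lambda>E. exp (\<Sum>e\<in>E. ?c e))"
  proof (rule expectation_cong_pmf)
    fix E assume "E \<in> set_pmf (gnp n p)"
    hence Ev: "E \<subseteq> vertex_pairs n" by (rule set_gnp)
    hence fE: "finite E" using finite_vertex_pairs finite_subset by blast
    have "deg E v = card {e \<in> E. v \<in> e}" using card_nbrs_Int[OF Ev, of v UNIV] by (simp add: deg_def)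
    thus "exp (l * deg E v) = exp (\<Sum>e\<in>E. ?c e)"
      using fE by (simp add: sum_distrib_left[symmetric] sum_of_bool_eq Int_def)
  qed
  also have "\<dots> \<le> exp (\<Sum>e\<in>vertex_pairs n. p * (exp (?c e) - 1))"
    unfolding gnp_eq_rand_subset by (rule rand_subset_mgf_le) (use p in \<open>auto simp: finite_vertex_pairs\<close>)
  also have "(\<Sum>e\<in>vertex_pairs n. p * (exp (?c e) - 1)) = (\<Sum>e\<in>{e \<in> vertex_pairs n. v \<in> e}. p * (exp l - 1))"
    by (rule sum.mono_neutral_cong_right) (auto simp: finite_vertex_pairs)
  also have "\<dots> = p * (real n - 1) * (exp l - 1)"
    using v by (simp add: cardv of_nat_diff)
  finally show ?thesis by simp
qed

lemma gnp_max_degree: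
  fixes p :: real
  assumes p: "0 \<le> p" "p \<le> 1" and v: "v < n"
  shows "measure_pmf.prob (gnp n p) {E. deg E v > 10 * (n * p)} \<le> exp (- 8 * (n * p))"
proof -
  have "measure_pmf.prob (gnp n p) {E. deg E v > 10 * (n * p)} \<le>
     measure_pmf.expectation (gnp n p) (\<lambda>E. exp (1 * deg E v) * exp (- 10 * (n * p)))"
    by (rule prob_le_expectation[OF finite_set_gnp]) (auto simp: exp_add[symmetric])
  also have "\<dots> = measure_pmf.expectation (gnp n p) (\<lambda>E. exp (1 * deg E v)) * exp (- 10 * (n * p))" by simp
  also have "\<dots> \<le> exp (p * (real n - 1) * (exp 1 - 1)) * exp (- 10 * (n * p))"
    using gnp_mgf_degree[OF p v, of 1] by (intro mult_right_mono) auto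
  also have "\<dots> \<le> exp (p * n * 2) * exp (- 10 * (n * p))"
  proof -
    have "exp (1::real) - 1 \<le> 2" using exp_bound[of 1] by simp
    hence "p * (real n - 1) * (exp 1 - 1) \<le> p * n * 2"
      using p v exp_1_ge_2 by (intro mult_mono) auto
    thus ?thesis by simp
  qed
  also have "\<dots> = exp (- 8 * (n * p))" by (simp add: exp_add[symmetric] mult_ac)
  finally show ?thesis .
qed

text \<open>Chernoff with a free tilt \<theta>, since near the connectivity threshold the exponent
  must stay close to n p. The summand 1 absorbs the difference between n - 1 and n.\<close>

lemma gnp_min_degree:
  fixes p :: real
  assumes p: "0 \<le> p" "p \<le> 1" and v: "v < n" and \<theta>: "\<theta> \<ge> 0"
  shows "measure_pmf.prob (gnp n p) {E. deg E v < \<eta> * (n * p)} \<le> exp (1 - (n * p) * (1 - exp (- \<theta>) - \<theta> * \<eta>))"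
proof -
  have "measure_pmf.prob (gnp n p) {E. deg E v < \<eta> * (n * p)} \<le>
     measure_pmf.expectation (gnp n p) (\<lambda>E. exp (- \<theta> * deg E v) * exp (\<theta> * (\<eta> * (n * p))))"
  proof (rule prob_le_expectation[OF finite_set_gnp])
    fix E assume "E \<in> {E. deg E v < \<eta> * (n * p)}"
    hence "\<theta> * deg E v \<le> \<theta> * (\<eta> * (n * p))" using \<theta> by (intro mult_left_mono) auto
    thus "1 \<le> exp (- \<theta> * deg E v) * exp (\<theta> * (\<eta> * (n * p)))" by (simp add: exp_add[symmetric])
  qed auto
  also have "\<dots> = measure_pmf.expectation (gnp n p) (\<lambda>E. exp (- \<theta> * deg E v)) * exp (\<theta> * (\<eta> * (n * p)))" by simp
  also have "\<dots> \<le> exp (p * (real n - 1) * (exp (- \<theta>) - 1)) * exp (\<theta> * (\<eta> * (n * p)))"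
    using gnp_mgf_degree[OF p v, of "- \<theta>"] by (intro mult_right_mono) auto
  also have "\<dots> = exp (p * (1 - exp (- \<theta>)) - (n * p) * (1 - exp (- \<theta>) - \<theta> * \<eta>))"
    by (simp add: exp_add[symmetric] algebra_simps)
  also have "\<dots> \<le> exp (1 - (n * p) * (1 - exp (- \<theta>) - \<theta> * \<eta>))"
  proof -
    have "p * (1 - exp (- \<theta>)) \<le> 1" using p \<theta> by (intro mult_le_one) auto
    thus ?thesis by simp
  qed
  finally show ?thesis .
qed

text \<open>A pair with both ends in the intersection of \<open>A\<close> and \<open>B\<close> is
  counted twice. The multiplicity s is thus 0, 1 or 2, and exp (\<theta> s) - 1 \<le> exp (2
  \<theta>) s.\<close>

lemma gnp_dense_pair:
  fixes p :: real
  assumes p: "0 \<le> p" "p \<le> 1" and A: "A \<subseteq> {..<n}" and B: "B \<subseteq> {..<n}" and \<theta>: "\<theta> > 0"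
  shows "measure_pmf.prob (gnp n p) {E. \<forall>v\<in>B. real (card (nbrs E v \<inter> A)) > M}
    \<le> exp (card B * (p * card A * exp (2 * \<theta>) - \<theta> * M))"
proof -
  let ?f = "\<lambda>e v. of_bool (v \<in> e \<and> e - {v} \<subseteq> A) :: real"
  let ?c = "\<lambda>e. \<Sum>v\<in>B. \<theta> * ?f e v"
  have fA: "finite A" "finite B" using A B finite_subset by blast+
  have "measure_pmf.prob (gnp n p) {E. \<forall>v\<in>B. real (card (nbrs E v \<inter> A)) > M} \<le>
    measure_pmf.expectation (gnp n p) (\<lambda>E. exp (\<Sum>e\<in>E. ?c e) * exp (- \<theta> * (card B * M)))"
  proof (rule prob_le_expectation[OF finite_set_gnp])
    fix E assume "E \<in> set_pmf (gnp n p)" and E: "E \<in> {E. \<forall>v\<in>B. real (card (nbrs E v \<inter> A)) > M}"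
    hence Ev: "E \<subseteq> vertex_pairs n" by (auto dest: set_gnp)
    have "(\<Sum>v\<in>B. \<theta> * M) \<le> (\<Sum>v\<in>B. \<theta> * real (card (nbrs E v \<inter> A)))"
      using E \<theta> by (intro sum_mono mult_left_mono) auto
    thus "1 \<le> exp (\<Sum>e\<in>E. ?c e) * exp (- \<theta> * (card B * M))"
      unfolding sum_nbrs_Int[OF Ev] by (simp add: exp_add[symmetric] mult_ac)
  qed auto
  also have "\<dots> = measure_pmf.expectation (gnp n p) (\<lambda>E. exp (\<Sum>e\<in>E. ?c e)) * exp (- \<theta> * (card B * M))" by simp
  also have "\<dots> \<le> exp (\<Sum>e\<in>vertex_pairs n. p * (exp (?c e) - 1)) * exp (- \<theta> * (card B * M))"
    unfolding gnp_eq_rand_subset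
    by (intro mult_right_mono rand_subset_mgf_le) (use p in \<open>auto simp: finite_vertex_pairs\<close>)
  also have "(\<Sum>e\<in>vertex_pairs n. p * (exp (?c e) - 1)) \<le> (\<Sum>e\<in>vertex_pairs n. p * (\<Sum>v\<in>B. exp (2 * \<theta>) * ?f e v))"
  proof (intro sum_mono mult_left_mono p)
    fix e assume e: "e \<in> vertex_pairs n"
    define s where "s = (\<Sum>v\<in>B. ?f e v)"
    have "s \<le> (\<Sum>v\<in>e. 1)"
    proof -
      have fe: "finite e" using e by (auto simp: vertex_pairs_def card_2_iff)
      have "s = (\<Sum>v\<in>B \<inter> e. ?f e v)"
        unfolding s_def by (rule sum.mono_neutral_right) (use fA in auto)
      also have "\<dots> \<le> (\<Sum>v\<in>B \<inter> e. 1)" by (rule sum_mono) auto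
      also have "\<dots> \<le> (\<Sum>v\<in>e. 1)" by (rule sum_mono2) (use fe in auto)
      finally show ?thesis .
    qed
    hence s2: "s \<le> 2" using e by (simp add: vertex_pairs_def)
    have s01: "s = 0 \<or> s \<ge> 1"
    proof -
      have "s = of_nat (card {v \<in> B. v \<in> e \<and> e - {v} \<subseteq> A})"
        unfolding s_def using fA by (simp add: sum_of_bool_eq Int_def)
      thus ?thesis by (cases "card {v \<in> B. v \<in> e \<and> e - {v} \<subseteq> A}") auto
    qed
    have "exp (\<theta> * s) - 1 \<le> exp (2 * \<theta>) * s"
    proof (cases "s = 0")
      case False
      hence "s \<ge> 1" using s01 by simp
      hence "exp (2 * \<theta>) * 1 \<le> exp (2 * \<theta>) * s" by (intro mult_left_mono) auto
      moreover have "exp (\<theta> * s) \<le> exp (2 * \<theta>)" using s2 \<theta> by simp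
      ultimately show ?thesis by linarith
    qed simp
    thus "exp (?c e) - 1 \<le> (\<Sum>v\<in>B. exp (2 * \<theta>) * ?f e v)"
      by (simp add: s_def sum_distrib_left)
  qed
  also have "\<dots> = p * (\<Sum>v\<in>B. exp (2 * \<theta>) * card (A - {v}))"
    unfolding sum_distrib_left[symmetric, of p] sum_complete[OF A B] ..
  also have "\<dots> \<le> p * (\<Sum>v\<in>B. exp (2 * \<theta>) * card A)"
    using p fA by (intro mult_left_mono sum_mono) (auto intro!: card_mono)
  also have "\<dots> = card B * (p * card A * exp (2 * \<theta>))" by simp
  also have "exp (card B * (p * card A * exp (2 * \<theta>))) * exp (- \<theta> * (card B * M)) =
     exp (card B * (p * card A * exp (2 * \<theta>) - \<theta> * M))"
    by (simp add: exp_add[symmetric] algebra_simps)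
  finally show ?thesis by simp
qed

text \<open>The average degree is written as \<open>r ^ 32\<close> so that all the powers of it that occur in the
  argument are integral powers of \<open>r\<close>.\<close>

definition sparse_graph :: "nat \<Rightarrow> real \<Rightarrow> nat set set \<Rightarrow> bool" where
  "sparse_graph n r E \<longleftrightarrow> (\<forall>A\<subseteq>{..<n}. real (card A) * r ^ 4 \<le> real n \<longrightarrow>
     real (card {v \<in> {..<n}. r ^ 30 < real (card (nbrs E v \<inter> A))}) * r ^ 8 \<le> real (card A))"

text \<open>The three properties are lower and upper degree bounds, the second moment of the degrees
  into every \<open>A\<close>, and sparsity. Only the first mentions \<eta>. The centre uses
  \<open>card A\<close> even for vertices of \<open>A\<close>, so that it is the same at all
  vertices.\<close>

definition good_graph :: "real \<Rightarrow> nat \<Rightarrow> real \<Rightarrow> nat set set \<Rightarrow> bool" where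
  "good_graph \<eta> n r E \<longleftrightarrow> E \<subseteq> vertex_pairs n \<and>
     (\<forall>v<n. \<eta> * r ^ 32 \<le> real (deg E v) \<and> real (deg E v) \<le> 10 * r ^ 32) \<and>
     (\<forall>A\<subseteq>{..<n}. (\<Sum>v<n. (real (card (nbrs E v \<inter> A)) - r ^ 32 / real n * real (card A))\<^sup>2) \<le> 1002 * real n * r ^ 32) \<and>
     sparse_graph n r E"

text \<open>One term of (1 + t)^n with t = s / n. Paying t^s instead of t^b gives one bound for all
  b \<le> s, so that both sets of the later union bound cost the same.\<close>

lemma binomial_le_exp:
  fixes s b n :: nat
  assumes "1 \<le> s" "b \<le> s" "s \<le> n"
  shows "real (n choose b) \<le> exp (real s + real s * ln (real n / real s))"
proof -
  define t where "t = real s / n"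
  have t: "0 < t" "t \<le> 1" using assms by (auto simp: t_def)
  have "real (n choose b) * t ^ s \<le> real (n choose b) * t ^ b"
    using t assms by (intro mult_left_mono power_decreasing) auto
  also have "\<dots> = real (n choose b) * t ^ b * 1 ^ (n - b)" by simp
  also have "\<dots> \<le> (\<Sum>k\<le>n. real (n choose k) * t ^ k * 1 ^ (n - k))"
    by (rule member_le_sum) (use assms t in auto)
  also have "\<dots> = (t + 1) ^ n" by (rule binomial_ring[symmetric])
  also have "\<dots> \<le> exp t ^ n" using exp_ge_add_one_self[of t] t by (intro power_mono) (auto simp: add.commute)
  also have "\<dots> = exp s" using assms by (simp add: exp_of_nat_mult[symmetric] t_def)
  finally have "real (n choose b) * t ^ s \<le> exp s" .
  moreover have "t ^ s * exp (real s * ln (real n / real s)) = 1"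
  proof -
    have "exp (real s * ln (real n / real s)) = (real n / real s) ^ s" using assms by (simp add: exp_of_nat_mult)
    thus ?thesis using assms by (simp add: t_def power_mult_distrib[symmetric] flip: power_divide)
  qed
  ultimately have "real (n choose b) = real (n choose b) * t ^ s * exp (real s * ln (real n / real s))"
    by (simp only: mult.assoc mult_1_right)
  also have "\<dots> \<le> exp s * exp (real s * ln (real n / real s))"
    using \<open>real (n choose b) * t ^ s \<le> exp s\<close> by (rule mult_right_mono) simp
  finally show ?thesis by (simp add: exp_add)
qed

lemma card_subsets_of_card: "card {A. A \<subseteq> {..<n::nat} \<and> card A = b} = n choose b"
  using n_subsets[of "{..<n}" b] by simp

text \<open>Either s^2 \<le> n and the logarithm is at least ln n / 2, or s itself exceeds sqrt n.
  This makes the tail polynomially small also for the smallest sets.\<close>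

lemma size_times_log:
  fixes s n :: nat
  assumes "1 \<le> s" "s \<le> n" "ln (real n / real s) \<ge> 1"
  shows "real s * ln (real n / real s) \<ge> ln n / 2"
proof (cases "s * s \<le> n")
  case True
  have "ln n \<le> ln ((real n / real s)\<^sup>2)"
  proof (rule ln_mono)
    have "real (s * s) \<le> real n" using True by (simp only: of_nat_le_iff)
    hence "real s * s * n \<le> real n * n" by (intro mult_right_mono) auto
    thus "real n \<le> (real n / real s)\<^sup>2" using assms by (simp add: power2_eq_square field_simps)
  qed (use assms in auto)
  also have "\<dots> = 2 * ln (real n / real s)" using assms by (simp add: ln_realpow)
  finally have "ln n / 2 \<le> 1 * ln (real n / real s)" by simp
  also have "\<dots> \<le> real s * ln (real n / real s)" using assms by (intro mult_right_mono) auto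
  finally show ?thesis .
next
  case False
  hence "real n \<le> real (s * s)" by (simp only: of_nat_le_iff not_le less_imp_le)
  hence "ln (real n) \<le> ln ((real s)\<^sup>2)" using assms by (intro ln_mono) (auto simp: power2_eq_square)
  also have "\<dots> = 2 * ln (real s)" using assms by (simp add: ln_realpow)
  also have "\<dots> \<le> 2 * real s" using ln_le_minus_one[of "real s"] assms by simp
  finally have "ln n / 2 \<le> real s * 1" by simp
  also have "\<dots> \<le> real s * ln (real n / real s)" using assms by (intro mult_left_mono) auto
  finally show ?thesis .
qed

text \<open>A vertex has on average at most about D / r^4 = r^28 neighbours in \<open>A\<close>, far
  below r^30. A violation exhibits \<open>b\<close> vertices that all exceed r^30, and a union bound
  over both sets remains affordable.\<close>

lemma gnp_not_sparse_size:
  fixes p r :: real and s n :: nat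
  assumes p: "0 \<le> p" "p \<le> 1" and r: "r \<ge> 16" and D: "real n * p = r ^ 32"
    and s: "1 \<le> s" "s \<le> n" and sr: "real s * r ^ 4 \<le> real n"
  shows "measure_pmf.prob (gnp n p) {E. \<exists>A\<subseteq>{..<n}. card A = s \<and>
      real (card {v \<in> {..<n}. r ^ 30 < real (card (nbrs E v \<inter> A))}) * r ^ 8 > real s} \<le> real n powr (- 4)"
    (is "measure_pmf.prob _ ?S \<le> _")
proof -
  define L where "L = ln (real n / real s)"
  \<comment> \<open>The least integer above s / r^8: a violating set of heavy vertices contains a
    subset of this size.\<close>
  define b where "b = nat \<lfloor>s / r ^ 8\<rfloor> + 1"
  have "ln r \<ge> 1"
  proof -
    have "exp 1 \<le> r" using r exp_bound[of 1] by simp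
    thus ?thesis using r by (subst ln_ge_iff) auto
  qed
  moreover have "L \<ge> 4 * ln r"
  proof -
    have "ln (r ^ 4) \<le> L" unfolding L_def using sr s r by (intro ln_mono) (auto simp: field_simps)
    thus ?thesis using r by (simp add: ln_realpow)
  qed
  ultimately have L: "L \<ge> 4" "L \<ge> 4 * ln r" by linarith+
  have r8: "r ^ 8 > 1" using r by (intro one_less_power) auto
  have "s / r ^ 8 < s" using r8 s by (simp add: divide_less_eq)
  hence b: "b \<le> s" "b \<ge> 1" unfolding b_def using s by linarith+
  have bs: "real b \<ge> s / r ^ 8" unfolding b_def using r8 by linarith
  have tail: "measure_pmf.prob (gnp n p) {E. \<forall>v\<in>B. real (card (nbrs E v \<inter> A)) > r ^ 30} \<le> exp (- 12 * (real s * L))"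
    if AB: "A \<subseteq> {..<n}" "card A = s" "B \<subseteq> {..<n}" "card B = b" for A B
  proof -
    \<comment> \<open>The tilt L / 8 multiplies the mean term D exp (- L) only by exp (L / 4),
      leaving at most D / r^3 = r^29, while the threshold gains L r^30 / 8. With b \<ge> s / r^8 the
      exponent beats the two union costs of s + s L each.\<close>
    have "measure_pmf.prob (gnp n p) {E. \<forall>v\<in>B. real (card (nbrs E v \<inter> A)) > r ^ 30}
      \<le> exp (card B * (p * card A * exp (2 * (L / 8)) - L / 8 * r ^ 30))"
      by (rule gnp_dense_pair[OF p]) (use AB L in auto)
    also have "\<dots> \<le> exp (- 12 * (real s * L))"
    proof -
      have "p * s * exp (2 * (L / 8)) = r ^ 32 * (exp (- L) * exp (L / 4))"
        using s by (simp add: D[symmetric] L_def exp_minus field_simps)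
      also have "\<dots> = r ^ 32 * exp (- 3 / 4 * L)" by (simp add: exp_add[symmetric])
      also have "\<dots> \<le> r ^ 32 * exp (- (3 * ln r))"
        using L r by (intro mult_left_mono) auto
      also have "exp (- (3 * ln r)) = 1 / r ^ 3"
        proof -
          have "exp (3 * ln r) = r ^ 3" using r exp_of_nat_mult[of 3 "ln r"] by simp
          thus ?thesis by (simp only: exp_minus inverse_eq_divide)
        qed
      also have "r ^ 32 * (1 / r ^ 3) = r ^ 29" using r by (simp add: field_simps flip: power_add)
      finally have 1: "p * s * exp (2 * (L / 8)) \<le> r ^ 29" .
      have "16 * r ^ 29 \<le> r * r ^ 29" using r by (intro mult_right_mono) auto
      also have "\<dots> = r ^ 30 * 1" by (simp flip: power_Suc)
      also have "\<dots> \<le> r ^ 30 * L" using L r by (intro mult_left_mono) auto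
      finally have 2: "p * s * exp (2 * (L / 8)) - L / 8 * r ^ 30 \<le> - (L * r ^ 30 / 16)"
        using 1 by (simp add: mult.commute)
      have "s / r ^ 8 * (L * r ^ 30 / 16) \<le> b * (L * r ^ 30 / 16)"
        using bs L r by (intro mult_right_mono) auto
      moreover have "s / r ^ 8 * (L * r ^ 30 / 16) = s * L * (r ^ 22 / 16)"
        using r by (simp add: field_simps flip: power_add)
      moreover have "s * L * 12 \<le> s * L * (r ^ 22 / 16)"
      proof (rule mult_left_mono)
        have "(16::real) ^ 2 \<le> r ^ 2" using r by (intro power_mono) auto
        also have "\<dots> \<le> r ^ 22" using r by (intro power_increasing) auto
        finally show "12 \<le> r ^ 22 / 16" by simp
      qed (use L in simp)
      moreover have "b * (p * s * exp (2 * (L / 8)) - L / 8 * r ^ 30) \<le> b * (- (L * r ^ 30 / 16))"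
        using 2 by (intro mult_left_mono) auto
      ultimately show ?thesis using AB by simp
    qed
    finally show ?thesis .
  qed
  let ?A = "{A. A \<subseteq> {..<n} \<and> card A = s}" and ?B = "{B. B \<subseteq> {..<n} \<and> card B = b}"
  have fin: "finite ?A" "finite ?B" by (auto intro: finite_subset[of _ "Pow {..<n}"])
  have "measure_pmf.prob (gnp n p) ?S \<le>
     measure_pmf.prob (gnp n p) (\<Union>A\<in>?A. \<Union>B\<in>?B. {E. \<forall>v\<in>B. real (card (nbrs E v \<inter> A)) > r ^ 30})"
  proof (rule measure_pmf.finite_measure_mono, rule subsetI)
    fix E assume "E \<in> ?S"
    then obtain A where A: "A \<subseteq> {..<n}" "card A = s"
      and gt: "real (card {v \<in> {..<n}. r ^ 30 < real (card (nbrs E v \<inter> A))}) * r ^ 8 > real s" by auto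
    let ?H = "{v \<in> {..<n}. r ^ 30 < real (card (nbrs E v \<inter> A))}"
    have "real (card ?H) > s / r ^ 8" using gt r by (simp add: divide_less_eq)
    moreover have "nat \<lfloor>x\<rfloor> + 1 \<le> m" if "x < real m" "x \<ge> 0" for x :: real and m
      using that by (simp add: Suc_le_eq nat_less_iff floor_less_iff)
    ultimately have "b \<le> card ?H" unfolding b_def using r by simp
    then obtain B where B: "B \<subseteq> ?H" "card B = b" by (rule obtain_subset_with_card_n)
    hence "B \<in> ?B" "\<forall>v\<in>B. real (card (nbrs E v \<inter> A)) > r ^ 30" by auto
    thus "E \<in> (\<Union>A\<in>?A. \<Union>B\<in>?B. {E. \<forall>v\<in>B. real (card (nbrs E v \<inter> A)) > r ^ 30})" using A by blast
  qed simp
  also have "\<dots> \<le> card ?A * (card ?B * exp (- 12 * (real s * L)))"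
    by (intro prob_UNION_le fin) (use tail in auto)
  also have "\<dots> \<le> exp (real s + real s * L) * (exp (real s + real s * L) * exp (- 12 * (real s * L)))"
    unfolding card_subsets_of_card L_def
    by (intro mult_mono binomial_le_exp) (use s b in auto)
  also have "\<dots> = exp (2 * real s - 10 * (real s * L))" by (simp add: exp_add[symmetric])
  also have "\<dots> \<le> exp (- (4 * ln n))"
  proof -
    have "real s * 1 \<le> s * L" using L by (intro mult_left_mono) auto
    moreover have "s * L \<ge> ln n / 2" unfolding L_def by (rule size_times_log) (use s L in \<open>auto simp: L_def\<close>)
    ultimately show ?thesis by simp
  qed
  also have "\<dots> = real n powr (- 4)" using s by (simp add: powr_def)
  finally show ?thesis .
qed

lemma gnp_not_sparse:
  fixes p r :: real
  assumes p: "0 \<le> p" "p \<le> 1" and r: "r \<ge> 16" and D: "real n * p = r ^ 32" and n: "n \<ge> 1"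
  shows "measure_pmf.prob (gnp n p) {E. \<not> sparse_graph n r E} \<le> real n powr (- 3)"
proof -
  let ?F = "\<lambda>s. {E. real s * r ^ 4 \<le> real n \<and> (\<exists>A\<subseteq>{..<n}. card A = s \<and>
      real (card {v \<in> {..<n}. r ^ 30 < real (card (nbrs E v \<inter> A))}) * r ^ 8 > real s)}"
  have "measure_pmf.prob (gnp n p) {E. \<not> sparse_graph n r E} \<le> measure_pmf.prob (gnp n p) (\<Union>s\<in>{1..n}. ?F s)"
  proof (rule measure_pmf.finite_measure_mono, rule subsetI)
    fix E assume "E \<in> {E. \<not> sparse_graph n r E}"
    then obtain A where A: "A \<subseteq> {..<n}" "real (card A) * r ^ 4 \<le> real n"
      "real (card {v \<in> {..<n}. r ^ 30 < real (card (nbrs E v \<inter> A))}) * r ^ 8 > real (card A)"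
      by (auto simp: sparse_graph_def not_le)
    have "card A \<noteq> 0"
    proof
      assume "card A = 0"
      hence "A = {}" using A(1) finite_subset[of A "{..<n}"] by simp
      moreover have "\<not> r ^ 30 < 0" using r by (simp add: not_less)
      ultimately show False using A(3) by simp
    qed
    moreover have "card A \<le> n" using card_mono[OF _ A(1)] by simp
    ultimately have "card A \<in> {1..n}" by simp
    thus "E \<in> (\<Union>s\<in>{1..n}. ?F s)" using A by blast
  qed simp
  also have "\<dots> \<le> card {1..n} * real n powr (- 4)"
  proof (rule prob_UNION_le)
    fix s assume s: "s \<in> {1..n}"
    show "measure_pmf.prob (gnp n p) (?F s) \<le> real n powr (- 4)"
    proof (cases "real s * r ^ 4 \<le> real n")
      case True
      thus ?thesis using gnp_not_sparse_size[OF p r D _ _ True] s by auto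
    qed simp
  qed simp
  also have "\<dots> = real n powr 1 * real n powr (- 4)" using n by simp
  also have "\<dots> = real n powr (- 3)" using n by (subst powr_add[symmetric]) simp
  finally show ?thesis .
qed

text \<open>With \<kappa> = (\<epsilon> / 2) / (1 + \<epsilon>), the two losses exp (- \<theta>) and
  \<theta> \<eta> get \<kappa> / 2 each. The exponent 1 + \<epsilon> / 2 beats the union over n
  vertices.\<close>

lemma min_degree_constants:
  assumes "\<epsilon> > (0::real)"
  obtains \<theta> \<eta> where "\<theta> > 0" "0 < \<eta>" "\<eta> \<le> 1" "(1 + \<epsilon>) * (1 - exp (- \<theta>) - \<theta> * \<eta>) \<ge> 1 + \<epsilon> / 2"
proof -
  define \<kappa> where "\<kappa> = \<epsilon> / 2 / (1 + \<epsilon>)"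
  have k: "0 < \<kappa>" "\<kappa> < 1" using assms by (auto simp: \<kappa>_def field_simps)
  define \<theta> where "\<theta> = ln (2 / \<kappa>)"
  have t0: "\<theta> > 0" using k by (simp add: \<theta>_def ln_gt_zero)
  have et: "exp (- \<theta>) = \<kappa> / 2" using k by (simp add: \<theta>_def exp_minus)
  define \<eta> where "\<eta> = min 1 (\<kappa> / (2 * \<theta>))"
  have e: "0 < \<eta>" "\<eta> \<le> 1" using k t0 by (auto simp: \<eta>_def)
  have "\<theta> * \<eta> \<le> \<theta> * (\<kappa> / (2 * \<theta>))" using t0 by (intro mult_left_mono) (auto simp: \<eta>_def)
  hence "\<theta> * \<eta> \<le> \<kappa> / 2" using t0 by simp
  hence "(1 + \<epsilon>) * (1 - \<kappa>) \<le> (1 + \<epsilon>) * (1 - exp (- \<theta>) - \<theta> * \<eta>)"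
    using assms et by (intro mult_left_mono) auto
  moreover have "(1 + \<epsilon>) * (1 - \<kappa>) = 1 + \<epsilon> / 2" using assms by (simp add: \<kappa>_def field_simps)
  ultimately show ?thesis using that t0 e by metis
qed

lemma gnp_good:
  assumes "\<epsilon> > (0::real)"
  obtains \<eta> c N where "0 < \<eta>" "\<eta> \<le> 1" "c > 0"
    "\<And>n p r. n \<ge> N \<Longrightarrow> 0 \<le> p \<Longrightarrow> p \<le> 1 \<Longrightarrow> r \<ge> 16 \<Longrightarrow> real n * p = r ^ 32 \<Longrightarrow> real n * p \<ge> (1 + \<epsilon>) * ln n \<Longrightarrow>
      measure_pmf.prob (gnp n p) {E. good_graph \<eta> n r E} \<ge> 1 - real n powr (- c)"
proof -
  obtain \<theta> \<eta> where \<theta>: "\<theta> > 0" "0 < \<eta>" "\<eta> \<le> 1" and key: "(1 + \<epsilon>) * (1 - exp (- \<theta>) - \<theta> * \<eta>) \<ge> 1 + \<epsilon> / 2"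
    using min_degree_constants[OF assms] by metis
  \<comment> \<open>The minimum-degree event has probability O(n^(- \<epsilon> / 2)), so all
    failures are at most multiples of n^(- 2 c). The multiplicities 1 + 3 + 1 + 1 = 6 are absorbed
    by n^c for n \<ge> N.\<close>
  define c where "c = min 1 (\<epsilon> / 4)"
  have c: "c > 0" "c \<le> 1" "2 * c \<le> \<epsilon> / 2" using assms by (auto simp: c_def)
  define N where "N = nat \<lceil>6 powr (1 / c)\<rceil> + 1"
  show thesis
  proof (rule that[OF \<theta>(2,3) c(1)])
    fix n :: nat and p r :: real
    assume n: "n \<ge> N" and p: "0 \<le> p" "p \<le> 1" and r: "r \<ge> 16" and D: "real n * p = r ^ 32"
      and lnn: "real n * p \<ge> (1 + \<epsilon>) * ln n"
    have nN: "real n \<ge> 6 powr (1 / c)" "n \<ge> 1" using n unfolding N_def by linarith+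
    have n6: "real n powr c \<ge> 6"
    proof -
      have "6 = (6 powr (1 / c)) powr c" using c by (simp add: powr_powr)
      also have "\<dots> \<le> real n powr c" using nN c by (intro powr_mono2) auto
      finally show ?thesis .
    qed
    have ln0: "ln n \<ge> 0" using nN by simp
    have D1: "real n * p \<ge> 1" unfolding D using r by (intro one_le_power) auto
    have Dln: "real n * p \<ge> ln n"
    proof -
      have "0 \<le> \<epsilon> * ln n" using assms ln0 by simp
      thus ?thesis using lnn by (simp add: distrib_right)
    qed
    let ?P = "measure_pmf.prob (gnp n p)"
    let ?S1 = "\<Union>v\<in>{..<n}. {E. deg E v > 10 * (n * p)}"
    let ?S2 = "\<Union>v\<in>{..<n}. {E. deg E v < \<eta> * (n * p)}"
    let ?S3 = "{E. (\<forall>v<n. deg E v \<le> 10 * (n * p)) \<and>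
      (\<exists>A\<subseteq>{..<n}. (\<Sum>v<n. (real (card (nbrs E v \<inter> A)) - p * card (A - {v}))\<^sup>2) > 500 * real n * (n * p))}"
    let ?S4 = "{E. \<not> sparse_graph n r E}"
    have m2: "real n powr (- a) \<le> real n powr (- 2 * c)" if "a \<ge> 2 * c" for a
      using that nN by (intro powr_mono) auto
    have S1: "?P ?S1 \<le> real n powr (- 2 * c)"
    proof -
      have "?P ?S1 \<le> card {..<n} * exp (- 8 * (n * p))"
        by (rule prob_UNION_le) (use gnp_max_degree[OF p] in auto)
      also have "\<dots> \<le> real n * exp (- (8 * ln n))" using Dln by (simp add: mult_left_mono)
      also have "exp (- (8 * ln n)) = real n powr (- 8)" using nN by (simp add: powr_def)
      also have "real n * real n powr (- 8) = real n powr 1 * real n powr (- 8)" by simp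
      also have "\<dots> = real n powr (- 7)" by (subst powr_add[symmetric]) simp
      also have "\<dots> \<le> real n powr (- 2 * c)" using m2[of 7] c by simp
      finally show ?thesis .
    qed
    have S2: "?P ?S2 \<le> 3 * real n powr (- 2 * c)"
    proof -
      have "?P ?S2 \<le> card {..<n} * exp (1 - (n * p) * (1 - exp (- \<theta>) - \<theta> * \<eta>))"
        by (rule prob_UNION_le) (use gnp_min_degree[OF p] \<theta> in auto)
      also have "\<dots> \<le> real n * exp (1 - (1 + \<epsilon> / 2) * ln n)"
      proof -
        have pos: "1 - exp (- \<theta>) - \<theta> * \<eta> \<ge> 0"
        proof (rule ccontr)
          assume "\<not> ?thesis"
          hence "(1 + \<epsilon>) * (1 - exp (- \<theta>) - \<theta> * \<eta>) \<le> 0" using assms by (intro mult_nonneg_nonpos) auto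
          thus False using key assms by linarith
        qed
        have "(1 + \<epsilon> / 2) * ln n \<le> (1 + \<epsilon>) * (1 - exp (- \<theta>) - \<theta> * \<eta>) * ln n"
          using key ln0 by (intro mult_right_mono) auto
        also have "\<dots> = (1 + \<epsilon>) * ln n * (1 - exp (- \<theta>) - \<theta> * \<eta>)" by (simp add: mult_ac)
        also have "\<dots> \<le> (n * p) * (1 - exp (- \<theta>) - \<theta> * \<eta>)" using lnn pos by (intro mult_right_mono) auto
        finally show ?thesis by (simp add: mult_left_mono)
      qed
      also have "exp (1 - (1 + \<epsilon> / 2) * ln n) = exp 1 * real n powr (- (1 + \<epsilon> / 2))"
        using nN by (simp add: powr_def exp_add[symmetric] algebra_simps)
      also have "real n * (exp 1 * real n powr (- (1 + \<epsilon> / 2))) = exp 1 * (real n powr 1 * real n powr (- (1 + \<epsilon> / 2)))"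
        by simp
      also have "\<dots> = exp 1 * real n powr (- (\<epsilon> / 2))"
        by (subst powr_add[symmetric]) simp
      also have "\<dots> \<le> 3 * real n powr (- 2 * c)"
        using m2[of "\<epsilon> / 2"] c exp_bound[of 1] by (intro mult_mono) auto
      finally show ?thesis .
    qed
    have S3: "?P ?S3 \<le> real n powr (- 2 * c)"
    proof -
      have "?P ?S3 \<le> exp (- 2 * real n)" by (rule gnp_deviation_all[OF p D1])
      also have "\<dots> \<le> exp (- 2 * ln n)" using ln_le_minus_one[of "real n"] nN by simp
      also have "\<dots> = real n powr (- 2)" using nN by (simp add: powr_def)
      also have "\<dots> \<le> real n powr (- 2 * c)" using m2[of 2] c by simp
      finally show ?thesis .
    qed
    have S4: "?P ?S4 \<le> real n powr (- 2 * c)"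
      using gnp_not_sparse[OF p r D nN(2)] m2[of 3] c by simp
    have "?P {E. \<not> good_graph \<eta> n r E} \<le> ?P ((?S1 \<union> ?S2) \<union> (?S3 \<union> ?S4))"
    proof (rule prob_mono_support)
      fix E assume E: "E \<in> set_pmf (gnp n p)" and ng: "E \<in> {E. \<not> good_graph \<eta> n r E}"
      have Ev: "E \<subseteq> vertex_pairs n" using set_gnp E by blast
      show "E \<in> ((?S1 \<union> ?S2) \<union> (?S3 \<union> ?S4))"
      proof (rule ccontr)
        assume nm: "E \<notin> ((?S1 \<union> ?S2) \<union> (?S3 \<union> ?S4))"
        have d: "\<eta> * r ^ 32 \<le> deg E v \<and> deg E v \<le> 10 * r ^ 32" if "v < n" for v
        proof -
          have "E \<notin> ?S1" "E \<notin> ?S2" using nm by blast+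
          hence "\<not> deg E v > 10 * (n * p)" "\<not> deg E v < \<eta> * (n * p)" using that by blast+
          thus ?thesis unfolding D[symmetric] by simp
        qed
        have sp: "sparse_graph n r E" using nm by simp
        have dev: "(\<Sum>v<n. (real (card (nbrs E v \<inter> A)) - r ^ 32 / real n * real (card A))\<^sup>2) \<le> 1002 * real n * r ^ 32"
          if A: "A \<subseteq> {..<n}" for A
        proof -
          have 1: "(\<Sum>v<n. (real (card (nbrs E v \<inter> A)) - p * card (A - {v}))\<^sup>2) \<le> 500 * real n * (n * p)"
          proof (rule ccontr)
            assume "\<not> ?thesis"
            moreover have "\<forall>v<n. deg E v \<le> 10 * (n * p)" using d unfolding D[symmetric] by blast
            ultimately have "E \<in> ?S3" using A not_le by blast
            thus False using nm by blast
          qed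
          have pr: "r ^ 32 / n = p" using D nN by (simp add: field_simps)
          have fA: "finite A" using A finite_subset by blast
          have "(\<Sum>v<n. (real (card (nbrs E v \<inter> A)) - r ^ 32 / real n * real (card A))\<^sup>2) \<le>
            (\<Sum>v<n. 2 * (real (card (nbrs E v \<inter> A)) - p * card (A - {v}))\<^sup>2 + 2)"
          proof (rule sum_mono)
            fix v
            \<comment> \<open>Restoring v to \<open>A\<close> shifts the centre by y \<le> p \<le>
              1, which turns the constant 500 into 2 * 500 + 2 = 1002, since D \<ge> 1.\<close>
            define x y where "x = real (card (nbrs E v \<inter> A)) - p * card (A - {v})" and "y = p * (real (card A) - card (A - {v}))"
            have "real (card A) - card (A - {v}) \<in> {0, 1}"
              using fA card_gt_0_iff[of A] by (cases "v \<in> A") (auto simp: card_Diff_singleton of_nat_diff Suc_le_eq)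
            hence "0 \<le> y" "y \<le> 1" using p by (auto simp: y_def)
            hence "y\<^sup>2 \<le> 1" by (simp add: power_le_one)
            moreover have "(x - y)\<^sup>2 \<le> 2 * x\<^sup>2 + 2 * y\<^sup>2"
              using zero_le_power2[of "x + y"] by (simp add: power2_eq_square algebra_simps)
            moreover have "real (card (nbrs E v \<inter> A)) - r ^ 32 / real n * real (card A) = x - y"
              unfolding pr by (simp add: x_def y_def algebra_simps)
            ultimately show "(real (card (nbrs E v \<inter> A)) - r ^ 32 / real n * real (card A))\<^sup>2 \<le>
               2 * (real (card (nbrs E v \<inter> A)) - p * card (A - {v}))\<^sup>2 + 2"
              by (simp add: x_def[symmetric])
          qed
          also have "\<dots> = 2 * (\<Sum>v<n. (real (card (nbrs E v \<inter> A)) - p * card (A - {v}))\<^sup>2) + 2 * real n"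
            by (simp add: sum.distrib sum_distrib_left)
          also have "\<dots> \<le> 2 * (500 * real n * (n * p)) + 2 * real n * (n * p)"
            using 1 mult_left_mono[OF D1, of "2 * real n"] by (simp add: algebra_simps)
          also have "\<dots> = 1002 * real n * r ^ 32" unfolding D by simp
          finally show ?thesis .
        qed
        have "good_graph \<eta> n r E" unfolding good_graph_def using Ev d dev sp by blast
        thus False using ng by simp
      qed
    qed
    also have "\<dots> \<le> (?P ?S1 + ?P ?S2) + (?P ?S3 + ?P ?S4)"
      by (intro order_trans[OF prob_Un_le] add_mono prob_Un_le)
    also have "\<dots> \<le> 6 * real n powr (- 2 * c)" using S1 S2 S3 S4 by linarith
    also have "\<dots> \<le> real n powr c * real n powr (- 2 * c)" using n6 by (intro mult_right_mono) auto
    also have "\<dots> = real n powr (- c)" by (subst powr_add[symmetric]) simp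
    finally show "?P {E. good_graph \<eta> n r E} \<ge> 1 - real n powr (- c)"
      by (simp add: prob_not)
  qed
qed

section \<open>One round on a good graph\<close>

text \<open>The constants \<open>L\<close> and \<open>Q\<close> are carried as parameters tied to
  \<open>k\<close> alone, so that the final constant can be selected before the density and
  \<epsilon>.\<close>

definition smooth_bound :: "nat \<Rightarrow> real \<Rightarrow> bool" where
  "smooth_bound k L \<longleftrightarrow> L \<ge> 0 \<and> (\<exists>f'. \<forall>x y. 0 \<le> x \<and> x \<le> 1 \<and> 0 \<le> y \<and> y \<le> 1 \<longrightarrow>
     \<bar>vote_fun k y - vote_fun k x - f' x * (y - x)\<bar> \<le> L * (y - x)\<^sup>2 \<and> \<bar>f' y - f' x\<bar> \<le> L * \<bar>y - x\<bar>)"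

lemma smooth_bound_exists: "\<exists>L. smooth_bound k L"
  using vote_fun_smooth[of k] unfolding smooth_bound_def by meson

definition quad_bound :: "nat \<Rightarrow> real \<Rightarrow> bool" where
  "quad_bound k Q \<longleftrightarrow> Q \<ge> 1 \<and> (\<forall>x. 0 \<le> x \<and> x \<le> 1 \<longrightarrow> mean_map k x \<le> Q * x\<^sup>2 \<and>
    \<bar>1 - 2 * mean_map k x\<bar> \<le> Q * \<bar>1 - 2 * x\<bar> \<and> 1 - vote_fun k (1 - x) \<le> Q * x \<and> vote_fun k x \<le> Q * x\<^sup>2)"

lemma quad_bound_exists: "k \<ge> 2 \<Longrightarrow> \<exists>Q. quad_bound k Q"
  using mean_map_bounds[of k] unfolding quad_bound_def by meson

definition mass :: "nat set set \<Rightarrow> nat set \<Rightarrow> real" where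
  "mass E A = (\<Sum>v\<in>A. stat E v)"

lemma bias_mass: "bias E A = 2 * mass E A - 1"
  by (simp add: bias_def mass_def)

text \<open>The drift coefficient of \<open>mean_map_drift\<close> when x (1 - x) \<ge> 1 / (8 Q),
  as for minority fractions between 1 / (4 Q) and 1/2.\<close>

definition growth_rate :: "nat \<Rightarrow> real \<Rightarrow> real" where
  "growth_rate k Q = 1 / (4 * Q) / 2 ^ (k - 1)"

lemma rand_subset_complement:
  assumes "finite I" "\<forall>i\<in>I. 0 \<le> q i \<and> q i \<le> 1"
  shows "rand_subset I (\<lambda>i. 1 - q i) = map_pmf (\<lambda>B. I - B) (rand_subset I q)"
  using assms
proof (induction I)
  case empty
  show ?case by (simp add: rand_subset_def)
next
  case (insert v I)
  have b: "bernoulli_pmf (1 - q v) = map_pmf Not (bernoulli_pmf (q v))"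
  proof (rule pmf_eqI)
    fix b
    have "Not -` {True} = {False}" "Not -` {False} = {True}" by auto
    thus "pmf (bernoulli_pmf (1 - q v)) b = pmf (map_pmf Not (bernoulli_pmf (q v))) b"
      using insert.prems by (cases b) (auto simp: pmf_map measure_pmf_single)
  qed
  have "rand_subset (insert v I) (\<lambda>i. 1 - q i) =
    map_pmf (\<lambda>(b, S). if b then insert v S else S) (pair_pmf (map_pmf Not (bernoulli_pmf (q v))) (map_pmf (\<lambda>B. I - B) (rand_subset I q)))"
    unfolding rand_subset_insert[OF insert.hyps] b using insert.IH insert.prems by simp
  also have "\<dots> = map_pmf (\<lambda>(b, S). if \<not> b then insert v (I - S) else I - S) (pair_pmf (bernoulli_pmf (q v)) (rand_subset I q))"
    by (simp add: pair_map_pmf1 pair_map_pmf2 pmf.map_comp o_def case_prod_unfold apfst_def apsnd_def map_prod_def cong: if_cong)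
  also have "\<dots> = map_pmf (\<lambda>B. insert v I - B) (rand_subset (insert v I) q)"
    unfolding rand_subset_insert[OF insert.hyps] pmf.map_comp
  proof (rule map_pmf_cong[OF refl])
    fix z assume "z \<in> set_pmf (pair_pmf (bernoulli_pmf (q v)) (rand_subset I q))"
    hence "snd z \<in> set_pmf (rand_subset I q)" by auto
    hence "snd z \<subseteq> I" using set_rand_subset[OF insert.hyps(1)] by blast
    thus "(case z of (b, S) \<Rightarrow> if \<not> b then insert v (I - S) else I - S) =
      ((\<lambda>B. insert v I - B) \<circ> (\<lambda>(b, S). if b then insert v S else S)) z"
      using insert.hyps by (cases z) auto
  qed
  finally show ?case .
qed

text \<open>Cauchy-Schwarz for weights of total at most 1, by |y| \<le> b / 2 + y^2 / (2 b).\<close>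

lemma expectation_le_root_second_moment:
  fixes p y :: "'a \<Rightarrow> real"
  assumes "\<And>i. i \<in> I \<Longrightarrow> p i \<ge> 0" "(\<Sum>i\<in>I. p i) \<le> 1" "(\<Sum>i\<in>I. p i * (y i)\<^sup>2) \<le> b\<^sup>2" "b > 0"
  shows "\<bar>\<Sum>i\<in>I. p i * y i\<bar> \<le> b"
proof -
  have "\<bar>\<Sum>i\<in>I. p i * y i\<bar> \<le> (\<Sum>i\<in>I. p i * \<bar>y i\<bar>)"
    using assms(1) sum_abs[of "\<lambda>i. p i * y i" I] by (simp add: abs_mult cong: sum.cong)
  also have "\<dots> \<le> (\<Sum>i\<in>I. p i * (b / 2 + (y i)\<^sup>2 / (2 * b)))"
  proof (intro sum_mono mult_left_mono assms(1))
    fix i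
    have "0 \<le> (b - \<bar>y i\<bar>)\<^sup>2 / (2 * b)" using assms by simp
    also have "\<dots> = b / 2 + (y i)\<^sup>2 / (2 * b) - \<bar>y i\<bar>"
      using assms by (simp add: power2_diff field_simps power2_eq_square)
    finally show "\<bar>y i\<bar> \<le> b / 2 + (y i)\<^sup>2 / (2 * b)" by simp
  qed
  also have "\<dots> = b / 2 * (\<Sum>i\<in>I. p i) + (\<Sum>i\<in>I. p i * (y i)\<^sup>2) / (2 * b)"
    by (simp add: distrib_left sum.distrib sum_distrib_left sum_divide_distrib mult_ac)
  also have "\<dots> \<le> b / 2 * 1 + b\<^sup>2 / (2 * b)"
    using assms by (intro add_mono mult_left_mono divide_right_mono) auto
  also have "\<dots> = b" using assms by (simp add: power2_eq_square)
  finally show ?thesis .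
qed

text \<open>Here \<open>r\<close> is the 32nd root of n p. The inequalities on \<open>r\<close> say
  that the average degree is large compared with the constants; \<open>noise\<close> follows for
  large n from r^32 \<le> n, because then r^13 \<le> n^(13/32) and 13/32 < 1/2. With these made
  explicit, the arguments inside the locale are not asymptotic.\<close>

locale good_voting =
  fixes k n :: nat and L Q r \<eta> :: real and E :: "nat set set"
  assumes k: "k \<ge> 2" and L: "smooth_bound k L" and Q: "quad_bound k Q"
    and eta: "0 < \<eta>" "\<eta> \<le> 1" and good: "good_graph \<eta> n r E"
    and r16: "r \<ge> 16" and rn: "r ^ 32 \<le> real n"
    and r_growth: "320 * (16032 * L + 1) \<le> r * growth_rate k Q"
    and r_end: "22 * Q \<le> r * \<eta>\<^sup>2"
    and noise: "20 * sqrt (ln n / n) * r ^ 13 \<le> 1"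
begin

text \<open>Size of a one-round fluctuation exceeded with probability at most n^(-5): the tail exp
  (- h^2 n / 80) with h^2 = 400 ln n / n.\<close>

definition noise_level :: real where "noise_level = 20 * sqrt (ln n / n)"

definition mean_mass :: "nat set \<Rightarrow> real" where
  "mean_mass A = (\<Sum>v<n. next_prob k E A v * stat E v)"

section \<open>Deterministic consequences of a good graph for the stationary weights\<close>

lemma Ev: "E \<subseteq> vertex_pairs n"
  using good by (simp add: good_graph_def)

lemma deg_bounds: "v < n \<Longrightarrow> \<eta> * r ^ 32 \<le> real (deg E v)" "v < n \<Longrightarrow> real (deg E v) \<le> 10 * r ^ 32"
  using good by (auto simp: good_graph_def)

lemma deviation: "A \<subseteq> {..<n} \<Longrightarrow> (\<Sum>v<n. (real (card (nbrs E v \<inter> A)) - r ^ 32 / real n * real (card A))\<^sup>2) \<le> 1002 * real n * r ^ 32"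
  using good by (simp add: good_graph_def)

lemma sparse: "A \<subseteq> {..<n} \<Longrightarrow> real (card A) * r ^ 4 \<le> real n \<Longrightarrow>
    real (card {v \<in> {..<n}. r ^ 30 < real (card (nbrs E v \<inter> A))}) * r ^ 8 \<le> real (card A)"
  using good by (simp add: good_graph_def sparse_graph_def)

lemma r_pos: "r > 0" "r ^ m > 0" and r_pow_ge: "r ^ m \<ge> 1"
  using r16 by (auto intro: one_le_power)

lemma n_pos: "n > 0" "n \<ge> 16"
proof -
  have "(16::real) ^ 1 \<le> r ^ 1" using r16 by simp
  also have "\<dots> \<le> r ^ 32" using r16 by (intro power_increasing) auto
  finally have "16 \<le> real n" using rn by simp
  thus "n > 0" "n \<ge> 16" by auto
qed

lemma deg_pos: "v < n \<Longrightarrow> deg E v > 0"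
  using deg_bounds(1)[of v] eta r_pos(2)[of 32] by (metis gr0I mult_pos_pos not_le of_nat_0)

lemma nonisolated: "nonisolated n E"
  unfolding nonisolated_def using deg_pos Ev by (metis card.empty deg_def less_irrefl)

lemma Q1: "Q \<ge> 1" using Q by (simp add: quad_bound_def)

lemma L0: "L \<ge> 0" using L by (simp add: smooth_bound_def)

lemma growth_rate_pos: "growth_rate k Q > 0" "growth_rate k Q \<le> 1 / (8 * Q)"
proof -
  show "growth_rate k Q > 0" using Q1 by (simp add: growth_rate_def)
  have "(2::real) ^ 1 \<le> 2 ^ (k - 1)" using k by (intro power_increasing) auto
  thus "growth_rate k Q \<le> 1 / (8 * Q)" using Q1 by (simp add: growth_rate_def field_simps)
qed

lemma deg_as_sum: "deg E v = (\<Sum>u<n. of_bool ({v, u} \<in> E) :: real)"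
proof -
  have "nbrs E v = {..<n} \<inter> {u. {v, u} \<in> E}" using nbrs_subset[OF Ev, of v] by (auto simp: nbrs_def)
  thus ?thesis by (simp add: deg_def sum_of_bool_eq)
qed

lemma nbrs_Int_as_sum: "finite A \<Longrightarrow> real (card (nbrs E v \<inter> A)) = (\<Sum>u\<in>A. of_bool ({v, u} \<in> E))"
  by (simp add: sum_of_bool_eq nbrs_def Int_def conj_commute)

lemma sum_nbrs_eq_sum_deg:
  assumes "A \<subseteq> {..<n}"
  shows "(\<Sum>v<n. real (card (nbrs E v \<inter> A))) = (\<Sum>u\<in>A. real (deg E u))"
proof -
  have "finite A" using assms finite_subset by blast
  hence "(\<Sum>v<n. real (card (nbrs E v \<inter> A))) = (\<Sum>v<n. \<Sum>u\<in>A. of_bool ({v, u} \<in> E))"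
    by (simp add: nbrs_Int_as_sum)
  also have "\<dots> = (\<Sum>u\<in>A. \<Sum>v<n. of_bool ({v, u} \<in> E))" by (rule sum.swap)
  finally show ?thesis by (simp add: deg_as_sum insert_commute)
qed

lemma handshake: "(\<Sum>v<n. real (deg E v)) = 2 * real (card E)"
proof -
  have fE: "finite E" using Ev finite_vertex_pairs finite_subset by blast
  have "(\<Sum>v<n. 1 * real (card (nbrs E v \<inter> UNIV))) = (\<Sum>e\<in>E. \<Sum>v<n. 1 * of_bool (v \<in> e \<and> e - {v} \<subseteq> UNIV))"
    by (rule sum_nbrs_Int[OF Ev])
  also have "\<dots> = (\<Sum>e\<in>E. 2)"
  proof (rule sum.cong[OF refl])
    fix e assume "e \<in> E"
    hence e: "e \<subseteq> {..<n}" "card e = 2" using Ev by (auto simp: vertex_pairs_def)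
    have "{..<n} \<inter> {v. v \<in> e} = e" using e by auto
    thus "(\<Sum>v<n. 1 * of_bool (v \<in> e \<and> e - {v} \<subseteq> UNIV)) = (2::real)" using e by (simp add: sum_of_bool_eq)
  qed
  finally show ?thesis by (simp add: deg_def)
qed

text \<open>From d \<ge> D - D / 4 - (d - D)^2 / D: the squared deviations sum to at most 1002 n D,
  and 1002 \<le> D / 4. The minimum degree would give a bound containing \<eta>, which must not
  enter the later constants.\<close>

lemma edges_lower: "real n * r ^ 32 / 2 \<le> 2 * real (card E)"
proof -
  let ?D = "r ^ 32"
  have D: "?D > 0" by (rule r_pos)
  have "(16::real) ^ 4 \<le> r ^ 4" using r16 by (intro power_mono) auto
  also have "\<dots> \<le> ?D" using r16 by (intro power_increasing) auto
  finally have D1: "?D \<ge> 4008" by simp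
  have nb: "nbrs E v \<inter> {..<n} = nbrs E v" for v using nbrs_subset[OF Ev] by auto
  have dev: "(\<Sum>v<n. (real (deg E v) - ?D)\<^sup>2) \<le> 1002 * real n * ?D"
    using deviation[of "{..<n}"] n_pos by (simp add: nb deg_def)
  have "(\<Sum>v<n. ?D - ?D / 4 - (real (deg E v) - ?D)\<^sup>2 / ?D) \<le> (\<Sum>v<n. real (deg E v))"
  proof (rule sum_mono)
    fix v
    define z where "z = real (deg E v) - ?D"
    have "0 \<le> (z + ?D / 2)\<^sup>2 / ?D" using D by simp
    also have "\<dots> = z\<^sup>2 / ?D + z + ?D / 4" using D by (simp add: power2_eq_square field_simps)
    finally show "?D - ?D / 4 - (real (deg E v) - ?D)\<^sup>2 / ?D \<le> real (deg E v)" by (simp add: z_def)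
  qed
  moreover have "(\<Sum>v<n. ?D - ?D / 4 - (real (deg E v) - ?D)\<^sup>2 / ?D) = real n * (3 / 4 * ?D) - (\<Sum>v<n. (real (deg E v) - ?D)\<^sup>2) / ?D"
    by (simp add: sum_subtractf sum_divide_distrib)
  moreover have "(\<Sum>v<n. (real (deg E v) - ?D)\<^sup>2) / ?D \<le> 1002 * real n"
    using dev D by (simp add: divide_le_eq)
  moreover have "4008 * real n \<le> ?D * real n" using D1 by (intro mult_right_mono) auto
  ultimately show ?thesis unfolding handshake by (simp add: mult.commute)
qed

lemma edges_pos: "2 * real (card E) > 0"
  using edges_lower n_pos r_pos(2)[of 32] by (smt (verit) divide_pos_pos mult_pos_pos of_nat_0_less_iff)

lemma stat_nonneg: "stat E v \<ge> 0"
  by (simp add: stat_def)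

lemma stat_bounds:
  assumes "v < n"
  shows "\<eta> / (10 * n) \<le> stat E v" "stat E v \<le> 20 / n"
proof -
  let ?D = "r ^ 32"
  have "2 * real (card E) \<le> (\<Sum>v<n. 10 * ?D)" unfolding handshake[symmetric] by (intro sum_mono deg_bounds) auto
  hence up: "2 * real (card E) \<le> real n * (10 * ?D)" by simp
  have "\<eta> / (10 * n) = \<eta> * ?D / (real n * (10 * ?D))" using r_pos by simp
  also have "\<dots> \<le> stat E v" unfolding stat_def
    using deg_bounds[OF assms] up edges_pos eta r_pos by (intro frac_le) auto
  finally show "\<eta> / (10 * n) \<le> stat E v" .
  have "stat E v \<le> 10 * ?D / (real n * ?D / 2)" unfolding stat_def
    using deg_bounds[OF assms] edges_lower n_pos r_pos(2)[of 32] by (intro frac_le) auto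
  thus "stat E v \<le> 20 / n" using r_pos by simp
qed

lemma sum_stat: "(\<Sum>v<n. stat E v) = 1"
  using handshake edges_pos by (simp add: stat_def sum_divide_distrib[symmetric])

lemma mass_range:
  assumes "A \<subseteq> {..<n}" shows "0 \<le> mass E A" "mass E A \<le> 1"
proof -
  show "0 \<le> mass E A" unfolding mass_def by (intro sum_nonneg stat_nonneg)
  have "mass E A \<le> (\<Sum>v<n. stat E v)"
    unfolding mass_def by (rule sum_mono2) (use assms stat_nonneg in auto)
  thus "mass E A \<le> 1" by (simp add: sum_stat)
qed

lemma mass_complement: "A \<subseteq> {..<n} \<Longrightarrow> mass E ({..<n} - A) = 1 - mass E A"
  using sum_stat unfolding mass_def by (simp add: sum_diff)

lemma card_le_mass:
  assumes "A \<subseteq> {..<n}"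
  shows "\<eta> * card A \<le> 10 * real n * mass E A"
proof -
  have "(\<Sum>v\<in>A. \<eta> / (10 * n)) \<le> mass E A"
    unfolding mass_def by (intro sum_mono stat_bounds) (use assms in auto)
  thus ?thesis using n_pos by (simp add: field_simps)
qed

lemma sum_stat_squares: "(\<Sum>v<n. (stat E v)\<^sup>2) \<le> 20 / n"
proof -
  have "(\<Sum>v<n. (stat E v)\<^sup>2) \<le> (\<Sum>v<n. 20 / n * stat E v)"
    unfolding power2_eq_square by (intro sum_mono mult_right_mono stat_bounds stat_nonneg) auto
  also have "\<dots> = 20 / n" unfolding sum_distrib_left[symmetric] sum_stat by simp
  finally show ?thesis .
qed

lemma stat_nfrac: "v < n \<Longrightarrow> stat E v * nfrac E A v = real (card (nbrs E v \<inter> A)) / (2 * real (card E))"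
  using deg_pos by (simp add: stat_def nfrac_def)

lemma mean_nfrac:
  assumes "A \<subseteq> {..<n}"
  shows "(\<Sum>v<n. stat E v * nfrac E A v) = mass E A"
proof -
  have "(\<Sum>v<n. stat E v * nfrac E A v) = (\<Sum>v<n. real (card (nbrs E v \<inter> A))) / (2 * real (card E))"
    by (simp add: stat_nfrac sum_divide_distrib)
  also have "\<dots> = mass E A"
    unfolding sum_nbrs_eq_sum_deg[OF assms] mass_def stat_def by (simp add: sum_divide_distrib)
  finally show ?thesis .
qed

text \<open>The centre \<open>mass E A\<close> may be replaced by \<open>card A / n\<close>, for which the deviation bound of the
  graph applies; vertices of degree below half the average are so atypical that they are
  absorbed by the degree deviation.\<close>

lemma nfrac_variance:
  assumes A: "A \<subseteq> {..<n}"
  shows "(\<Sum>v<n. stat E v * (nfrac E A v - mass E A)\<^sup>2) \<le> 16032 / r ^ 32"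
proof -
  let ?D = "r ^ 32" and ?y = "nfrac E A"
  define a where "a = real (card A) / n"
  have D: "?D > 0" by (rule r_pos)
  have "card A \<le> n" using card_mono[OF _ A] by simp
  hence a: "0 \<le> a" "a \<le> 1" using n_pos by (auto simp: a_def)
  let ?x = "mass E A"
  have "(\<Sum>v<n. stat E v * (?y v - a)\<^sup>2) = (\<Sum>v<n. stat E v * (?y v - ?x)\<^sup>2 + (2 * (?x - a) * (stat E v * ?y v) - (2 * (?x - a) * ?x) * stat E v) + (?x - a)\<^sup>2 * stat E v)"
    by (intro sum.cong refl) (simp add: power2_eq_square algebra_simps)
  also have "\<dots> = (\<Sum>v<n. stat E v * (?y v - ?x)\<^sup>2) + (2 * (?x - a) * ?x - (2 * (?x - a) * ?x) * 1) + (?x - a)\<^sup>2 * 1"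
    unfolding sum.distrib sum_subtractf sum_distrib_left[symmetric] mean_nfrac[OF A] sum_stat ..
  finally have "(\<Sum>v<n. stat E v * (?y v - ?x)\<^sup>2) \<le> (\<Sum>v<n. stat E v * (?y v - a)\<^sup>2)" by simp
  also have "\<dots> \<le> (\<Sum>v<n. 8 / (n * ?D\<^sup>2) * ((real (card (nbrs E v \<inter> A)) - ?D / real n * real (card A))\<^sup>2 + (real (deg E v) - ?D)\<^sup>2))"
  proof (rule sum_mono)
    fix v assume "v \<in> {..<n}"
    hence v: "v < n" by simp
    let ?d = "real (deg E v)" and ?dA = "real (card (nbrs E v \<inter> A))"
    have aD: "?D / real n * real (card A) = a * ?D" by (simp add: a_def)
    have y: "0 \<le> ?y v" "?y v \<le> 1" using nfrac_range(1) nfrac_range(2)[OF Ev] by blast+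
    have nD: "real n * ?D\<^sup>2 > 0" using n_pos D by simp
    show "stat E v * (?y v - a)\<^sup>2 \<le> 8 / (n * ?D\<^sup>2) * ((?dA - ?D / real n * real (card A))\<^sup>2 + (?d - ?D)\<^sup>2)"
    proof (cases "?d \<ge> ?D / 2")
      case True
      have "?y v - a = (?dA - a * ?d) / ?d" using deg_pos[OF v] by (simp add: nfrac_def field_simps)
      \<comment> \<open>The weight is proportional to the degree, so only one inverse degree is
        left. It is at most 2 / D here, without any use of \<eta>.\<close>
      hence "stat E v * (?y v - a)\<^sup>2 = (?dA - a * ?d)\<^sup>2 / (2 * real (card E) * ?d)"
        using deg_pos[OF v] by (simp add: stat_def power_divide power2_eq_square)
      also have "\<dots> \<le> (?dA - a * ?d)\<^sup>2 / (real n * ?D / 2 * (?D / 2))"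
        using True edges_lower n_pos D edges_pos deg_pos[OF v] by (intro divide_left_mono mult_mono mult_pos_pos) auto
      also have "\<dots> = 4 / (n * ?D\<^sup>2) * (?dA - a * ?d)\<^sup>2"
      proof -
        have "X / (real n * d / 2 * (d / 2)) = 4 / (n * d\<^sup>2) * X" for X d :: real by (simp add: power2_eq_square mult_ac)
        thus ?thesis .
      qed
      also have "(?dA - a * ?d)\<^sup>2 \<le> 2 * ((?dA - a * ?D)\<^sup>2 + (?d - ?D)\<^sup>2)"
      proof -
        have "(?dA - a * ?d)\<^sup>2 = ((?dA - a * ?D) - a * (?d - ?D))\<^sup>2" by (simp add: algebra_simps)
        also have "\<dots> \<le> 2 * (?dA - a * ?D)\<^sup>2 + 2 * (a * (?d - ?D))\<^sup>2"
          using zero_le_power2[of "(?dA - a * ?D) + a * (?d - ?D)"] by (simp add: power2_eq_square algebra_simps)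
        also have "(a * (?d - ?D))\<^sup>2 \<le> (?d - ?D)\<^sup>2"
          unfolding power_mult_distrib using a by (intro mult_left_le_one_le) (auto simp: power_le_one)
        finally show ?thesis by simp
      qed
      hence "4 / (n * ?D\<^sup>2) * (?dA - a * ?d)\<^sup>2 \<le> 4 / (n * ?D\<^sup>2) * (2 * ((?dA - a * ?D)\<^sup>2 + (?d - ?D)\<^sup>2))"
        by (rule mult_left_mono) (use nD in simp)
      finally show ?thesis unfolding aD by simp
    next
      case False
      have "(?y v - a)\<^sup>2 \<le> 1" using y a by (simp add: abs_square_le_1 abs_le_iff)
      hence "stat E v * (?y v - a)\<^sup>2 \<le> stat E v * 1" by (intro mult_left_mono stat_nonneg) auto
      also have "\<dots> \<le> (?D / 2) / (real n * ?D / 2)" unfolding stat_def mult_1_right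
        using False edges_lower n_pos D by (intro frac_le) auto
      also have "\<dots> = 4 / (n * ?D\<^sup>2) * (?D / 2)\<^sup>2" using D n_pos by (simp add: power2_eq_square)
      also have "\<dots> \<le> 4 / (n * ?D\<^sup>2) * (?D - ?d)\<^sup>2"
        using False D nD by (intro mult_left_mono power_mono) auto
      also have "\<dots> \<le> 8 / (n * ?D\<^sup>2) * ((?dA - ?D / real n * real (card A))\<^sup>2 + (?d - ?D)\<^sup>2)"
        using nD by (intro mult_mono divide_right_mono) (auto simp: power2_commute[of ?D])
      finally show ?thesis .
    qed
  qed
  also have "\<dots> = 8 / (n * ?D\<^sup>2) * ((\<Sum>v<n. (real (card (nbrs E v \<inter> A)) - ?D / real n * real (card A))\<^sup>2) + (\<Sum>v<n. (real (deg E v) - ?D)\<^sup>2))"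
    by (simp only: sum_distrib_left[symmetric] sum.distrib)
  also have "\<dots> \<le> 8 / (n * ?D\<^sup>2) * (1002 * real n * ?D + 1002 * real n * ?D)"
  proof -
    have nb: "nbrs E v \<inter> {..<n} = nbrs E v" for v using nbrs_subset[OF Ev] by auto
    have "(\<Sum>v<n. (real (deg E v) - ?D)\<^sup>2) \<le> 1002 * real n * ?D"
      using deviation[of "{..<n}"] n_pos by (simp add: nb deg_def)
    thus ?thesis using deviation[OF A] n_pos D by (intro mult_left_mono add_mono) auto
  qed
  \<comment> \<open>16032 = 8 * (1002 + 1002): one deviation bound for \<open>A\<close> and one for
    the degrees.\<close>
  also have "\<dots> = 16032 / ?D" using n_pos D by (simp add: field_simps power_add[symmetric])
  finally show ?thesis .
qed

lemma next_prob_01: "\<forall>v\<in>{..<n}. 0 \<le> next_prob k E A v \<and> next_prob k E A v \<le> 1"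
  using next_prob_range[OF Ev] by blast

text \<open>To first order the error is \<open>a (f' (1 - x) - f' x)\<close>, where \<open>a\<close> is the excess of edges inside
  \<open>A\<close>; the same \<open>a\<close> occurs on both sides of the cut because \<open>nfrac\<close> has mean \<open>mass E A\<close>. Hence this
  term carries the additional factor \<open>\<bar>1 - 2 x\<bar>\<close>.\<close>

lemma mean_mass_approx:
  assumes A: "A \<subseteq> {..<n}"
  shows "\<bar>mean_mass A - mean_map k (mass E A)\<bar> \<le> 16032 * L / r ^ 32 + 16032 * L * \<bar>1 - 2 * mass E A\<bar> / r ^ 16"
proof -
  let ?x = "mass E A" and ?y = "nfrac E A" and ?p = "stat E" and ?f = "vote_fun k"
  obtain f' where f': "\<And>x y. 0 \<le> x \<Longrightarrow> x \<le> 1 \<Longrightarrow> 0 \<le> y \<Longrightarrow> y \<le> 1 \<Longrightarrow>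
     \<bar>?f y - ?f x - f' x * (y - x)\<bar> \<le> L * (y - x)\<^sup>2 \<and> \<bar>f' y - f' x\<bar> \<le> L * \<bar>y - x\<bar>"
    using L unfolding smooth_bound_def by meson
  have x: "0 \<le> ?x" "?x \<le> 1" using mass_range[OF A] .
  have y: "0 \<le> ?y v" "?y v \<le> 1" for v using nfrac_range(1) nfrac_range(2)[OF Ev] by blast+
  define g where "g = (\<lambda>v. if v \<in> A then 1 - ?f (1 - ?x) else ?f ?x)"
  define d where "d = (\<lambda>v. if v \<in> A then f' (1 - ?x) else f' ?x)"
  define a where "a = (\<Sum>v\<in>A. ?p v * (?y v - ?x))"
  have split: "(\<Sum>v<n. h v) = (\<Sum>v\<in>A. h v) + (\<Sum>v\<in>{..<n} - A. h v)" for h :: "nat \<Rightarrow> real"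
    using A by (simp add: sum.subset_diff add.commute)
  have mm: "(\<Sum>v<n. ?p v * g v) = mean_map k ?x"
  proof -
    have "(\<Sum>v<n. ?p v * g v) = mass E A * (1 - ?f (1 - ?x)) + mass E ({..<n} - A) * ?f ?x"
    proof -
      have m: "(\<Sum>v\<in>S. ?p v * c) = mass E S * c" for S c by (simp add: mass_def sum_distrib_right)
      show ?thesis unfolding split[of "\<lambda>v. ?p v * g v"] m[symmetric]
        by (intro arg_cong2[of _ _ _ _ "(+)"] sum.cong) (auto simp: g_def)
    qed
    thus ?thesis by (simp add: mean_map_def mass_complement[OF A])
  qed
  have "(\<Sum>v<n. ?p v * (?y v - ?x)) = 0"
    using mean_nfrac[OF A] sum_stat by (simp add: right_diff_distrib sum_subtractf sum_distrib_right[symmetric])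
  hence a2: "(\<Sum>v\<in>{..<n} - A. ?p v * (?y v - ?x)) = - a" unfolding a_def split[of "\<lambda>v. ?p v * (?y v - ?x)"] by simp
  have lin: "(\<Sum>v<n. ?p v * (d v * (?y v - ?x))) = a * (f' (1 - ?x) - f' ?x)"
  proof -
    have "(\<Sum>v\<in>A. ?p v * (d v * (?y v - ?x))) = f' (1 - ?x) * a"
      unfolding a_def sum_distrib_left by (intro sum.cong) (auto simp: d_def)
    moreover have "(\<Sum>v\<in>{..<n} - A. ?p v * (d v * (?y v - ?x))) = f' ?x * (- a)"
      unfolding a2[symmetric] sum_distrib_left by (intro sum.cong) (auto simp: d_def)
    ultimately show ?thesis unfolding split[of "\<lambda>v. ?p v * (d v * (?y v - ?x))"] by (simp add: algebra_simps)
  qed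
  have V: "(\<Sum>v<n. ?p v * (?y v - ?x)\<^sup>2) \<le> 16032 / r ^ 32" by (rule nfrac_variance[OF A])
  have "\<bar>\<Sum>v<n. ?p v * (next_prob k E A v - g v - d v * (?y v - ?x))\<bar> \<le> (\<Sum>v<n. L * (?p v * (?y v - ?x)\<^sup>2))"
  proof (rule order_trans[OF sum_abs], rule sum_mono)
    fix v
    have "\<bar>next_prob k E A v - g v - d v * (?y v - ?x)\<bar> \<le> L * (?y v - ?x)\<^sup>2"
    proof (cases "v \<in> A")
      case True
      have "\<bar>?f (1 - ?y v) - ?f (1 - ?x) - f' (1 - ?x) * ((1 - ?y v) - (1 - ?x))\<bar> \<le> L * ((1 - ?y v) - (1 - ?x))\<^sup>2"
        using f'[of "1 - ?x" "1 - ?y v"] x y[of v] by simp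
      moreover have "next_prob k E A v - g v - d v * (?y v - ?x) = - (?f (1 - ?y v) - ?f (1 - ?x) - f' (1 - ?x) * ((1 - ?y v) - (1 - ?x)))"
        using True by (simp add: next_prob_def g_def d_def algebra_simps)
      ultimately show ?thesis by (simp add: power2_commute)
    next
      case False
      thus ?thesis using f'[of ?x "?y v"] x y[of v] by (simp add: next_prob_def g_def d_def)
    qed
    hence "?p v * \<bar>next_prob k E A v - g v - d v * (?y v - ?x)\<bar> \<le> ?p v * (L * (?y v - ?x)\<^sup>2)"
      by (rule mult_left_mono[OF _ stat_nonneg])
    thus "\<bar>?p v * (next_prob k E A v - g v - d v * (?y v - ?x))\<bar> \<le> L * (?p v * (?y v - ?x)\<^sup>2)"
      using stat_nonneg[of v] by (simp add: abs_mult mult.left_commute)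
  qed
  also have "\<dots> \<le> L * (16032 / r ^ 32)"
    unfolding sum_distrib_left[symmetric] by (intro mult_left_mono V L0)
  also have "(\<Sum>v<n. ?p v * (next_prob k E A v - g v - d v * (?y v - ?x))) = mean_mass A - mean_map k ?x - a * (f' (1 - ?x) - f' ?x)"
  proof -
    have "(\<Sum>v<n. ?p v * (F v - G v - H v)) = (\<Sum>v<n. ?p v * F v) - (\<Sum>v<n. ?p v * G v) - (\<Sum>v<n. ?p v * H v)" for F G H
      by (simp add: right_diff_distrib sum_subtractf)
    from this[of "next_prob k E A" g "\<lambda>v. d v * (?y v - ?x)"] show ?thesis
      unfolding mm lin by (simp only: mean_mass_def mult.commute)
  qed
  finally have 1: "\<bar>mean_mass A - mean_map k ?x - a * (f' (1 - ?x) - f' ?x)\<bar> \<le> 16032 * L / r ^ 32" by (simp add: mult.commute)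
  \<comment> \<open>127^2 = 16129 exceeds 16032.\<close>
  have "\<bar>a\<bar> \<le> 127 / r ^ 16"
    unfolding a_def
  proof (rule expectation_le_root_second_moment)
    show "(\<Sum>v\<in>A. ?p v) \<le> 1" using x(2) by (simp add: mass_def)
    have "(\<Sum>v\<in>A. ?p v * (?y v - ?x)\<^sup>2) \<le> (\<Sum>v<n. ?p v * (?y v - ?x)\<^sup>2)"
      by (rule sum_mono2) (use A stat_nonneg in auto)
    also have "\<dots> \<le> 16032 / r ^ 32" by (rule V)
    also have "\<dots> \<le> (127 / r ^ 16)\<^sup>2" using r_pos by (simp add: power_divide divide_right_mono)
    finally show "(\<Sum>v\<in>A. ?p v * (?y v - ?x)\<^sup>2) \<le> (127 / r ^ 16)\<^sup>2" .
  qed (use stat_nonneg r_pos in auto)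
  moreover have "\<bar>f' (1 - ?x) - f' ?x\<bar> \<le> L * \<bar>1 - 2 * ?x\<bar>"
    using f'[of ?x "1 - ?x"] x by simp
  ultimately have "\<bar>a * (f' (1 - ?x) - f' ?x)\<bar> \<le> 127 / r ^ 16 * (L * \<bar>1 - 2 * ?x\<bar>)"
    unfolding abs_mult using r_pos by (intro mult_mono) auto
  also have "\<dots> \<le> 16032 / r ^ 16 * (L * \<bar>1 - 2 * ?x\<bar>)"
    using r_pos L0 by (intro mult_right_mono divide_right_mono) auto
  finally have "\<bar>a * (f' (1 - ?x) - f' ?x)\<bar> \<le> 16032 * L * \<bar>1 - 2 * ?x\<bar> / r ^ 16" by simp
  thus ?thesis using 1 by linarith
qed

section \<open>Concentration of the mass after one round, and symmetry of the opinions\<close>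

lemma kern_mass_tail:
  assumes h: "0 \<le> h" "h \<le> 1"
  shows "measure_pmf.prob (kern k n E A) {B. mass E B \<ge> mean_mass A + h} \<le> exp (- (h\<^sup>2 * n / 80))"
    and "measure_pmf.prob (kern k n E A) {B. mass E B \<le> mean_mass A - h} \<le> exp (- (h\<^sup>2 * n / 80))"
proof -
  \<comment> \<open>The minimiser of 20 l^2 / n - l h.\<close>
  define l where "l = h * n / 40"
  have lw: "\<forall>i\<in>{..<n}. \<bar>c * l * stat E i\<bar> \<le> 1" if "\<bar>c\<bar> = 1" for c
  proof
    fix i assume "i \<in> {..<n}"
    hence "l * stat E i \<le> l * (20 / n)" using h by (intro mult_left_mono stat_bounds) (auto simp: l_def)
    also have "\<dots> \<le> 1" using h n_pos by (simp add: l_def)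
    finally show "\<bar>c * l * stat E i\<bar> \<le> 1" using that h stat_nonneg[of i] by (simp add: abs_mult l_def)
  qed
  have ex: "exp (l\<^sup>2 * (\<Sum>i<n. (stat E i)\<^sup>2) - l * h) \<le> exp (- (h\<^sup>2 * n / 80))"
  proof -
    have "l\<^sup>2 * (\<Sum>i<n. (stat E i)\<^sup>2) \<le> l\<^sup>2 * (20 / n)" by (intro mult_left_mono sum_stat_squares) auto
    also have "\<dots> = h\<^sup>2 * n / 80" using n_pos by (simp add: l_def power2_eq_square)
    finally have "l\<^sup>2 * (\<Sum>i<n. (stat E i)\<^sup>2) \<le> h\<^sup>2 * n / 80" .
    moreover have "l * h = h\<^sup>2 * n / 40" by (simp add: l_def power2_eq_square)
    ultimately show ?thesis by simp
  qed
  have l0: "l \<ge> 0" using h by (simp add: l_def)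
  have "measure_pmf.prob (kern k n E A) {B. mass E B \<ge> mean_mass A + h} \<le> exp (l\<^sup>2 * (\<Sum>i<n. (stat E i)\<^sup>2) - l * h)"
    unfolding kern_def
  proof (rule rand_subset_upper_tail[OF _ next_prob_01])
    fix B assume "B \<in> {B. mass E B \<ge> mean_mass A + h}"
    hence "l * (mean_mass A + h) \<le> l * mass E B" using l0 by (intro mult_left_mono) auto
    thus "l * (\<Sum>i\<in>B. stat E i) \<ge> l * (\<Sum>i<n. next_prob k E A i * stat E i) + l * h"
      by (simp add: mass_def mean_mass_def distrib_left)
  qed (use lw[of 1] in auto)
  thus "measure_pmf.prob (kern k n E A) {B. mass E B \<ge> mean_mass A + h} \<le> exp (- (h\<^sup>2 * n / 80))"
    using ex by linarith
  have "measure_pmf.prob (kern k n E A) {B. mass E B \<le> mean_mass A - h} \<le> exp ((- l)\<^sup>2 * (\<Sum>i<n. (stat E i)\<^sup>2) - l * h)"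
    unfolding kern_def
  proof (rule rand_subset_upper_tail[OF _ next_prob_01])
    fix B assume "B \<in> {B. mass E B \<le> mean_mass A - h}"
    hence "l * mass E B \<le> l * (mean_mass A - h)" using l0 by (intro mult_left_mono) auto
    thus "- l * (\<Sum>i\<in>B. stat E i) \<ge> - l * (\<Sum>i<n. next_prob k E A i * stat E i) + l * h"
      by (simp add: mass_def mean_mass_def algebra_simps)
  qed (use lw[of "- 1"] in auto)
  thus "measure_pmf.prob (kern k n E A) {B. mass E B \<le> mean_mass A - h} \<le> exp (- (h\<^sup>2 * n / 80))"
    using ex unfolding power2_minus by linarith
qed

lemma noise_bounds: "0 \<le> noise_level" "noise_level * r ^ 13 \<le> 1" "noise_level \<le> 1" "exp (- (noise_level\<^sup>2 * n / 80)) = real n powr (- 5)"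
proof -
  have ln0: "ln n \<ge> 0" using n_pos by simp
  show 0: "0 \<le> noise_level" using ln0 by (simp add: noise_level_def)
  show 1: "noise_level * r ^ 13 \<le> 1" using noise by (simp add: noise_level_def)
  have "noise_level * 1 \<le> noise_level * r ^ 13" by (intro mult_left_mono 0 r_pow_ge)
  thus "noise_level \<le> 1" using 1 by simp
  have "noise_level\<^sup>2 = 400 * (ln n / n)" using ln0 by (simp add: noise_level_def power_mult_distrib)
  hence "noise_level\<^sup>2 * n / 80 = 5 * ln n" using n_pos by simp
  thus "exp (- (noise_level\<^sup>2 * n / 80)) = real n powr (- 5)" using n_pos by (simp add: powr_def)
qed

lemma kern_mass_upper:
  "measure_pmf.prob (kern k n E A) {B. mass E B < mean_mass A + noise_level} \<ge> 1 - real n powr (- 5)"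
proof -
  have "{B. mass E B < mean_mass A + noise_level} = {B. \<not> (mass E B \<ge> mean_mass A + noise_level)}" by auto
  thus ?thesis using kern_mass_tail(1)[OF noise_bounds(1,3), of A] noise_bounds(4) by (simp only: prob_not)
qed

lemma kern_mass_lower:
  "measure_pmf.prob (kern k n E A) {B. mass E B > mean_mass A - noise_level} \<ge> 1 - real n powr (- 5)"
proof -
  have "{B. mass E B > mean_mass A - noise_level} = {B. \<not> (mass E B \<le> mean_mass A - noise_level)}" by auto
  thus ?thesis using kern_mass_tail(2)[OF noise_bounds(1,3), of A] noise_bounds(4) by (simp only: prob_not)
qed

lemma prob_kern_ge:
  assumes "measure_pmf.prob (kern k n E A) S \<ge> 1 - b" "\<And>B. B \<subseteq> {..<n} \<Longrightarrow> B \<in> S \<Longrightarrow> B \<in> T"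
  shows "measure_pmf.prob (kern k n E A) T \<ge> 1 - b"
proof -
  have "measure_pmf.prob (kern k n E A) S \<le> measure_pmf.prob (kern k n E A) T"
    by (rule prob_mono_support) (use assms(2) set_kern in blast)
  thus ?thesis using assms(1) by linarith
qed

lemma nfrac_complement:
  assumes v: "v < n"
  shows "nfrac E ({..<n} - A) v = 1 - nfrac E A v"
proof -
  have "nbrs E v \<inter> ({..<n} - A) = nbrs E v - nbrs E v \<inter> A" using nbrs_subset[OF Ev] by auto
  hence "card (nbrs E v \<inter> ({..<n} - A)) = deg E v - card (nbrs E v \<inter> A)"
    using finite_nbrs[OF Ev] by (simp add: card_Diff_subset deg_def)
  moreover have "card (nbrs E v \<inter> A) \<le> deg E v" unfolding deg_def by (intro card_mono finite_nbrs[OF Ev]) auto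
  ultimately show ?thesis using deg_pos[OF v] by (simp add: nfrac_def of_nat_diff field_simps)
qed

text \<open>Exchanging the opinions commutes with a round, because a tie keeps either opinion. It
  reduces the analysis to sets of mass at most 1/2.\<close>

lemma cons_prob_complement:
  assumes "A \<subseteq> {..<n}"
  shows "cons_prob k n E t ({..<n} - A) = cons_prob k n E t A"
  using assms
proof (induction t arbitrary: A)
  case 0
  have "({..<n} - A \<in> {{}, {..<n}}) = (A \<in> {{}, {..<n}})" using 0 by auto
  thus ?case by (simp add: cons_prob_def indicator_def)
next
  case (Suc t)
  have "kern k n E ({..<n} - A) = rand_subset {..<n} (\<lambda>v. 1 - next_prob k E A v)"
    unfolding kern_def by (rule rand_subset_cong) (auto simp: next_prob_def nfrac_complement)
  also have "\<dots> = map_pmf (\<lambda>B. {..<n} - B) (kern k n E A)"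
    unfolding kern_def by (rule rand_subset_complement[OF _ next_prob_01]) simp
  finally have K: "kern k n E ({..<n} - A) = map_pmf (\<lambda>B. {..<n} - B) (kern k n E A)" .
  have "measure_pmf.expectation (kern k n E A) (\<lambda>B. cons_prob k n E t ({..<n} - B)) = measure_pmf.expectation (kern k n E A) (cons_prob k n E t)"
    by (rule expectation_cong_pmf) (use set_kern Suc.IH in blast)
  thus ?case unfolding cons_prob_Suc K by simp
qed

end

section \<open>Growth, quadratic decay and extinction of the minority\<close>

text \<open>Chosen so that, at this multiple of 1 / D and of sqrt (ln n / n), the drift exceeds the
  additive error and the noise with room to spare. It contains no \<eta> and hence no
  \<epsilon>.\<close>

definition bias_const :: "nat \<Rightarrow> real \<Rightarrow> real \<Rightarrow> real" where
  "bias_const k L Q = 160 * (16032 * L + 1) / growth_rate k Q"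

lemma ln_4_ge_1: "ln (4::real) \<ge> 1"
proof -
  have "exp 1 \<le> (4::real)" using exp_bound[of 1] by simp
  thus ?thesis by (subst ln_ge_iff) auto
qed

context good_voting
begin

abbreviation "L' \<equiv> 16032 * L"
abbreviation "c1 \<equiv> growth_rate k Q"
text \<open>In the variable u = 2 Q x the quadratic bound reads u -> u^2 / 2; x0 corresponds to u =
  1/2, where the doubly exponential decay takes over.\<close>

abbreviation "x0 \<equiv> 1 / (4 * Q)"

lemma error_small: "m \<ge> 1 \<Longrightarrow> (L' + 1) / r ^ m \<le> c1 / 320"
proof -
  assume m: "m \<ge> 1"
  have "r ^ 1 \<le> r ^ m" using r16 m by (intro power_increasing) auto
  hence "(L' + 1) / r ^ m \<le> (L' + 1) / r" using L0 r_pos by (intro divide_left_mono mult_pos_pos) auto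
  also have "\<dots> \<le> c1 / 320" using r_growth r_pos by (simp add: field_simps)
  finally show ?thesis .
qed

lemma bias_const_ge: "bias_const k L Q \<ge> 160" "bias_const k L Q \<le> r / 2"
proof -
  have "c1 \<le> 1 / (8 * Q)" by (rule growth_rate_pos)
  also have "\<dots> \<le> 1" using Q1 by simp
  finally have c: "c1 \<le> 1" .
  have "160 * c1 \<le> 160 * (L' + 1)" using c L0 by simp
  thus "bias_const k L Q \<ge> 160" using growth_rate_pos by (simp add: bias_const_def field_simps)
  show "bias_const k L Q \<le> r / 2" using r_growth growth_rate_pos by (simp add: bias_const_def field_simps)
qed

lemma noise_le: "noise_level \<le> 1 / r ^ 13"
  using noise_bounds(2) r_pos(2)[of 13] by (simp add: pos_le_divide_eq)

lemma growth_rate_eq: "x0 / 2 / 2 ^ (k - 2) = c1"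
proof -
  have "k - 1 = Suc (k - 2)" using k by simp
  thus ?thesis by (simp add: growth_rate_def)
qed

lemma mean_map_drift': 
  assumes "x0 / 2 \<le> x * (1 - x)" "0 \<le> x" "x \<le> 1 / 2"
  shows "mean_map k x \<le> x - c1 * (1 - 2 * x)"
proof -
  have "x0 / 2 * (1 - 2 * x) / 2 ^ (k - 2) \<le> x * (1 - x) * (1 - 2 * x) / 2 ^ (k - 2)"
    using assms by (intro divide_right_mono mult_right_mono) auto
  moreover have "x0 / 2 * (1 - 2 * x) / 2 ^ (k - 2) = c1 * (1 - 2 * x)"
    unfolding growth_rate_eq[symmetric] by simp
  ultimately show ?thesis using mean_map_drift[OF assms(2,3) k] by linarith
qed

text \<open>The mean-field map multiplies the bias by at least 1 + 2 c1, and the error proportional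
  to the bias, of relative size 1 / r^16, takes at most c1 / 2 of this.\<close>

lemma mean_bias_growth:
  assumes A: "A \<subseteq> {..<n}" and x: "x0 / 2 \<le> mass E A * (1 - mass E A)" "mass E A \<le> 1 / 2"
  shows "1 - 2 * mean_mass A \<ge> (1 + 3 / 2 * c1) * (1 - 2 * mass E A) - 2 * L' / r ^ 32"
proof -
  let ?x = "mass E A"
  have d: "0 \<le> 1 - 2 * ?x" using x by simp
  have m: "mean_mass A \<le> mean_map k ?x + L' / r ^ 32 + L' * (1 - 2 * ?x) / r ^ 16"
    using mean_mass_approx[OF A] d by (simp add: abs_le_iff)
  have F: "mean_map k ?x \<le> ?x - c1 * (1 - 2 * ?x)"
    by (rule mean_map_drift') (use x mass_range[OF A] in auto)
  have "(L' + 1) / r ^ 16 \<le> c1 / 320" by (rule error_small) simp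
  moreover have "L' / r ^ 16 \<le> (L' + 1) / r ^ 16" using r_pos by (intro divide_right_mono) auto
  ultimately have "L' / r ^ 16 \<le> c1 / 4" using growth_rate_pos(1) by linarith
  hence "L' / r ^ 16 * (1 - 2 * ?x) \<le> c1 / 4 * (1 - 2 * ?x)" using d by (rule mult_right_mono)
  hence "L' * (1 - 2 * ?x) / r ^ 16 \<le> c1 * (1 - 2 * ?x) / 4" by simp
  moreover have "(1 + 3 / 2 * c1) * (1 - 2 * ?x) = (1 - 2 * ?x) + 3 / 2 * (c1 * (1 - 2 * ?x))"
    by (simp add: field_simps)
  ultimately show ?thesis using m F by linarith
qed

text \<open>Of the gain 3/2 c1 times the bias, the part 1/2 pays for the additive error and the
  noise: the assumed bias makes these at most 1/160 and 1/8 of the gain c1 times the bias, before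
  the factor 2 in each.\<close>

lemma growth_step:
  assumes A: "A \<subseteq> {..<n}" and x: "x0 \<le> mass E A" "mass E A \<le> 1 / 2"
    and d: "1 - 2 * mass E A \<ge> bias_const k L Q * max (1 / r ^ 32) (sqrt (ln n / n))"
  shows "measure_pmf.prob (kern k n E A) {B. 1 - 2 * mass E B \<ge> (1 + c1) * (1 - 2 * mass E A)} \<ge> 1 - real n powr (- 5)"
proof (rule prob_kern_ge[OF kern_mass_upper])
  fix B assume "B \<in> {B. mass E B < mean_mass A + noise_level}"
  hence B: "mass E B < mean_mass A + noise_level" by simp
  let ?x = "mass E A"
  have "x0 * (1 / 2) \<le> ?x * (1 - ?x)" using x Q1 mass_range[OF A] by (intro mult_mono) auto
  hence g: "1 - 2 * mean_mass A \<ge> (1 + 3 / 2 * c1) * (1 - 2 * ?x) - 2 * L' / r ^ 32"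
    by (intro mean_bias_growth A) (use x in auto)
  have bc: "bias_const k L Q > 0" using bias_const_ge(1) by simp
  have eq: "bias_const k L Q * c1 = 160 * (L' + 1)" using growth_rate_pos(1) by (simp add: bias_const_def)
  have "bias_const k L Q * (1 / r ^ 32) \<le> 1 - 2 * ?x"
    using d bc by (meson max.cobounded1 mult_left_mono less_imp_le order_trans)
  from mult_left_mono[OF this, of c1] have "160 * (L' + 1) / r ^ 32 \<le> c1 * (1 - 2 * ?x)"
    using growth_rate_pos(1) eq by (simp add: mult.commute[of c1])
  moreover have "L' / r ^ 32 \<le> (L' + 1) / r ^ 32" using r_pos by (intro divide_right_mono) auto
  moreover have "160 * (L' + 1) / r ^ 32 = 160 * ((L' + 1) / r ^ 32)" by (simp only: times_divide_eq_right)
  ultimately have 1: "160 * (L' / r ^ 32) \<le> c1 * (1 - 2 * ?x)" by linarith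
  have "bias_const k L Q * sqrt (ln n / n) \<le> 1 - 2 * ?x"
    using d bc by (meson max.cobounded2 mult_left_mono less_imp_le order_trans)
  from mult_left_mono[OF this, of c1] have "160 * (L' + 1) * sqrt (ln n / n) \<le> c1 * (1 - 2 * ?x)"
    using growth_rate_pos(1) eq by (simp add: mult.assoc[symmetric] mult.commute[of c1])
  moreover have "160 * 1 * sqrt (ln n / n) \<le> 160 * (L' + 1) * sqrt (ln n / n)"
    using L0 n_pos by (intro mult_right_mono) auto
  ultimately have 2: "8 * noise_level \<le> c1 * (1 - 2 * ?x)" by (simp add: noise_level_def)
  show "B \<in> {B. 1 - 2 * mass E B \<ge> (1 + c1) * (1 - 2 * ?x)}"
  proof -
    define d e where "d = c1 * (1 - 2 * ?x)" and "e = L' / r ^ 32"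
    have *: "(1 + 3 / 2 * c) * z = z + 3 / 2 * (c * z)" "(1 + c) * z = z + c * z" for c z :: real
      by (simp_all add: distrib_right)
    have e2: "2 * L' / r ^ 32 = 2 * e" by (simp add: e_def)
    have "1 - 2 * mean_mass A \<ge> (1 - 2 * ?x) + 3 / 2 * d - 2 * e"
      using g unfolding *(1) d_def[symmetric] e2 .
    moreover have "160 * e \<le> d" "8 * noise_level \<le> d" using 1 2 by (simp_all add: d_def e_def)
    ultimately have "1 - 2 * mass E B \<ge> (1 - 2 * ?x) + d"
      using B noise_bounds(1) by linarith
    thus ?thesis unfolding mem_Collect_eq *(2) d_def .
  qed
qed

text \<open>All errors are O(r^(-13)), whereas u^2 \<ge> r^(-10). The spare r^3 absorbs the
  constants; this explains the floor r^(-5) for \<open>u\<close>.\<close>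

lemma quadratic_step:
  assumes A: "A \<subseteq> {..<n}" and u: "2 * Q * mass E A \<le> u" "1 / r ^ 5 \<le> u" "u \<le> 1"
  shows "measure_pmf.prob (kern k n E A) {B. 2 * Q * mass E B \<le> u\<^sup>2} \<ge> 1 - real n powr (- 5)"
proof (rule prob_kern_ge[OF kern_mass_upper])
  fix B assume "B \<in> {B. mass E B < mean_mass A + noise_level}"
  hence B: "mass E B < mean_mass A + noise_level" by simp
  let ?x = "mass E A"
  have x: "0 \<le> ?x" "?x \<le> 1" using mass_range[OF A] by auto
  have "L' * \<bar>1 - 2 * ?x\<bar> / r ^ 16 \<le> L' * 1 / r ^ 16"
    using x L0 r_pos by (intro divide_right_mono mult_left_mono) auto
  moreover have "L' / r ^ 32 \<le> L' / r ^ 16"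
    using L0 r16 r_pos by (intro divide_left_mono power_increasing mult_pos_pos) auto
  moreover have "L' / r ^ 16 \<le> L' / r ^ 13"
    using L0 r16 r_pos by (intro divide_left_mono power_increasing mult_pos_pos) auto
  moreover have "mean_map k ?x \<le> Q * ?x\<^sup>2" using Q x by (simp add: quad_bound_def)
  ultimately have "mass E B \<le> Q * ?x\<^sup>2 + (2 * L' + 1) / r ^ 13"
    using B mean_mass_approx[OF A] noise_le by (simp add: abs_le_iff add_divide_distrib)
  hence "2 * Q * mass E B \<le> 2 * Q * (Q * ?x\<^sup>2 + (2 * L' + 1) / r ^ 13)" using Q1 by (intro mult_left_mono) auto
  also have "\<dots> = (2 * Q * ?x)\<^sup>2 / 2 + 2 * Q * ((2 * L' + 1) / r ^ 13)"
    by (simp add: power2_eq_square algebra_simps)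
  also have "(2 * Q * ?x)\<^sup>2 \<le> u\<^sup>2" using u x Q1 by (intro power_mono) auto
  also have "2 * Q * ((2 * L' + 1) / r ^ 13) \<le> (1 / r ^ 5)\<^sup>2 / 2"
  proof -
    have "2 * Q * ((2 * L' + 1) / r ^ 3) \<le> 2 * Q * (2 * ((L' + 1) / r ^ 3))"
      using L0 Q1 r_pos(2)[of 3] by (intro mult_left_mono) (auto simp: divide_right_mono)
    also have "\<dots> \<le> 2 * Q * (2 * (c1 / 320))"
      using Q1 by (intro mult_left_mono error_small) auto
    also have "\<dots> \<le> 2 * Q * (2 * (1 / (8 * Q) / 320))"
      using Q1 growth_rate_pos(2) by (intro mult_left_mono divide_right_mono) auto
    also have "\<dots> \<le> 1 / 2" using Q1 by simp
    finally have "2 * Q * ((2 * L' + 1) / r ^ 3) / r ^ 10 \<le> 1 / 2 / r ^ 10"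
      using r_pos by (intro divide_right_mono) auto
    thus ?thesis by (simp add: power_divide power_add[symmetric] power_mult[symmetric])
  qed
  also have "(1 / r ^ 5)\<^sup>2 \<le> u\<^sup>2" using u r_pos by (intro power_mono) auto
  finally show "B \<in> {B. 2 * Q * mass E B \<le> u\<^sup>2}" by simp
qed

text \<open>Three kinds of vertices enter the next set. Those with more than r^30 neighbours in
  \<open>A\<close> number at most card A / r^8 by sparsity. For all others the fraction y is at most
  1 / (\<eta> r^2): members of \<open>A\<close> stay with probability at most Q y, and outsiders
  join with probability at most Q y^2, where one factor y is bounded and the other summed over the
  edges into \<open>A\<close>. The 22 in \<open>r_end\<close> is 2 (1 + 10), for the last two
  kinds.\<close>

lemma expected_card:
  assumes A: "A \<subseteq> {..<n}" and s: "real (card A) * r ^ 4 \<le> real n"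
  shows "measure_pmf.expectation (kern k n E A) (\<lambda>B. real (card B)) \<le> 1 / r * card A"
proof -
  let ?y = "nfrac E A" and ?dA = "\<lambda>v. real (card (nbrs E v \<inter> A))"
  define H where "H = {v \<in> {..<n}. r ^ 30 < ?dA v}"
  have fA: "finite A" using A finite_subset by blast
  have "measure_pmf.expectation (kern k n E A) (\<lambda>B. real (card B)) = measure_pmf.expectation (kern k n E A) (\<lambda>B. \<Sum>v\<in>B. 1)"
    by simp
  also have "\<dots> = (\<Sum>v<n. next_prob k E A v * 1)"
    unfolding kern_def by (rule expectation_rand_subset_sum[OF _ next_prob_01]) simp
  also have "\<dots> \<le> (\<Sum>v<n. of_bool (v \<in> H) + (of_bool (v \<in> A) * (Q / (\<eta> * r ^ 2)) + Q / (\<eta>\<^sup>2 * r ^ 34) * ?dA v))"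
  proof (rule sum_mono)
    fix v assume "v \<in> {..<n}"
    hence v: "v < n" by simp
    have nn: "0 \<le> Q / (\<eta> * r ^ 2)" "0 \<le> Q / (\<eta>\<^sup>2 * r ^ 34)" using Q1 eta r_pos by auto
    show "next_prob k E A v * 1 \<le> of_bool (v \<in> H) + (of_bool (v \<in> A) * (Q / (\<eta> * r ^ 2)) + Q / (\<eta>\<^sup>2 * r ^ 34) * ?dA v)"
    proof (cases "v \<in> H")
      case True
      have "0 \<le> of_bool (v \<in> A) * (Q / (\<eta> * r ^ 2)) + Q / (\<eta>\<^sup>2 * r ^ 34) * ?dA v" using nn by (intro add_nonneg_nonneg mult_nonneg_nonneg) auto
      thus ?thesis using True next_prob_range[OF Ev, of k A v] by simp
    next
      case False
      hence dA: "?dA v \<le> r ^ 30" using v by (auto simp: H_def)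
      have y0: "0 \<le> ?y v" "?y v \<le> 1" using nfrac_range(1) nfrac_range(2)[OF Ev] by blast+
      have eD: "\<eta> * r ^ 32 > 0" using eta r_pos by simp
      have y1: "?y v \<le> ?dA v / (\<eta> * r ^ 32)"
        unfolding nfrac_def using deg_bounds[OF v] eD deg_pos[OF v] by (intro divide_left_mono) auto
      also have "\<dots> \<le> r ^ 30 / (\<eta> * r ^ 32)" using dA eD by (intro divide_right_mono) auto
      also have "\<dots> = 1 / (\<eta> * r ^ 2)" using r_pos eta by (simp add: field_simps power_add[symmetric])
      finally have y2: "?y v \<le> 1 / (\<eta> * r ^ 2)" .
      show ?thesis
      proof (cases "v \<in> A")
        case True
        have "next_prob k E A v \<le> Q * ?y v" using True Q y0 by (simp add: next_prob_def quad_bound_def)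
        also have "\<dots> \<le> Q * (1 / (\<eta> * r ^ 2))" using Q1 y2 by (intro mult_left_mono) auto
        finally have "next_prob k E A v \<le> Q / (\<eta> * r ^ 2)" by simp
        moreover have "0 \<le> Q / (\<eta>\<^sup>2 * r ^ 34) * ?dA v" using nn by (intro mult_nonneg_nonneg) auto
        ultimately show ?thesis using True by simp
      next
        case False
        have "next_prob k E A v \<le> Q * (?y v)\<^sup>2" using False Q y0 by (simp add: next_prob_def quad_bound_def)
        also have "\<dots> \<le> Q * (?dA v / (\<eta> * r ^ 32) * (1 / (\<eta> * r ^ 2)))"
        proof -
          have "?y v * ?y v \<le> ?dA v / (\<eta> * r ^ 32) * (1 / (\<eta> * r ^ 2))"
            using y0 y1 y2 eD by (intro mult_mono) auto
          thus ?thesis using Q1 by (simp only: power2_eq_square[of "?y v"] mult_left_mono)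
        qed
        also have "\<dots> = Q / (\<eta>\<^sup>2 * r ^ 34) * ?dA v"
        proof -
          have "r ^ 34 = r ^ 32 * r ^ 2" by (simp flip: power_add)
          thus ?thesis by (simp add: power2_eq_square mult_ac)
        qed
        finally show ?thesis using False by simp
      qed
    qed
  qed
  also have "\<dots> = card H + (card A * (Q / (\<eta> * r ^ 2)) + Q / (\<eta>\<^sup>2 * r ^ 34) * (\<Sum>v<n. ?dA v))"
  proof -
    have "{..<n} \<inter> H = H" "{..<n} \<inter> A = A" using A by (auto simp: H_def)
    hence "(\<Sum>v<n. of_bool (v \<in> H)) = real (card H)" "(\<Sum>v<n. of_bool (v \<in> A)) = real (card A)"
      by (simp_all add: sum_of_bool_eq)
    thus ?thesis by (simp only: sum.distrib sum_distrib_left[symmetric] sum_distrib_right[symmetric])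
  qed
  also have "(\<Sum>v<n. ?dA v) \<le> card A * (10 * r ^ 32)"
  proof -
    have "(\<Sum>u\<in>A. real (deg E u)) \<le> (\<Sum>u\<in>A. 10 * r ^ 32)" using A by (intro sum_mono deg_bounds) auto
    thus ?thesis unfolding sum_nbrs_eq_sum_deg[OF A] by simp
  qed
  also have "real (card H) \<le> card A * (1 / r ^ 8)"
    using sparse[OF A s] r_pos unfolding H_def by (simp add: field_simps)
  also have "card A * (1 / r ^ 8) + (card A * (Q / (\<eta> * r ^ 2)) + Q / (\<eta>\<^sup>2 * r ^ 34) * (card A * (10 * r ^ 32)))
     = card A * (1 / r ^ 8 + Q / (\<eta> * r ^ 2) + 10 * Q / (\<eta>\<^sup>2 * r ^ 2))"
    using r_pos eta by (simp add: field_simps power_add[symmetric])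
  also have "\<dots> \<le> card A * (1 / r)"
  proof (rule mult_left_mono)
    have e2: "\<eta>\<^sup>2 \<le> \<eta>" "0 < \<eta>\<^sup>2" using eta by (auto simp: power2_eq_square mult_left_le)
    have q: "Q / (\<eta>\<^sup>2 * r) \<le> 1 / 22" using r_end e2 r_pos(1) by (simp add: field_simps)
    have "1 / r ^ 7 \<le> 1 / 16"
    proof -
      have "r ^ 1 \<le> r ^ 7" using r16 by (intro power_increasing) auto
      thus ?thesis using r16 by (intro divide_left_mono) auto
    qed
    moreover have "Q / (\<eta> * r) \<le> Q / (\<eta>\<^sup>2 * r)"
      using Q1 e2 eta r_pos by (intro divide_left_mono mult_right_mono mult_pos_pos) auto
    ultimately have "1 / r ^ 7 + Q / (\<eta> * r) + 10 * (Q / (\<eta>\<^sup>2 * r)) \<le> 1" using q by linarith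
    hence "1 / r * (1 / r ^ 7 + Q / (\<eta> * r) + 10 * (Q / (\<eta>\<^sup>2 * r))) \<le> 1 / r * 1"
      using r_pos by (intro mult_left_mono) auto
    thus "1 / r ^ 8 + Q / (\<eta> * r ^ 2) + 10 * Q / (\<eta>\<^sup>2 * r ^ 2) \<le> 1 / r"
      by (simp add: distrib_left power2_eq_square power_add[symmetric] mult_ac flip: power_Suc)
  qed simp
  finally show ?thesis using Q1 eta by (simp add: mult.commute divide_right_mono)
qed

text \<open>The mean is at most half of the allowed size n / r^4, and the Chernoff exponent n / (16
  r^8) exceeds 5 ln n because \<open>noise\<close> gives 400 r^26 ln n \<le> n.\<close>

lemma card_tail:
  assumes A: "A \<subseteq> {..<n}" and s: "real (card A) * r ^ 4 \<le> real n"
  shows "measure_pmf.prob (kern k n E A) {B. real (card B) * r ^ 4 \<le> real n} \<ge> 1 - real n powr (- 5)"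
proof -
  define l where "l = 1 / (4 * r ^ 4)"
  define h where "h = real n / (2 * r ^ 4)"
  have l: "0 < l" "l \<le> 1" using r_pos(2)[of 4] r_pow_ge[of 4] by (auto simp: l_def divide_le_eq)
  have mean: "(\<Sum>v<n. next_prob k E A v * 1) \<le> h"
  proof -
    have "(\<Sum>v<n. next_prob k E A v * 1) = measure_pmf.expectation (kern k n E A) (\<lambda>B. \<Sum>v\<in>B. 1)"
      unfolding kern_def by (rule expectation_rand_subset_sum[OF _ next_prob_01, symmetric]) simp
    also have "\<dots> \<le> 1 / r * card A" using expected_card[OF A s] by simp
    also have "\<dots> \<le> 1 / 2 * (n / r ^ 4)"
      using r16 r_pos s by (intro mult_mono) (auto simp: field_simps)
    finally show ?thesis by (simp add: h_def)
  qed
  have "measure_pmf.prob (kern k n E A) {B. \<not> (real (card B) * r ^ 4 \<le> real n)} \<le> exp (l\<^sup>2 * (\<Sum>i<n. 1\<^sup>2) - l * h)"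
    unfolding kern_def
  proof (rule rand_subset_upper_tail[OF _ next_prob_01])
    fix B assume "B \<in> {B. \<not> (real (card B) * r ^ 4 \<le> real n)}"
    hence "2 * h \<le> real (card B)" using r_pos(2)[of 4] by (simp add: h_def field_simps)
    hence "(\<Sum>v<n. next_prob k E A v * 1) + h \<le> real (card B)" using mean by linarith
    hence "l * ((\<Sum>v<n. next_prob k E A v * 1) + h) \<le> l * real (card B)" using l by (intro mult_left_mono) auto
    thus "l * (\<Sum>i\<in>B. 1) \<ge> l * (\<Sum>v<n. next_prob k E A v * 1) + l * h" by (simp add: distrib_left)
  qed (use l in auto)
  also have "l\<^sup>2 * (\<Sum>i<n. 1\<^sup>2) - l * h = - (n / r ^ 8 / 16)"
    using r_pos by (simp add: l_def h_def power2_eq_square field_simps power_add[symmetric])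
  also have "exp (- (n / r ^ 8 / 16)) \<le> exp (- (5 * ln n))"
  proof -
    have "noise_level\<^sup>2 * (r ^ 13)\<^sup>2 \<le> 1"
      using noise_bounds(1,2) r_pos unfolding power_mult_distrib[symmetric] by (intro power_le_one) auto
    moreover have "noise_level\<^sup>2 = 400 * (ln n / n)" using n_pos by (simp add: noise_level_def power_mult_distrib)
    ultimately have "400 * (ln n / n) * r ^ 26 \<le> 1" by (simp add: power_mult[symmetric])
    hence "400 * ln n * r ^ 26 \<le> n" using n_pos by (simp add: field_simps)
    moreover have "400 * ln n * r ^ 8 \<le> 400 * ln n * r ^ 26"
      using n_pos r16 by (intro mult_left_mono power_increasing) auto
    ultimately have "400 * ln n * r ^ 8 \<le> n" by simp
    hence "400 * ln n \<le> n / r ^ 8" using r_pos(2)[of 8] by (simp add: field_simps)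
    moreover have "ln n \<ge> 0" using n_pos by simp
    ultimately show ?thesis by simp
  qed
  also have "\<dots> = real n powr (- 5)" using n_pos by (simp add: powr_def)
  finally show ?thesis by (simp add: prob_not)
qed

lemma endgame:
  assumes A: "A \<subseteq> {..<n}" "real (card A) * r ^ 4 \<le> real n" and t: "t * ln r \<ge> 2 * ln n"
  shows "cons_prob k n E t A \<ge> 1 - (t * real n powr (- 5) + real n powr (- 1))"
proof -
  have "cons_prob k n E t A \<ge> 1 - (t * real n powr (- 5) + (1 / r) ^ t * card A)"
    by (rule cons_prob_contraction[where R = "{A. real (card A) * r ^ 4 \<le> real n}"])
      (use A expected_card card_tail r_pos in auto)
  moreover have "(1 / r) ^ t * card A \<le> real n powr (- 2) * real n"
  proof (rule mult_mono)
    have "(1 / r) ^ t = exp (- (t * ln r))" using r_pos by (simp add: exp_minus exp_of_nat_mult power_one_over inverse_eq_divide)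
    also have "\<dots> \<le> exp (- (2 * ln n))" using t by simp
    also have "\<dots> = real n powr (- 2)" using n_pos by (simp add: powr_def)
    finally show "(1 / r) ^ t \<le> real n powr (- 2)" .
    show "real (card A) \<le> real n" using card_mono[OF _ A(1)] by simp
  qed auto
  moreover have "real n powr (- 2) * real n = real n powr (- 1)"
    using n_pos powr_add[of "real n" "- 2" 1] by simp
  ultimately show ?thesis by linarith
qed

lemma quadratic_phase:
  assumes A: "A \<subseteq> {..<n}" "2 * Q * mass E A \<le> 1 / 2" and t2: "2 ^ t2 \<ge> log 2 n" and t: "t * ln r \<ge> 2 * ln n"
  shows "cons_prob k n E (t2 + t) A \<ge> 1 - (t2 * real n powr (- 5) + (t * real n powr (- 5) + real n powr (- 1)))"
proof -
  \<comment> \<open>Iterated squaring from 1/2, stopped at the floor of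
    \<open>quadratic_step\<close>. After t2 rounds the power is at most 1 / n, below the
    floor.\<close>
  define u where "u = (\<lambda>j::nat. max ((1 / 2) ^ (2 ^ j)) (1 / r ^ 5))"
  have r5: "1 / r ^ 5 \<le> 1 / 2"
  proof -
    have "r ^ 1 \<le> r ^ 5" using r16 by (intro power_increasing) auto
    thus ?thesis using r16 by (intro divide_left_mono) auto
  qed
  have u1: "u j \<le> 1" for j using r5 by (auto simp: u_def intro: power_le_one)
  have u2: "(u j)\<^sup>2 \<le> u (Suc j)" for j
  proof (cases "(1 / 2 :: real) ^ (2 ^ j) \<ge> 1 / r ^ 5")
    case True
    hence "(u j)\<^sup>2 = (1 / 2) ^ (2 ^ Suc j)" by (simp add: u_def max_def power_mult[symmetric] mult.commute)
    thus ?thesis by (simp add: u_def)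
  next
    case False
    hence "(u j)\<^sup>2 = 1 / r ^ 5 * (1 / r ^ 5)" by (simp add: u_def max_def power2_eq_square)
    also have "\<dots> \<le> 1 / r ^ 5 * 1" using r5 r_pos by (intro mult_left_mono) auto
    finally show ?thesis by (simp add: u_def)
  qed
  show ?thesis
  proof (rule cons_prob_phases[where G = "\<lambda>j. {A. 2 * Q * mass E A \<le> u j}"])
    fix i B assume B: "B \<subseteq> {..<n}" "B \<in> {A. 2 * Q * mass E A \<le> u i}"
    have "measure_pmf.prob (kern k n E B) {B. 2 * Q * mass E B \<le> (u i)\<^sup>2} \<ge> 1 - real n powr (- 5)"
      by (rule quadratic_step) (use B u1 in \<open>auto simp: u_def\<close>)
    thus "measure_pmf.prob (kern k n E B) {A. 2 * Q * mass E A \<le> u (Suc i)} \<ge> 1 - real n powr (- 5)"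
      by (rule prob_kern_ge) (use u2[of i] in auto)
  next
    fix B assume B: "B \<subseteq> {..<n}" "B \<in> {A. 2 * Q * mass E A \<le> u t2}"
    have "(1 / 2 :: real) ^ (2 ^ t2) = 2 powr (- (2 ^ t2))"
      by (simp add: powr_minus powr_realpow[symmetric] power_one_over inverse_eq_divide)
    also have "\<dots> \<le> 2 powr (- log 2 n)" using t2 by (intro powr_mono) auto
    also have "\<dots> = 1 / n" using n_pos by (simp add: powr_minus powr_log_cancel inverse_eq_divide)
    also have "\<dots> \<le> 1 / r ^ 32" using rn r_pos n_pos by (intro divide_left_mono mult_pos_pos) auto
    also have "\<dots> \<le> 1 / r ^ 5" using r16 r_pos by (intro divide_left_mono power_increasing mult_pos_pos) auto
    finally have "u t2 = 1 / r ^ 5" by (simp add: u_def max_def)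
    hence "2 * Q * mass E B \<le> 1 / r ^ 5" using B by simp
    moreover have "1 * mass E B \<le> 2 * Q * mass E B" using Q1 mass_range[OF B(1)] by (intro mult_right_mono) auto
    ultimately have "mass E B \<le> 1 / r ^ 5" by linarith
    hence "10 * real n * mass E B \<le> 10 * real n * (1 / r ^ 5)" by (intro mult_left_mono) auto
    hence "\<eta> * card B \<le> 10 * real n * (1 / r ^ 5)" using card_le_mass[OF B(1)] by linarith
    from mult_right_mono[OF this, of "r ^ 5"] have c5: "\<eta> * card B * r ^ 5 \<le> 10 * real n" using r_pos by simp
    \<comment> \<open>From mass to size: a vertex has mass at least \<eta> / (10 n), and the loss 10
      / \<eta> is covered by one factor r, so r^(-5) becomes r^(-4).\<close>
    have "\<eta>\<^sup>2 \<le> \<eta>" using eta by (simp add: power2_eq_square mult_left_le)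
    hence "r * \<eta>\<^sup>2 \<le> r * \<eta>" using r_pos by (intro mult_left_mono) auto
    hence "10 \<le> r * \<eta>" using r_end Q1 by linarith
    hence "10 * (card B * r ^ 4) \<le> r * \<eta> * (card B * r ^ 4)" using r_pos by (intro mult_right_mono) auto
    also have "\<dots> = \<eta> * card B * r ^ 5" by (simp add: mult_ac flip: power_Suc)
    finally have "card B * r ^ 4 \<le> n" using c5 by simp
    thus "cons_prob k n E t B \<ge> 1 - (t * real n powr (- 5) + real n powr (- 1))"
      by (intro endgame B t) simp
  next
    have "(1 / 2 :: real) \<le> u 0" by (simp add: u_def)
    thus "A \<in> {A. 2 * Q * mass E A \<le> u 0}" using A by simp
  qed (use A in auto)
qed

lemma growth_phase:
  assumes A: "A \<subseteq> {..<n}" and d: "1 - 2 * mass E A \<ge> bias_const k L Q * max (1 / r ^ 32) (sqrt (ln n / n))"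
    and t1: "(1 - 2 * mass E A) * (1 + c1) ^ t1 \<ge> 1"
    and t2: "2 ^ t2 \<ge> log 2 n" and t: "t * ln r \<ge> 2 * ln n"
  shows "cons_prob k n E (t1 + (t2 + t)) A \<ge> 1 - (t1 * real n powr (- 5) + (t2 * real n powr (- 5) + (t * real n powr (- 5) + real n powr (- 1))))"
proof -
  define d0 where "d0 = 1 - 2 * mass E A"
  define M where "M = bias_const k L Q * max (1 / r ^ 32) (sqrt (ln n / n))"
  \<comment> \<open>The target is capped at the bias 1 - 2 x0, since \<open>growth_step\<close>
    applies only while the minority has mass at least x0.\<close>
  define G where "G = (\<lambda>i::nat. {B. 1 - 2 * mass E B \<ge> min (d0 * (1 + c1) ^ i) (1 - 2 * x0)})"
  have c1: "c1 > 0" by (rule growth_rate_pos)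
  have x0: "0 < x0" "x0 \<le> 1 / 4" using Q1 by auto
  have Mpos: "M > 0" unfolding M_def using bias_const_ge(1) r_pos(2)[of 32] by (intro mult_pos_pos) (auto simp: less_max_iff_disj)
  have Mle: "M \<le> 1 / 2"
  proof -
    have "sqrt (ln n / n) \<le> noise_level" using n_pos by (simp add: noise_level_def)
    also have "\<dots> \<le> 1 / r ^ 13" by (rule noise_le)
    also have "\<dots> \<le> 1 / r ^ 1" using r16 r_pos by (intro divide_left_mono power_increasing mult_pos_pos) auto
    finally have "sqrt (ln n / n) \<le> 1 / r" by simp
    moreover have "1 / r ^ 32 \<le> 1 / r ^ 1" using r16 r_pos by (intro divide_left_mono power_increasing mult_pos_pos) auto
    ultimately have "M \<le> r / 2 * (1 / r)"
      unfolding M_def using bias_const_ge r_pos by (intro mult_mono) (auto simp: le_max_iff_disj)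
    thus ?thesis using r_pos by simp
  qed
  have d0M: "M \<le> d0" using d by (simp add: M_def d0_def)
  have pw: "(1 + c1) ^ i \<ge> 1" for i using c1 by (intro one_le_power) auto
  have dM: "M \<le> min (d0 * (1 + c1) ^ i) (1 - 2 * x0)" for i
  proof -
    have "d0 * 1 \<le> d0 * (1 + c1) ^ i" using pw d0M Mpos by (intro mult_left_mono) auto
    hence "M \<le> d0 * (1 + c1) ^ i" using d0M by linarith
    moreover have "M \<le> 1 - 2 * x0" using Mle x0 by linarith
    ultimately show ?thesis by (rule min.boundedI)
  qed
  show ?thesis
  proof (rule cons_prob_phases[where G = G])
    fix i B assume B: "B \<subseteq> {..<n}" "B \<in> G i"
    have dB: "1 - 2 * mass E B \<ge> min (d0 * (1 + c1) ^ i) (1 - 2 * x0)" using B by (simp add: G_def)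
    hence dBM: "1 - 2 * mass E B \<ge> M" using dM[of i] by linarith
    show "measure_pmf.prob (kern k n E B) (G (Suc i)) \<ge> 1 - real n powr (- 5)"
    proof (cases "mass E B \<ge> x0")
      case True
      have "measure_pmf.prob (kern k n E B) {C. 1 - 2 * mass E C \<ge> (1 + c1) * (1 - 2 * mass E B)} \<ge> 1 - real n powr (- 5)"
        by (rule growth_step) (use B True dBM Mpos in \<open>auto simp: M_def\<close>)
      thus ?thesis
      proof (rule prob_kern_ge)
        fix C assume "C \<in> {C. 1 - 2 * mass E C \<ge> (1 + c1) * (1 - 2 * mass E B)}"
        moreover have "(1 + c1) * min (d0 * (1 + c1) ^ i) (1 - 2 * x0) \<le> (1 + c1) * (1 - 2 * mass E B)"
          using dB c1 by (intro mult_left_mono) auto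
        moreover have "min (d0 * (1 + c1) ^ Suc i) (1 - 2 * x0) \<le> (1 + c1) * min (d0 * (1 + c1) ^ i) (1 - 2 * x0)"
        proof -
          have "1 * (1 - 2 * x0) \<le> (1 + c1) * (1 - 2 * x0)" using c1 x0 by (intro mult_right_mono) auto
          thus ?thesis by (auto simp: min_def mult_ac)
        qed
        ultimately show "C \<in> G (Suc i)" by (simp add: G_def)
      qed
    next
      \<comment> \<open>Once below x0 the set stays there: a quadratic step with u = 1/2 gives 2 Q x
        \<le> 1/4, which is mass at most x0 / 2.\<close>
      case False
      have r5: "1 / r ^ 5 \<le> 1 / 2"
      proof -
        have "r ^ 1 \<le> r ^ 5" using r16 by (intro power_increasing) auto
        thus ?thesis using r16 by (intro divide_left_mono) auto
      qed
      have "2 * Q * mass E B \<le> 2 * Q * x0" using False Q1 by (intro mult_left_mono) auto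
      hence "measure_pmf.prob (kern k n E B) {C. 2 * Q * mass E C \<le> (1 / 2)\<^sup>2} \<ge> 1 - real n powr (- 5)"
        by (intro quadratic_step) (use B Q1 r5 in auto)
      thus ?thesis
      proof (rule prob_kern_ge)
        fix C assume "C \<in> {C. 2 * Q * mass E C \<le> (1 / 2)\<^sup>2}"
        hence "mass E C \<le> x0" using Q1 by (simp add: field_simps power2_eq_square)
        thus "C \<in> G (Suc i)" by (simp add: G_def)
      qed
    qed
  next
    fix B assume B: "B \<subseteq> {..<n}" "B \<in> G t1"
    hence "mass E B \<le> x0" using t1 x0 by (simp add: G_def d0_def min_def split: if_splits)
    hence "2 * Q * mass E B \<le> 2 * Q * x0" using Q1 by (intro mult_left_mono) auto
    thus "cons_prob k n E (t2 + t) B \<ge> 1 - (t2 * real n powr (- 5) + (t * real n powr (- 5) + real n powr (- 1)))"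
      by (intro quadratic_phase B t2 t) (use Q1 in simp)
  next
    show "A \<in> G 0" by (simp add: G_def d0_def)
  qed (use A in auto)
qed

end

text \<open>The first summand counts growth rounds per unit of ln (1 / bias). The 64 comes from 2 ln
  n / ln r = 64 ln n / ln (r^32) and also covers the doubly logarithmic phase and the
  roundings.\<close>

definition time_const :: "nat \<Rightarrow> real \<Rightarrow> real" where
  "time_const k Q = 1 / ln (1 + growth_rate k Q) + 64"

text \<open>The scaled bias h at which the gain c1 h equals the mean error 2 L' b, plus 80 from the
  fluctuations, plus 1 to be gained. Here \<open>b\<close> bounds sqrt n / D.\<close>

definition pot_offset :: "nat \<Rightarrow> real \<Rightarrow> real \<Rightarrow> real \<Rightarrow> real" where
  "pot_offset k L Q b = (2 * (16032 * L) * b + 81) / growth_rate k Q"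

text \<open>A lower bound for the variance of sqrt n times the bias after one round from a nearly
  balanced configuration.\<close>

definition var_const :: "nat \<Rightarrow> real \<Rightarrow> real" where
  "var_const k \<eta> = \<eta> / (5 * 4 ^ (2 * k))"

text \<open>Large enough that the level \<theta> v / 5 - 1 reached by \<open>scaled_jump\<close>, v
  being \<open>var_const\<close>, is at least \<open>pot_offset\<close> + 1.\<close>

definition tilt :: "nat \<Rightarrow> real \<Rightarrow> real \<Rightarrow> real \<Rightarrow> real \<Rightarrow> real" where
  "tilt k L Q \<eta> b = max 1 (5 * (pot_offset k L Q b + 2) / var_const k \<eta>)"

text \<open>One minus half of the jump probability exp (- 320 \<theta>^2) / 4: a jump at least
  halves the potential.\<close>

definition pot_rate :: "nat \<Rightarrow> real \<Rightarrow> real \<Rightarrow> real \<Rightarrow> real \<Rightarrow> real" where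
  "pot_rate k L Q \<eta> b = 1 - exp (- 320 * (tilt k L Q \<eta> b)\<^sup>2) / 8"

lemma pot_rate_bounds: "7 / 8 \<le> pot_rate k L Q \<eta> b" "pot_rate k L Q \<eta> b < 1"
  by (auto simp: pot_rate_def)

lemma vote_fun_0: "vote_fun k 0 = 0"
  using vote_fun_le_power[of 0 k] vote_fun_nonneg[of 0 k] by simp

context good_voting
begin

lemma n_large: "real n \<ge> 16 ^ 32" "ln n \<ge> 32" "ln (ln n) \<ge> 1" "ln (ln n) \<le> ln n" "ln n \<le> n"
proof -
  have "(16::real) ^ 32 \<le> r ^ 32" using r16 by (intro power_mono) auto
  thus n: "real n \<ge> 16 ^ 32" using rn by simp
  have "ln (4::real) \<le> ln 16" by (intro ln_mono) auto
  hence l16: "ln (16::real) \<ge> 1" using ln_4_ge_1 by linarith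
  have "ln (16 ^ 32 :: real) \<le> ln n" using n by (intro ln_mono) auto
  moreover have "ln (16 ^ 32 :: real) = 32 * ln 16" by (subst ln_realpow) auto
  ultimately show l: "ln n \<ge> 32" using l16 by linarith
  have "ln 16 \<le> ln (ln n)" using l by (intro ln_mono) auto
  thus "ln (ln n) \<ge> 1" using l16 by linarith
  show "ln (ln n) \<le> ln n" using ln_le_minus_one[of "ln n"] l by simp
  show "ln n \<le> n" using ln_le_minus_one[of "real n"] n_pos by simp
qed

lemma consensus_time_minority:
  assumes A: "A \<subseteq> {..<n}" and d: "1 - 2 * mass E A \<ge> bias_const k L Q * max (1 / r ^ 32) (sqrt (ln n / n))"
  shows "\<exists>t::nat. t \<le> time_const k Q * (ln (ln n) + ln (inverse (1 - 2 * mass E A)) + ln n / ln (r ^ 32)) \<and>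
    cons_prob k n E t A \<ge> 1 - real n powr (- 1 / 2)"
proof -
  define d0 where "d0 = 1 - 2 * mass E A"
  have "160 * (1 / r ^ 32) \<le> bias_const k L Q * max (1 / r ^ 32) (sqrt (ln n / n))"
    using bias_const_ge(1) r_pos(2)[of 32] by (intro mult_mono) auto
  hence "160 * (1 / r ^ 32) \<le> d0" using d by (simp add: d0_def)
  moreover have "1 / real n \<le> 1 / r ^ 32" using rn r_pos(2)[of 32] n_pos by (intro divide_left_mono mult_pos_pos) auto
  moreover have "0 < 1 / real n" using n_pos by simp
  ultimately have d0n: "1 / n \<le> d0" by linarith
  hence d0p: "0 < d0" using n_pos by (smt (verit) divide_pos_pos of_nat_0_less_iff)
  have d01: "d0 \<le> 1" using mass_range[OF A] by (simp add: d0_def)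
  have c1: "0 < c1" "c1 \<le> 1 / 8"
  proof -
    have "1 / (8 * Q) \<le> 1 / 8" using Q1 by simp
    thus "0 < c1" "c1 \<le> 1 / 8" using growth_rate_pos by linarith+
  qed
  define lc where "lc = ln (1 + c1)"
  have lc: "lc > 0" "lc \<ge> c1 / 2"
  proof -
    show "lc > 0" using c1 by (simp add: lc_def)
    have "c1 - c1\<^sup>2 \<le> lc" unfolding lc_def by (rule ln_one_plus_pos_lower_bound) (use c1 in auto)
    moreover have "c1\<^sup>2 \<le> c1 / 2" using c1 mult_left_mono[of c1 "1 / 2" c1] by (simp add: power2_eq_square)
    ultimately show "lc \<ge> c1 / 2" by linarith
  qed
  define l where "l = ln (inverse d0)"
  have l: "0 \<le> l" "l \<le> ln n"
  proof -
    show "0 \<le> l" using d01 d0p by (simp add: l_def ln_inverse)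
    have "inverse d0 \<le> n" using d0n d0p n_pos by (simp add: field_simps)
    thus "l \<le> ln n" unfolding l_def using d0p by (intro ln_mono) auto
  qed
  define w where "w = ln n / ln (r ^ 32)"
  have lnr: "ln r \<ge> 1"
  proof -
    have "ln 4 \<le> ln r" using r16 by (intro ln_mono) auto
    thus ?thesis using ln_4_ge_1 by linarith
  qed
  have lnr32: "ln (r ^ 32) = 32 * ln r" using r_pos by (simp add: ln_realpow)
  have w: "0 \<le> w" "w \<le> ln n"
  proof -
    show "0 \<le> w" using lnr n_large(2) by (simp add: w_def lnr32)
    have "ln n / ln (r ^ 32) \<le> ln n / 1" unfolding lnr32 using lnr n_large(2) by (intro divide_left_mono) auto
    thus "w \<le> ln n" by (simp add: w_def)
  qed
  \<comment> \<open>Rounds for the growth of the bias, for the repeated squaring, and for the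
    extinction of the minority.\<close>
  define t1 t2 t where "t1 = nat \<lceil>l / lc\<rceil>" and "t2 = nat \<lceil>log 2 (log 2 n)\<rceil>" and "t = nat \<lceil>2 * ln n / ln r\<rceil>"
  have t1: "l / lc \<le> t1" "t1 \<le> l / lc + 1" 
  proof -
    have "0 \<le> l / lc" using l lc by simp
    thus "l / lc \<le> t1" "t1 \<le> l / lc + 1" unfolding t1_def by linarith+
  qed
  have l2: "ln (2::real) \<ge> 1 / 2" "ln (2::real) \<le> 1" using ln_le_minus_one[of "1 / 2 :: real"] ln_le_minus_one[of "2::real"] by (auto simp: ln_div)
  have log2n: "log 2 n \<ge> 1"
    using n_large(2) l2 by (simp add: log_def field_simps)
  have log2: "0 \<le> log 2 (log 2 n)" using log2n by simp
  have t2: "log 2 (log 2 n) \<le> t2" "t2 \<le> log 2 (log 2 n) + 1" unfolding t2_def using log2 by linarith+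
  have t3: "2 * ln n / ln r \<le> t" "t \<le> 2 * ln n / ln r + 1"
  proof -
    have "0 \<le> 2 * ln n / ln r" using n_large(2) lnr by simp
    thus "2 * ln n / ln r \<le> t" "t \<le> 2 * ln n / ln r + 1" unfolding t_def by linarith+
  qed
  have "log 2 (log 2 n) \<le> 4 * ln (ln n)"
  proof -
    have "log 2 n \<le> 2 * ln n" using l2 n_large(2) by (simp add: log_def field_simps)
    hence "ln (log 2 n) \<le> ln (2 * ln n)" using log2n by (intro ln_mono) auto
    also have "\<dots> = ln 2 + ln (ln n)" using n_large(2) by (subst ln_mult) auto
    also have "\<dots> \<le> 2 * ln (ln n)" using l2 n_large(3) by simp
    finally have *: "ln (log 2 n) \<le> 2 * ln (ln n)" .
    have "log 2 (log 2 n) = ln (log 2 n) / ln 2" by (simp add: log_def)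
    also have "\<dots> \<le> 2 * ln (ln n) / ln 2" using * l2 by (intro divide_right_mono) auto
    also have "\<dots> \<le> 2 * ln (ln n) / (1 / 2)" using l2 n_large(3) by (intro divide_left_mono) auto
    finally show ?thesis by simp
  qed
  moreover have "2 * ln n / ln r = 64 * w" using lnr by (simp add: w_def lnr32)
  ultimately have "t1 + (t2 + t) \<le> l / lc + 4 * ln (ln n) + 64 * w + 3" using t1 t2 t3 by linarith
  also have "\<dots> \<le> l / lc + 7 * ln (ln n) + 64 * w" using n_large(3) by simp
  also have "\<dots> \<le> time_const k Q * (ln (ln n) + l + w)"
  proof -
    have "0 \<le> 1 / lc * (ln (ln n) + w)" using lc w n_large(3) by simp
    thus ?thesis using l n_large(3) w by (simp add: time_const_def lc_def[symmetric] distrib_left distrib_right add_divide_distrib)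
  qed
  finally have total: "t1 + (t2 + t) \<le> time_const k Q * (ln (ln n) + l + w)" .
  have "cons_prob k n E (t1 + (t2 + t)) A \<ge> 1 - (t1 * real n powr (- 5) + (t2 * real n powr (- 5) + (t * real n powr (- 5) + real n powr (- 1))))"
  proof (rule growth_phase[OF A d])
    have "inverse d0 = exp l" using d0p by (simp add: l_def)
    also have "\<dots> \<le> exp (t1 * lc)" using t1 lc by (simp add: field_simps)
    also have "\<dots> = (1 + c1) ^ t1" using c1 by (simp add: lc_def exp_of_nat_mult)
    finally have "d0 * inverse d0 \<le> d0 * (1 + c1) ^ t1" using d0p by (intro mult_left_mono) auto
    thus "1 \<le> (1 - 2 * mass E A) * (1 + c1) ^ t1" using d0p by (simp add: d0_def[symmetric])
    have "log 2 n = 2 powr (log 2 (log 2 n))" using log2n by simp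
    also have "\<dots> \<le> 2 powr t2" using t2 by (intro powr_mono) auto
    also have "\<dots> = 2 ^ t2" by (simp add: powr_realpow)
    finally show "log 2 n \<le> 2 ^ t2" .
    show "2 * ln n \<le> t * ln r" using t3 lnr by (simp add: field_simps)
  qed
  moreover have "t1 * real n powr (- 5) + (t2 * real n powr (- 5) + (t * real n powr (- 5) + real n powr (- 1))) \<le> real n powr (- 1 / 2)"
  proof -
    \<comment> \<open>Keeps the number of rounds below n^3, so that failures of n^(-5) per round
      remain negligible without a further condition on n.\<close>
    have "1 / lc \<le> r"
    proof -
      have "1 / lc \<le> 1 / (c1 / 2)" using lc c1 by (intro divide_left_mono mult_pos_pos) auto
      moreover have "320 * 1 \<le> r * c1" using r_growth L0 by simp
      hence "1 / (c1 / 2) \<le> r" using c1 by (simp add: field_simps)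
      ultimately show ?thesis by linarith
    qed
    moreover have "r \<le> n"
    proof -
      have "r ^ 1 \<le> r ^ 32" using r16 by (intro power_increasing) auto
      thus ?thesis using rn by simp
    qed
    moreover have "64 \<le> real n" using n_large(1) by simp
    ultimately have K: "time_const k Q \<le> 2 * real n" unfolding time_const_def lc_def[symmetric] by linarith
    have "time_const k Q * (ln (ln n) + l + w) \<le> 2 * real n * (3 * real n)"
    proof (rule mult_mono)
      show "ln (ln n) + l + w \<le> 3 * real n" "0 \<le> ln (ln n) + l + w" using n_large w l by linarith+
    qed (use K in auto)
    also have "\<dots> \<le> real n * real n * real n" using n_large(1) by (simp add: mult_left_mono)
    finally have "real (t1 + (t2 + t)) \<le> real n * real n * real n" using total by linarith
    also have "\<dots> = real n powr 3" using n_pos by (simp add: powr_numeral power3_eq_cube)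
    finally have "real (t1 + (t2 + t)) * real n powr (- 5) \<le> real n powr 3 * real n powr (- 5)" by (rule mult_right_mono) simp
    also have "\<dots> = real n powr (- 2)" using powr_add[of "real n" 3 "- 5"] by simp
    also have "\<dots> \<le> real n powr (- 1)" using n_pos by (intro powr_mono) auto
    finally have "real (t1 + (t2 + t)) * real n powr (- 5) + real n powr (- 1) \<le> 2 * real n powr (- 1)" by simp
    also have "\<dots> \<le> real n powr (1 / 2) * real n powr (- 1)"
    proof (rule mult_right_mono)
      have "2 = sqrt 4" by simp
      also have "\<dots> \<le> sqrt n" using n_pos by (intro real_sqrt_le_mono) auto
      finally show "2 \<le> real n powr (1 / 2)" by (simp add: powr_half_sqrt)
    qed simp
    also have "\<dots> = real n powr (- 1 / 2)" using powr_add[of "real n" "1 / 2" "- 1"] by simp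
    finally show ?thesis by (simp add: distrib_right)
  qed
  ultimately have "cons_prob k n E (t1 + (t2 + t)) A \<ge> 1 - real n powr (- 1 / 2)" by linarith
  thus ?thesis using total unfolding l_def w_def d0_def by blast
qed

lemma consensus_time:
  assumes A: "A \<subseteq> {..<n}" and d: "\<bar>bias E A\<bar> \<ge> bias_const k L Q * max (1 / r ^ 32) (sqrt (ln n / n))"
  shows "\<exists>t::nat. t \<le> time_const k Q * (ln (ln n) + ln (inverse \<bar>bias E A\<bar>) + ln n / ln (r ^ 32)) \<and>
    cons_prob k n E t A \<ge> 1 - real n powr (- 1 / 2)"
proof (cases "mass E A \<le> 1 / 2")
  case True
  hence b: "\<bar>bias E A\<bar> = 1 - 2 * mass E A" by (simp add: bias_mass)
  show ?thesis using consensus_time_minority[OF A] d unfolding b by blast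
next
  case False
  let ?C = "{..<n} - A"
  have b: "\<bar>bias E A\<bar> = 1 - 2 * mass E ?C" using False by (simp add: bias_mass mass_complement[OF A])
  have "?C \<subseteq> {..<n}" by auto
  from consensus_time_minority[OF this] d show ?thesis unfolding b cons_prob_complement[OF A] by blast
qed

section \<open>Consensus is absorbing\<close>

lemma kern_empty: "kern k n E {} = return_pmf {}"
proof -
  have "measure_pmf.expectation (kern k n E {}) (\<lambda>B. real (card B)) = (\<Sum>v<n. next_prob k E {} v * 1)"
    using expectation_rand_subset_sum[OF _ next_prob_01, of "{}" "\<lambda>_. 1"] unfolding kern_def by simp
  also have "\<dots> = 0" by (simp add: next_prob_def nfrac_def vote_fun_0)
  finally have e: "measure_pmf.expectation (kern k n E {}) (\<lambda>B. real (card B)) = 0" .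
  have "B = {}" if B: "B \<in> set_pmf (kern k n E {})" for B
  proof (rule ccontr)
    assume ne: "B \<noteq> {}"
    have "finite B" using B set_kern[of k n E "{}"] finite_subset by blast
    hence cB: "card B \<noteq> 0" using ne by simp
    have "0 = (\<Sum>C\<in>set_pmf (kern k n E {}). pmf (kern k n E {}) C *\<^sub>R real (card C))"
      unfolding e[symmetric] by (rule integral_measure_pmf) (auto simp: finite_set_kern)
    hence "pmf (kern k n E {}) B * real (card B) = 0"
      using B finite_set_kern[of k n E "{}"] by (subst (asm) eq_commute, subst (asm) sum_nonneg_eq_0_iff) auto
    thus False using B cB by (simp add: set_pmf_iff)
  qed
  hence "set_pmf (kern k n E {}) \<subseteq> {{}}" by auto
  thus ?thesis by (simp add: set_pmf_subset_singleton)
qed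

text \<open>Configurations of different bias come with different consensus times; monotonicity
  permits one common number of rounds for all of them.\<close>

lemma cons_prob_mono_Suc:
  assumes "A \<subseteq> {..<n}"
  shows "cons_prob k n E t A \<le> cons_prob k n E (Suc t) A"
  using assms
proof (induction t arbitrary: A)
  case 0
  have e: "cons_prob k n E (Suc 0) {} = 1" unfolding cons_prob_Suc kern_empty by (simp add: cons_prob_def)
  show ?case
  proof (cases "A \<in> {{}, {..<n}}")
    case True
    have "cons_prob k n E (Suc 0) {..<n} = cons_prob k n E (Suc 0) {}"
      using cons_prob_complement[of "{}" "Suc 0"] by simp
    thus ?thesis using True e cons_prob_range(2)[of k n E 0 A] by auto
  next
    case False
    hence "cons_prob k n E 0 A = 0" by (simp add: cons_prob_def)
    thus ?thesis using cons_prob_range(1) by metis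
  qed
next
  case (Suc t)
  have "measure_pmf.expectation (kern k n E A) (cons_prob k n E t) \<le> measure_pmf.expectation (kern k n E A) (cons_prob k n E (Suc t))"
  proof (rule expectation_mono_pmf[OF finite_set_kern])
    fix B assume "B \<in> set_pmf (kern k n E A)"
    hence "B \<subseteq> {..<n}" using set_kern by blast
    thus "cons_prob k n E t B \<le> cons_prob k n E (Suc t) B" by (rule Suc.IH)
  qed
  thus ?case by (simp only: cons_prob_Suc[of k n E t A] cons_prob_Suc[of k n E "Suc t" A])
qed

lemma cons_prob_mono:
  assumes "A \<subseteq> {..<n}" "s \<le> t"
  shows "cons_prob k n E s A \<le> cons_prob k n E t A"
  by (rule lift_Suc_mono_le[of "\<lambda>t. cons_prob k n E t A", OF cons_prob_mono_Suc[OF assms(1)] assms(2)])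

section \<open>Drift and fluctuations near balance\<close>

lemma mean_mass_complement:
  assumes A: "A \<subseteq> {..<n}"
  shows "mean_mass ({..<n} - A) = 1 - mean_mass A"
proof -
  have "mean_mass ({..<n} - A) = (\<Sum>v<n. stat E v - next_prob k E A v * stat E v)"
    unfolding mean_mass_def by (intro sum.cong refl) (auto simp: next_prob_def nfrac_complement algebra_simps)
  thus ?thesis by (simp add: sum_subtractf sum_stat mean_mass_def)
qed

lemma abs_mean_bias_growth:
  assumes A: "A \<subseteq> {..<n}" and x: "\<bar>1 - 2 * mass E A\<bar> \<le> 1 / 2"
  shows "\<bar>1 - 2 * mean_mass A\<bar> \<ge> (1 + c1) * \<bar>1 - 2 * mass E A\<bar> - 2 * L' / r ^ 32"
proof -
  have *: "\<bar>1 - 2 * mean_mass A\<bar> \<ge> (1 + c1) * \<bar>1 - 2 * mass E A\<bar> - 2 * L' / r ^ 32"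
    if A: "A \<subseteq> {..<n}" and x: "1 / 4 \<le> mass E A" "mass E A \<le> 1 / 2" for A
  proof -
    have "x0 / 2 \<le> 1 / 4 * (1 / 2)" using Q1 by simp
    also have "\<dots> \<le> mass E A * (1 - mass E A)" using x by (intro mult_mono) auto
    finally have "1 - 2 * mean_mass A \<ge> (1 + 3 / 2 * c1) * (1 - 2 * mass E A) - 2 * L' / r ^ 32"
      by (intro mean_bias_growth A x)
    moreover have "(1 + c1) * (1 - 2 * mass E A) \<le> (1 + 3 / 2 * c1) * (1 - 2 * mass E A)"
      using x growth_rate_pos(1) by (intro mult_right_mono) auto
    ultimately show ?thesis using x by simp
  qed
  show ?thesis
  proof (cases "mass E A \<le> 1 / 2")
    case True
    thus ?thesis using *[OF A] x by (simp add: abs_le_iff)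
  next
    case False
    have "(1 + c1) * \<bar>1 - 2 * mass E ({..<n} - A)\<bar> - 2 * L' / r ^ 32 \<le> \<bar>1 - 2 * mean_mass ({..<n} - A)\<bar>"
      by (rule *) (use False x in \<open>auto simp: mass_complement[OF A] abs_le_iff\<close>)
    moreover have "\<bar>1 - 2 * mass E ({..<n} - A)\<bar> = \<bar>1 - 2 * mass E A\<bar>"
      "\<bar>1 - 2 * mean_mass ({..<n} - A)\<bar> = \<bar>1 - 2 * mean_mass A\<bar>"
      unfolding mass_complement[OF A] mean_mass_complement[OF A] by (auto simp: abs_if)
    ultimately show ?thesis by simp
  qed
qed

text \<open>The bias in units of 1 / sqrt n, the order of its fluctuation in one round.\<close>

definition scaled :: "nat set \<Rightarrow> real" where
  "scaled A = sqrt n * \<bar>1 - 2 * mass E A\<bar>"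

lemma scaled_stat_le:
  fixes c s :: real
  assumes v: "v < n" and c: "c \<ge> 0" "(40 * c)\<^sup>2 \<le> n" and s: "\<bar>s\<bar> = 1"
  shows "\<bar>s * (2 * c * sqrt n * stat E v)\<bar> \<le> 1"
proof -
  have "40 * c \<le> sqrt n" using c by (simp add: real_le_rsqrt)
  have "2 * c * sqrt n * stat E v \<le> 2 * c * sqrt n * (20 / n)" using c by (intro mult_left_mono stat_bounds v) auto
  also have "\<dots> = (40 * c) * (sqrt n / n)" by simp
  also have "\<dots> \<le> sqrt n * (sqrt n / n)" using \<open>40 * c \<le> sqrt n\<close> by (intro mult_right_mono) auto
  also have "\<dots> = 1" using n_pos by simp
  finally have "2 * c * sqrt n * stat E v \<le> 1" .
  moreover have "0 \<le> 2 * c * sqrt n * stat E v" using c stat_nonneg by simp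
  ultimately have "\<bar>2 * c * sqrt n * stat E v\<bar> \<le> 1" by linarith
  thus ?thesis using s by (simp only: abs_mult[of s] mult_1)
qed

lemma sum_scaled_squares:
  fixes c s :: real
  shows
  "(\<Sum>v<n. next_prob k E A v * (s * (2 * c * sqrt n * stat E v))\<^sup>2) \<le> 80 * s\<^sup>2 * c\<^sup>2"
proof -
  have "(\<Sum>v<n. next_prob k E A v * (s * (2 * c * sqrt n * stat E v))\<^sup>2) \<le> (\<Sum>v<n. (s * (2 * c * sqrt n * stat E v))\<^sup>2)"
    using next_prob_01 by (intro sum_mono mult_left_le_one_le) auto
  also have "\<dots> = 4 * n * s\<^sup>2 * c\<^sup>2 * (\<Sum>v<n. (stat E v)\<^sup>2)"
    by (simp add: power_mult_distrib sum_distrib_left mult_ac)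
  also have "\<dots> \<le> 4 * n * s\<^sup>2 * c\<^sup>2 * (20 / n)" by (intro mult_left_mono sum_stat_squares) auto
  also have "\<dots> = 80 * s\<^sup>2 * c\<^sup>2" using n_pos by simp
  finally show ?thesis .
qed

lemma scaled_sum:
  fixes c s :: real
  shows "(\<Sum>v\<in>B. s * (2 * c * sqrt n * stat E v)) = s * (2 * c * sqrt n * mass E B)"
  by (simp add: mass_def sum_distrib_left)

lemma scaled_mean:
  fixes c s :: real
  shows "(\<Sum>v<n. next_prob k E A v * (s * (2 * c * sqrt n * stat E v))) = s * (2 * c * sqrt n * mean_mass A)"
  by (simp add: mean_mass_def sum_distrib_left mult_ac)

lemma scaled_exp_moment:
  "measure_pmf.expectation (kern k n E A) (\<lambda>B. exp (- scaled B)) \<le> exp (80 - sqrt n * \<bar>1 - 2 * mean_mass A\<bar>)"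
proof -
  \<comment> \<open>With s the sign of the mean bias, minus the absolute bias is at most - s times
    the bias, which is linear in the random set.\<close>
  define s :: real where "s = (if 1 - 2 * mean_mass A \<ge> 0 then 1 else - 1)"
  have s: "\<bar>s\<bar> = 1" "s\<^sup>2 = 1" "s * (1 - 2 * mean_mass A) = \<bar>1 - 2 * mean_mass A\<bar>" by (auto simp: s_def)
  let ?c = "\<lambda>v. s * (2 * 1 * sqrt n * stat E v)"
  have "measure_pmf.expectation (kern k n E A) (\<lambda>B. exp (- scaled B)) \<le>
    measure_pmf.expectation (kern k n E A) (\<lambda>B. exp (\<Sum>v\<in>B. ?c v) * exp (- s * sqrt n))"
  proof (rule expectation_mono_pmf[OF finite_set_kern])
    fix B
    have "s * (1 - 2 * mass E B) \<le> \<bar>1 - 2 * mass E B\<bar>" by (auto simp: s_def)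
    hence "sqrt n * (s * (1 - 2 * mass E B)) \<le> scaled B" unfolding scaled_def by (rule mult_left_mono) simp
    hence "- scaled B \<le> s * (2 * 1 * sqrt n * mass E B) + - s * sqrt n" by (simp add: algebra_simps)
    thus "exp (- scaled B) \<le> exp (\<Sum>v\<in>B. ?c v) * exp (- s * sqrt n)"
      unfolding scaled_sum by (simp flip: exp_add)
  qed
  also have "\<dots> = measure_pmf.expectation (kern k n E A) (\<lambda>B. exp (\<Sum>v\<in>B. ?c v)) * exp (- s * sqrt n)" by simp
  also have "\<dots> \<le> exp ((\<Sum>v<n. next_prob k E A v * ?c v) + (\<Sum>v<n. next_prob k E A v * (?c v)\<^sup>2)) * exp (- s * sqrt n)"
  proof -
    have "\<forall>v\<in>{..<n}. \<bar>?c v\<bar> \<le> 1" using scaled_stat_le[of _ 1 s] s n_large(1) by simp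
    thus ?thesis unfolding kern_def by (intro mult_right_mono rand_subset_mgf_centered next_prob_01) auto
  qed
  also have "\<dots> = exp (- (s * (1 - 2 * mean_mass A) * sqrt n) + (\<Sum>v<n. next_prob k E A v * (?c v)\<^sup>2))"
    unfolding scaled_mean by (simp add: exp_add[symmetric] algebra_simps)
  also have "\<dots> \<le> exp (80 - sqrt n * \<bar>1 - 2 * mean_mass A\<bar>)"
    using sum_scaled_squares[of A s 1] unfolding s by (simp add: mult.commute)
  finally show ?thesis .
qed

text \<open>By Chebyshev and \<open>nfrac_variance\<close>, vertices of total stationary mass at
  least 1/2 see a fraction between 1/4 and 3/4. There either outcome has probability at least
  4^(-k).\<close>

lemma next_prob_variance:
  assumes A: "A \<subseteq> {..<n}" and x: "\<bar>1 - 2 * mass E A\<bar> \<le> 1 / 4"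
  shows "(\<Sum>v<n. next_prob k E A v * (1 - next_prob k E A v) * (stat E v)\<^sup>2) \<ge> var_const k \<eta> / (4 * n)"
proof -
  let ?y = "nfrac E A" and ?x = "mass E A" and ?q = "next_prob k E A"
  define I where "I = {v \<in> {..<n}. \<bar>?y v - ?x\<bar> \<le> 1 / 8}"
  have half: "(\<Sum>v\<in>I. stat E v) \<ge> 1 / 2"
  proof -
    have "(\<Sum>v<n. stat E v) \<le> (\<Sum>v<n. of_bool (v \<in> I) * stat E v + 64 * (stat E v * (?y v - ?x)\<^sup>2))"
    proof (rule sum_mono)
      fix v assume v: "v \<in> {..<n}"
      show "stat E v \<le> of_bool (v \<in> I) * stat E v + 64 * (stat E v * (?y v - ?x)\<^sup>2)"
      proof (cases "v \<in> I")
        case True thus ?thesis using stat_nonneg[of v] by simp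
      next
        case False
        hence "1 / 8 \<le> \<bar>?y v - ?x\<bar>" using v by (auto simp: I_def)
        hence "(1 / 8)\<^sup>2 \<le> \<bar>?y v - ?x\<bar>\<^sup>2" by (intro power_mono) auto
        hence "stat E v * 1 \<le> stat E v * (64 * (?y v - ?x)\<^sup>2)" by (intro mult_left_mono stat_nonneg) (simp add: power2_eq_square)
        thus ?thesis using False by (simp add: mult_ac)
      qed
    qed
    also have "\<dots> = (\<Sum>v<n. of_bool (v \<in> I) * stat E v) + 64 * (\<Sum>v<n. stat E v * (?y v - ?x)\<^sup>2)"
      by (simp add: sum.distrib sum_distrib_left)
    also have "(\<Sum>v<n. of_bool (v \<in> I) * stat E v) = (\<Sum>v\<in>I. stat E v)"
      by (rule sum.mono_neutral_cong_right) (auto simp: I_def)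
    also have "64 * (\<Sum>v<n. stat E v * (?y v - ?x)\<^sup>2) \<le> 64 * (16032 / r ^ 32)"
      by (intro mult_left_mono nfrac_variance A) auto
    also have "64 * (16032 / r ^ 32) \<le> 1 / 2"
    proof -
      have "(16::real) ^ 32 \<le> r ^ 32" using r16 by (intro power_mono) auto
      hence "2 * 64 * 16032 \<le> r ^ 32" by simp
      thus ?thesis using r_pos(2)[of 32] by (simp add: field_simps)
    qed
    finally show ?thesis using sum_stat by simp
  qed
  have nn: "0 \<le> ?q v * (1 - ?q v)" for v
    using next_prob_range[OF Ev, of k A v] by simp
  have "var_const k \<eta> / (4 * n) = (1 / 4) ^ (2 * k) * (\<eta> / (10 * n)) * (1 / 2)"
    using n_pos by (simp add: var_const_def power_one_over field_simps)
  also have "\<dots> \<le> (1 / 4) ^ (2 * k) * (\<eta> / (10 * n)) * (\<Sum>v\<in>I. stat E v)"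
    using half eta by (intro mult_left_mono) auto
  also have "\<dots> = (\<Sum>v\<in>I. (1 / 4) ^ (2 * k) * (\<eta> / (10 * n) * stat E v))"
    by (simp add: sum_distrib_left mult.assoc)
  also have "\<dots> \<le> (\<Sum>v\<in>I. ?q v * (1 - ?q v) * (stat E v)\<^sup>2)"
  proof (rule sum_mono)
    fix v assume "v \<in> I"
    hence v: "v < n" "\<bar>?y v - ?x\<bar> \<le> 1 / 8" by (auto simp: I_def)
    hence y: "1 / 4 \<le> ?y v" "?y v \<le> 3 / 4" using x unfolding abs_le_iff by linarith+
    have f: "(1 / 4) ^ k \<le> vote_fun k z" "vote_fun k z \<le> 1 - (1 / 4) ^ k" if z: "1 / 4 \<le> z" "z \<le> 3 / 4" for z
    proof -
      have "(1 / 4) ^ k \<le> z ^ k" using z by (intro power_mono) auto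
      also have "\<dots> \<le> vote_fun k z" using z k by (intro vote_fun_ge_power) auto
      finally show "(1 / 4) ^ k \<le> vote_fun k z" .
      have "(1 / 4) ^ k \<le> (1 - z) ^ k" using z by (intro power_mono) auto
      thus "vote_fun k z \<le> 1 - (1 / 4) ^ k" using vote_fun_le_power[of z k] z by simp
    qed
    have "(1 / 4) ^ k \<le> ?q v" "(1 / 4) ^ k \<le> 1 - ?q v"
      using f[of "?y v"] f[of "1 - ?y v"] y by (auto simp: next_prob_def)
    hence "(1 / 4) ^ k * (1 / 4) ^ k \<le> ?q v * (1 - ?q v)" by (intro mult_mono) (auto intro: order_trans[of 0 "(1 / 4) ^ k"])
    moreover have "(1 / 4 :: real) ^ k * (1 / 4) ^ k = (1 / 4) ^ (2 * k)" by (simp add: power_add[symmetric] mult_2)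
    moreover have "\<eta> / (10 * n) * stat E v \<le> (stat E v)\<^sup>2"
      unfolding power2_eq_square by (intro mult_right_mono stat_bounds stat_nonneg v)
    ultimately show "(1 / 4) ^ (2 * k) * (\<eta> / (10 * n) * stat E v) \<le> ?q v * (1 - ?q v) * (stat E v)\<^sup>2"
      using nn[of v] eta stat_nonneg[of v] by (intro mult_mono) auto
  qed
  also have "\<dots> \<le> (\<Sum>v<n. ?q v * (1 - ?q v) * (stat E v)\<^sup>2)"
    by (rule sum_mono2) (use nn in \<open>auto simp: I_def intro!: mult_nonneg_nonneg[OF nn]\<close>)
  finally show ?thesis .
qed

lemma scaled_jump:
  fixes \<theta> :: real
  assumes A: "A \<subseteq> {..<n}" and x: "\<bar>1 - 2 * mass E A\<bar> \<le> 1 / 4" and \<theta>: "\<theta> \<ge> 1" "(80 * \<theta>)\<^sup>2 \<le> n"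
  shows "measure_pmf.prob (kern k n E A) {B. scaled B \<ge> \<theta> * var_const k \<eta> / 5 - 1} \<ge> exp (- 320 * \<theta>\<^sup>2) / 4"
proof -
  \<comment> \<open>The deviation is taken in the direction of the mean bias, so the mean can only
    add to the size of the resulting bias.\<close>
  define s :: real where "s = (if 1 - 2 * mean_mass A \<ge> 0 then - 1 else 1)"
  have s: "\<bar>s\<bar> = 1" "s\<^sup>2 = 1" "- s * (1 - 2 * mean_mass A) \<ge> 0" by (auto simp: s_def)
  define m where "m = s * (2 * \<theta> * sqrt n * mean_mass A)"
  let ?c = "\<lambda>v. s * (2 * \<theta> * sqrt n * stat E v)" and ?d = "\<lambda>v. s * (2 * (2 * \<theta>) * sqrt n * stat E v)"
  let ?S = "\<lambda>B. (\<Sum>v\<in>B. ?c v) - m" and ?K = "kern k n E A" and ?q = "next_prob k E A"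
  \<comment> \<open>The exponent gained from the variance by \<open>rand_subset_mgf_lower\<close>.
    As \<theta> \<ge> 1, dividing the threshold a - 1 by \<theta> leaves at least \<theta>
    \<open>var_const\<close> / 5 - 1.\<close>
  define a where "a = \<theta>\<^sup>2 * var_const k \<eta> / 5"
  have th4: "(40 * \<theta>)\<^sup>2 \<le> n"
  proof -
    have "(40 * \<theta>)\<^sup>2 \<le> (80 * \<theta>)\<^sup>2" using \<theta> by (intro power_mono) auto
    thus ?thesis using \<theta> by linarith
  qed
  have c: "\<forall>v\<in>{..<n}. \<bar>?c v\<bar> \<le> 1" using scaled_stat_le[of _ \<theta> s] s \<theta> th4 by auto
  have d: "\<forall>v\<in>{..<n}. \<bar>?d v\<bar> \<le> 1" using scaled_stat_le[of _ "2 * \<theta>" s] s \<theta> by auto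
  have "measure_pmf.prob ?K {B. ?S B \<ge> a - 1} \<ge> exp (2 * a - 320 * \<theta>\<^sup>2) / 4"
  proof (rule exp_tilt_lower_tail[OF finite_set_kern])
    have "exp (m + (\<Sum>v<n. ?q v * (1 - ?q v) * (?c v)\<^sup>2) / 5) \<le> measure_pmf.expectation ?K (\<lambda>B. exp (\<Sum>v\<in>B. ?c v))"
      using rand_subset_mgf_lower[OF _ next_prob_01[of A] c] unfolding kern_def[symmetric] scaled_mean m_def by simp
    hence "exp (m + (\<Sum>v<n. ?q v * (1 - ?q v) * (?c v)\<^sup>2) / 5) * exp (- m) \<le> measure_pmf.expectation ?K (\<lambda>B. exp (\<Sum>v\<in>B. ?c v)) * exp (- m)"
      by (rule mult_right_mono) simp
    moreover have "exp (m + z) * exp (- m) = exp z" for z by (simp flip: exp_add)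
    moreover have "exp (?S B) = exp (\<Sum>v\<in>B. ?c v) * exp (- m)" for B by (simp add: exp_diff exp_minus divide_inverse)
    ultimately have 1: "exp ((\<Sum>v<n. ?q v * (1 - ?q v) * (?c v)\<^sup>2) / 5) \<le> measure_pmf.expectation ?K (\<lambda>B. exp (?S B))"
      by simp
    have "a = \<theta>\<^sup>2 * (4 * n) * (var_const k \<eta> / (4 * n)) / 5" using n_pos by (simp add: a_def)
    also have "\<dots> \<le> \<theta>\<^sup>2 * (4 * n) * (\<Sum>v<n. ?q v * (1 - ?q v) * (stat E v)\<^sup>2) / 5"
      by (intro divide_right_mono mult_left_mono next_prob_variance A x) auto
    also have "\<dots> = (\<Sum>v<n. ?q v * (1 - ?q v) * (?c v)\<^sup>2) / 5"
      using s(2) by (simp add: sum_distrib_left power_mult_distrib mult_ac)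
    finally have "exp a \<le> exp ((\<Sum>v<n. ?q v * (1 - ?q v) * (?c v)\<^sup>2) / 5)" by simp
    thus "exp a \<le> measure_pmf.expectation ?K (\<lambda>B. exp (?S B))" using 1 by linarith
    have "measure_pmf.expectation ?K (\<lambda>B. exp (\<Sum>v\<in>B. ?d v)) \<le> exp ((\<Sum>v<n. ?q v * ?d v) + (\<Sum>v<n. ?q v * (?d v)\<^sup>2))"
      unfolding kern_def by (rule rand_subset_mgf_centered[OF _ next_prob_01 d]) simp
    also have "(\<Sum>v<n. ?q v * ?d v) = 2 * m" unfolding scaled_mean by (simp add: m_def)
    also have "exp (2 * m + (\<Sum>v<n. ?q v * (?d v)\<^sup>2)) \<le> exp (2 * m + 320 * \<theta>\<^sup>2)"
      using sum_scaled_squares[of A s "2 * \<theta>"] s(2) by (simp add: power_mult_distrib)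
    finally have "measure_pmf.expectation ?K (\<lambda>B. exp (\<Sum>v\<in>B. ?d v)) * exp (- 2 * m) \<le> exp (2 * m + 320 * \<theta>\<^sup>2) * exp (- 2 * m)"
      by (rule mult_right_mono) simp
    moreover have "exp (2 * m + 320 * \<theta>\<^sup>2) * exp (- 2 * m) = exp (320 * \<theta>\<^sup>2)" by (simp flip: exp_add)
    moreover have "measure_pmf.expectation ?K (\<lambda>B. exp (\<Sum>v\<in>B. ?d v)) * exp (- 2 * m) = measure_pmf.expectation ?K (\<lambda>B. exp (2 * ?S B))"
    proof -
      have "(\<Sum>v\<in>B. ?d v) + - 2 * m = 2 * ?S B" for B unfolding scaled_sum by (simp add: algebra_simps)
      hence *: "exp (\<Sum>v\<in>B. ?d v) * exp (- 2 * m) = exp (2 * ?S B)" for B by (simp only: exp_add[symmetric])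
      have "measure_pmf.expectation ?K (\<lambda>B. exp (\<Sum>v\<in>B. ?d v) * exp (- 2 * m)) = measure_pmf.expectation ?K (\<lambda>B. exp (\<Sum>v\<in>B. ?d v)) * exp (- 2 * m)"
        by simp
      thus ?thesis unfolding * by (rule sym)
    qed
    ultimately show "measure_pmf.expectation ?K (\<lambda>B. exp (2 * ?S B)) \<le> exp (320 * \<theta>\<^sup>2)" by (simp only:)
  qed
  also have "measure_pmf.prob ?K {B. ?S B \<ge> a - 1} \<le> measure_pmf.prob ?K {B. scaled B \<ge> \<theta> * var_const k \<eta> / 5 - 1}"
  proof (rule prob_mono_support)
    fix B assume "B \<in> {B. ?S B \<ge> a - 1}"
    hence "a - 1 \<le> s * (2 * \<theta> * sqrt n * mass E B) - m" unfolding scaled_sum by simp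
    also have "\<dots> \<le> s * (2 * \<theta> * sqrt n * mass E B) - m + \<theta> * sqrt n * (- s * (1 - 2 * mean_mass A))"
    proof -
      have "0 \<le> \<theta> * sqrt n" using \<theta> by simp
      from mult_nonneg_nonneg[OF this s(3)] show ?thesis by linarith
    qed
    also have "\<dots> = \<theta> * sqrt n * (- s * (1 - 2 * mass E B))" by (simp add: m_def algebra_simps)
    also have "\<dots> \<le> \<theta> * sqrt n * \<bar>1 - 2 * mass E B\<bar>"
      using \<theta> by (intro mult_left_mono) (auto simp: s_def)
    finally have "a - 1 \<le> \<theta> * scaled B" by (simp add: scaled_def mult.assoc)
    hence "\<theta> * (\<theta> * var_const k \<eta> / 5 - 1) \<le> \<theta> * scaled B" using \<theta> by (simp add: a_def power2_eq_square algebra_simps)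
    thus "B \<in> {B. scaled B \<ge> \<theta> * var_const k \<eta> / 5 - 1}" using \<theta> by simp
  qed
  finally have "exp (2 * a - 320 * \<theta>\<^sup>2) / 4 \<le> measure_pmf.prob ?K {B. scaled B \<ge> \<theta> * var_const k \<eta> / 5 - 1}" .
  moreover have "exp (- 320 * \<theta>\<^sup>2) \<le> exp (2 * a - 320 * \<theta>\<^sup>2)" using eta by (simp add: a_def var_const_def)
  ultimately show ?thesis by linarith
qed

end

section \<open>Starting from an unbiased configuration\<close>

text \<open>The forward counterpart of \<open>cons_prob_phases\<close>: it locates the state at each
  time, as needed to exclude an early consensus.\<close>

lemma pmf_chain_phases:
  fixes \<eta> :: real
  assumes step: "\<And>i B. B \<subseteq> {..<n} \<Longrightarrow> B \<in> G i \<Longrightarrow> measure_pmf.prob (kern k n E B) (G (Suc i)) \<ge> 1 - \<eta>"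
    and "0 \<le> \<eta>" "A \<subseteq> {..<n}" "A \<in> G 0"
  shows "measure_pmf.prob (chain k n E t A) (G t) \<ge> 1 - t * \<eta> \<and> set_pmf (chain k n E t A) \<subseteq> Pow {..<n}"
proof (induction t)
  case 0
  show ?case using assms by simp
next
  case (Suc t)
  let ?M = "chain k n E t A"
  note int = integrable_measure_pmf_finite[OF finite_set_chain]
  have "1 - Suc t * \<eta> \<le> measure_pmf.prob ?M (G t) - \<eta>" using Suc by (simp add: algebra_simps)
  also have "\<dots> = measure_pmf.expectation ?M (\<lambda>B. indicat_real (G t) B - \<eta>)" by (simp add: int)
  also have "\<dots> \<le> measure_pmf.expectation ?M (\<lambda>B. measure_pmf.prob (kern k n E B) (G (Suc t)))"
  proof (rule expectation_mono_pmf[OF finite_set_chain])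
    fix B assume B: "B \<in> set_pmf ?M"
    hence "B \<subseteq> {..<n}" using Suc by blast
    hence "B \<in> G t \<Longrightarrow> measure_pmf.prob (kern k n E B) (G (Suc t)) \<ge> 1 - \<eta>" by (rule step)
    moreover have "0 \<le> measure_pmf.prob (kern k n E B) (G (Suc t))" by simp
    ultimately show "indicat_real (G t) B - \<eta> \<le> measure_pmf.prob (kern k n E B) (G (Suc t))"
      using assms(2) by (cases "B \<in> G t") (auto intro: order_trans[of _ 0])
  qed
  also have "\<dots> = measure_pmf.prob (chain k n E (Suc t) A) (G (Suc t))"
    by (simp add: prob_bind_pmf[OF finite_set_chain])
  finally show ?case by (auto dest: set_kern[THEN subsetD])
qed

context good_voting
begin

text \<open>Below the bias at which deterministic growth takes over, the capped exponential of
  the scaled bias decreases in expectation by a constant factor: for a large scaled bias because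
  the bias grows by a constant factor, for a small one because it jumps with constant probability.\<close>

definition potential :: "real \<Rightarrow> nat set \<Rightarrow> real" where
  "potential h A = min 1 (exp (h - scaled A))"

lemma potential_drift:
  assumes A: "A \<subseteq> {..<n}" and x: "\<bar>1 - 2 * mass E A\<bar> \<le> 1 / 4"
    and b: "b \<ge> 0" "sqrt n \<le> b * r ^ 32" and n\<theta>: "(80 * tilt k L Q \<eta> b)\<^sup>2 \<le> n"
  shows "measure_pmf.expectation (kern k n E A) (potential (pot_offset k L Q b))
    \<le> pot_rate k L Q \<eta> b * potential (pot_offset k L Q b) A"
proof -
  define h \<theta> \<rho> where "h = pot_offset k L Q b" and "\<theta> = tilt k L Q \<eta> b" and "\<rho> = pot_rate k L Q \<eta> b"
  let ?K = "kern k n E A" and ?\<Phi> = "potential h"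
  note int = integrable_measure_pmf_finite[OF finite_set_kern]
  have v: "var_const k \<eta> > 0" using eta by (simp add: var_const_def)
  have h: "c1 * h = 2 * L' * b + 81" "h > 0"
    using growth_rate_pos(1) L0 b(1) by (auto simp: h_def pot_offset_def add_nonneg_pos)
  have e: "exp (- 1 :: real) \<le> 1 / 2" using exp_1_ge_2 by (simp add: exp_minus field_simps)
  have "measure_pmf.expectation ?K ?\<Phi> \<le> \<rho> * ?\<Phi> A"
  proof (cases "scaled A \<le> h")
    case True
    hence \<Phi>A: "?\<Phi> A = 1" by (simp add: potential_def)
    have jump: "measure_pmf.prob ?K {B. scaled B \<ge> h + 1} \<ge> exp (- 320 * \<theta>\<^sup>2) / 4"
    proof -
      have "\<theta> \<ge> 1" by (simp add: \<theta>_def tilt_def)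
      moreover have "h + 1 \<le> \<theta> * var_const k \<eta> / 5 - 1"
      proof -
        have "5 * (h + 2) / var_const k \<eta> \<le> \<theta>" by (simp add: \<theta>_def tilt_def h_def)
        thus ?thesis using v by (simp add: field_simps)
      qed
      hence "measure_pmf.prob ?K {B. scaled B \<ge> \<theta> * var_const k \<eta> / 5 - 1} \<le> measure_pmf.prob ?K {B. scaled B \<ge> h + 1}"
        by (intro prob_mono_support) auto
      ultimately show ?thesis using scaled_jump[OF A x, of \<theta>] n\<theta> by (simp add: \<theta>_def)
    qed
    have "measure_pmf.expectation ?K ?\<Phi> \<le> measure_pmf.expectation ?K (\<lambda>B. 1 - indicat_real {B. scaled B \<ge> h + 1} B / 2)"
    proof (rule expectation_mono_pmf[OF finite_set_kern])
      fix B
      show "?\<Phi> B \<le> 1 - indicat_real {B. scaled B \<ge> h + 1} B / 2"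
      proof (cases "scaled B \<ge> h + 1")
        case True
        hence "exp (h - scaled B) \<le> exp (- 1)" by simp
        hence "exp (h - scaled B) \<le> 1 / 2" using e by (rule order_trans)
        thus ?thesis using True by (simp add: potential_def min_le_iff_disj)
      qed (simp add: potential_def)
    qed
    also have "\<dots> = 1 - measure_pmf.prob ?K {B. scaled B \<ge> h + 1} / 2" by (simp add: int)
    also have "\<dots> \<le> \<rho>" using jump by (simp add: \<rho>_def pot_rate_def \<theta>_def)
    finally show ?thesis by (simp add: \<Phi>A)
  next
    case False
    hence \<Phi>A: "?\<Phi> A = exp (h - scaled A)" by (simp add: potential_def)
    have "measure_pmf.expectation ?K ?\<Phi> \<le> measure_pmf.expectation ?K (\<lambda>B. exp h * exp (- scaled B))"
      by (rule expectation_mono_pmf[OF finite_set_kern]) (simp add: potential_def flip: exp_add)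
    also have "\<dots> = exp h * measure_pmf.expectation ?K (\<lambda>B. exp (- scaled B))" by simp
    also have "\<dots> \<le> exp h * exp (80 - sqrt n * \<bar>1 - 2 * mean_mass A\<bar>)"
      by (intro mult_left_mono scaled_exp_moment) simp
    also have "\<dots> = exp (h + (80 - sqrt n * \<bar>1 - 2 * mean_mass A\<bar>))" by (rule exp_add[symmetric])
    \<comment> \<open>Here \<open>scaled A\<close> exceeds h, so its growth by c1 h = 2 L' b + 81
      outweighs the error and the 80 and leaves 1.\<close>
    also have "\<dots> \<le> exp (h - scaled A - 1)"
    proof -
      have "sqrt n * ((1 + c1) * \<bar>1 - 2 * mass E A\<bar> - 2 * L' / r ^ 32) \<le> sqrt n * \<bar>1 - 2 * mean_mass A\<bar>"
        by (intro mult_left_mono abs_mean_bias_growth A) (use x in auto)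
      moreover have "sqrt n * ((1 + c1) * \<bar>1 - 2 * mass E A\<bar> - 2 * L' / r ^ 32) = scaled A + c1 * scaled A - 2 * L' * (sqrt n / r ^ 32)"
        by (simp add: scaled_def algebra_simps)
      moreover have "2 * L' * (sqrt n / r ^ 32) \<le> 2 * L' * b"
        using b(2) r_pos(2)[of 32] L0 by (intro mult_left_mono) (auto simp: pos_divide_le_eq)
      moreover have "c1 * h \<le> c1 * scaled A" using False growth_rate_pos(1) by (intro mult_left_mono) auto
      ultimately show ?thesis using h(1) by simp
    qed
    also have "\<dots> = exp (- 1) * ?\<Phi> A" unfolding \<Phi>A by (simp flip: exp_add)
    also have "\<dots> \<le> \<rho> * ?\<Phi> A"
      using e pot_rate_bounds(1)[of k L Q \<eta> b] by (intro mult_right_mono) (auto simp: \<rho>_def potential_def)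
    finally show ?thesis .
  qed
  thus ?thesis by (simp add: h_def \<rho>_def)
qed

lemma log_consensus:
  assumes A: "A \<subseteq> {..<n}"
    and b: "b \<ge> 0" "sqrt n \<le> b * r ^ 32" "b \<le> sqrt (ln n)" and C: "bias_const k L Q \<le> sqrt (ln n)"
    and n\<theta>: "(80 * tilt k L Q \<eta> b)\<^sup>2 \<le> n"
  shows "\<exists>t::nat. t \<le> (3 * time_const k Q + 2 / ln (1 / pot_rate k L Q \<eta> b) + 1) * ln n \<and>
    cons_prob k n E t A \<ge> 1 - 2 * real n powr (- 1 / 2)"
proof -
  define M where "M = bias_const k L Q * max (1 / r ^ 32) (sqrt (ln n / n))"
  define h \<rho> where "h = pot_offset k L Q b" and "\<rho> = pot_rate k L Q \<eta> b"
  define s t where "s = nat \<lfloor>3 * time_const k Q * ln n\<rfloor>" and "t = nat \<lceil>2 / ln (1 / \<rho>) * ln n\<rceil>"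
  have h0: "h > 0" using growth_rate_pos(1) L0 b(1) by (simp add: h_def pot_offset_def add_nonneg_pos)
  have \<rho>: "7 / 8 \<le> \<rho>" "\<rho> < 1" unfolding \<rho>_def by (rule pot_rate_bounds)+
  have l\<rho>: "ln (1 / \<rho>) > 0" using \<rho> by (intro ln_gt_zero) auto
  have lnn: "ln n > 0" using n_large(2) by simp
  have sn: "sqrt n > 0" using n_pos by simp
  \<comment> \<open>On dense graphs 1 / D is at most b / sqrt n, so for b \<le> sqrt (ln n) the
    threshold is governed by the noise term.\<close>
  have max_eq: "max (1 / r ^ 32) (sqrt (ln n / n)) = sqrt (ln n / n)"
  proof -
    have "1 / r ^ 32 \<le> b / sqrt n" using b(2) sn r_pos(2)[of 32] by (simp add: field_simps)
    also have "\<dots> \<le> sqrt (ln n) / sqrt n" using b(3) sn by (intro divide_right_mono) auto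
    finally show ?thesis by (simp add: real_sqrt_divide max_absorb2)
  qed
  have sM: "sqrt n * M = bias_const k L Q * sqrt (ln n)" using sn unfolding M_def max_eq by (simp add: real_sqrt_divide)
  have M4: "M \<le> 1 / 4"
  proof -
    have "sqrt (ln n / n) \<le> noise_level / 20" by (simp add: noise_level_def)
    also have "\<dots> \<le> (1 / r ^ 13) / 20" using noise_le by simp
    also have "1 / r ^ 13 \<le> 1 / r ^ 1" using r16 r_pos by (intro divide_left_mono power_increasing mult_pos_pos) auto
    finally have "sqrt (ln n / n) \<le> 1 / r / 20" by simp
    hence "M \<le> r / 2 * (1 / r / 20)" unfolding M_def max_eq using bias_const_ge lnn r_pos by (intro mult_mono) auto
    thus ?thesis using r_pos by simp
  qed
  define G where "G = {B. \<bar>bias E B\<bar> \<ge> M}"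
  have bias_eq: "\<bar>bias E B\<bar> = \<bar>1 - 2 * mass E B\<bar>" for B by (simp add: bias_mass abs_minus_commute)
  have inG: "cons_prob k n E (s + j) B \<ge> 1 - real n powr (- 1 / 2)" if B: "B \<subseteq> {..<n}" "B \<in> G" for B j
  proof -
    have "\<bar>bias E B\<bar> \<ge> bias_const k L Q * max (1 / r ^ 32) (sqrt (ln n / n))" using B by (simp add: G_def M_def)
    from consensus_time[OF B(1) this] obtain u :: nat
      where u: "u \<le> time_const k Q * (ln (ln n) + ln (inverse \<bar>bias E B\<bar>) + ln n / ln (r ^ 32))"
        "cons_prob k n E u B \<ge> 1 - real n powr (- 1 / 2)" by blast
    have K: "time_const k Q \<ge> 0" using growth_rate_pos(1) by (simp add: time_const_def)
    have "ln (inverse \<bar>bias E B\<bar>) \<le> ln n"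
    proof -
      have "1 / n \<le> 1 / r ^ 32" using rn r_pos(2)[of 32] n_pos by (intro divide_left_mono mult_pos_pos) auto
      also have "\<dots> \<le> max (1 / r ^ 32) (sqrt (ln n / n))" by simp
      also have "\<dots> \<le> M" unfolding M_def using bias_const_ge(1) r_pos(2)[of 32]
        by (intro mult_le_cancel_right1[THEN iffD2]) (auto simp: le_max_iff_disj)
      also have "M \<le> \<bar>bias E B\<bar>" using B by (simp add: G_def)
      finally have m: "1 / n \<le> \<bar>bias E B\<bar>" .
      moreover have "0 < 1 / real n" using n_pos by simp
      ultimately have p: "0 < \<bar>bias E B\<bar>" by linarith
      have "inverse \<bar>bias E B\<bar> \<le> inverse (1 / n)" using m n_pos by (intro le_imp_inverse_le) auto
      thus ?thesis using p by (intro ln_mono) auto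
    qed
    moreover have "ln n / ln (r ^ 32) \<le> ln n"
    proof -
      have "ln 4 \<le> ln r" using r16 by (intro ln_mono) auto
      hence "1 \<le> ln r" using ln_4_ge_1 by linarith
      hence "1 \<le> ln (r ^ 32)" using r_pos by (simp add: ln_realpow)
      hence "ln n / ln (r ^ 32) \<le> ln n / 1" using lnn by (intro divide_left_mono) auto
      thus ?thesis by simp
    qed
    ultimately have "ln (ln n) + ln (inverse \<bar>bias E B\<bar>) + ln n / ln (r ^ 32) \<le> 3 * ln n" using n_large(4) by linarith
    hence "real u \<le> time_const k Q * (3 * ln n)" using u(1) K by (meson mult_left_mono order_trans)
    hence "u \<le> s" unfolding s_def by (simp add: le_nat_floor mult_ac)
    hence "cons_prob k n E u B \<le> cons_prob k n E (s + j) B" by (intro cons_prob_mono B) simp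
    thus ?thesis using u(2) by linarith
  qed
  have total: "real (s + t) \<le> (3 * time_const k Q + 2 / ln (1 / \<rho>) + 1) * ln n"
  proof -
    have "0 \<le> 3 * time_const k Q * ln n" "0 \<le> 2 / ln (1 / \<rho>) * ln n"
      using growth_rate_pos(1) lnn l\<rho> by (auto simp: time_const_def)
    hence "real s \<le> 3 * time_const k Q * ln n" "real t \<le> 2 / ln (1 / \<rho>) * ln n + 1"
      unfolding s_def t_def by linarith+
    thus ?thesis using n_large(2) by (simp add: distrib_right)
  qed
  have "cons_prob k n E (s + t) A \<ge> 1 - 2 * real n powr (- 1 / 2)"
  proof (cases "A \<in> G")
    case True
    have "0 \<le> real n powr (- 1 / 2)" by simp
    thus ?thesis using inG[OF A True, of t] by linarith
  next
    case False
    \<comment> \<open>Outside \<open>G\<close> the scaled bias is at most C sqrt (ln n) \<le> ln n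
      with C = \<open>bias_const\<close>, so the potential is at least 1 / n, while t rounds
      multiply it by at most n^(-2).\<close>
    define \<phi> where "\<phi> = exp (- ln n)"
    have "cons_prob k n E (s + t) A \<ge> 1 - (real n powr (- 1 / 2) + \<rho> ^ t * potential h A / \<phi>)"
    proof (rule cons_prob_potential[where G = G])
      fix B assume B: "B \<subseteq> {..<n}" "B \<notin> G"
      hence x: "\<bar>1 - 2 * mass E B\<bar> < M" by (simp add: G_def bias_eq)
      have "measure_pmf.expectation (kern k n E B) (\<lambda>B. if B \<in> G then 0 else potential h B) \<le> measure_pmf.expectation (kern k n E B) (potential h)"
        by (rule expectation_mono_pmf[OF finite_set_kern]) (simp add: potential_def)
      also have "\<dots> \<le> \<rho> * potential h B"
        unfolding h_def \<rho>_def by (rule potential_drift[OF B(1) _ b(1,2) n\<theta>]) (use x M4 in linarith)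
      finally show "measure_pmf.expectation (kern k n E B) (\<lambda>B. if B \<in> G then 0 else potential h B) \<le> \<rho> * potential h B" .
      have "scaled B \<le> sqrt n * M" unfolding scaled_def using x by (intro mult_left_mono) auto
      also have "\<dots> \<le> sqrt (ln n) * sqrt (ln n)" unfolding sM using C lnn by (intro mult_right_mono) auto
      also have "\<dots> = ln n" using lnn by simp
      finally have "exp (- ln n) \<le> exp (h - scaled B)" using h0 by simp
      moreover have "exp (- ln n) \<le> 1" using lnn by simp
      ultimately show "\<phi> \<le> potential h B" by (simp add: potential_def \<phi>_def)
    qed (use inG \<rho> A False in \<open>auto simp: \<phi>_def\<close>)
    moreover have "\<rho> ^ t * potential h A / \<phi> \<le> real n powr (- 1 / 2)"
    proof -
      have "\<rho> ^ t = exp (- (t * ln (1 / \<rho>)))" using \<rho> by (simp add: ln_div exp_of_nat_mult)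
      also have "\<dots> \<le> exp (- (2 * ln n))"
      proof -
        have "2 / ln (1 / \<rho>) * ln n \<le> t" unfolding t_def by linarith
        hence "2 * ln n \<le> t * ln (1 / \<rho>)" using l\<rho> by (simp add: field_simps)
        thus ?thesis by simp
      qed
      finally have "\<rho> ^ t * potential h A \<le> exp (- (2 * ln n)) * 1" using \<rho> by (intro mult_mono) (auto simp: potential_def)
      hence "\<rho> ^ t * potential h A / \<phi> \<le> exp (- (2 * ln n)) / \<phi>" by (intro divide_right_mono) (auto simp: \<phi>_def)
      also have "\<dots> = exp (- ln n)" by (simp add: \<phi>_def flip: exp_diff)
      also have "\<dots> \<le> exp (- 1 / 2 * ln n)" using lnn by simp
      also have "\<dots> = real n powr (- 1 / 2)" using n_pos by (simp add: powr_def)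
      finally show ?thesis .
    qed
    ultimately show ?thesis by linarith
  qed
  thus ?thesis using total unfolding \<rho>_def by blast
qed

section \<open>The lower bound on the consensus time\<close>

lemma balanced_start: "\<exists>A\<subseteq>{..<n}. \<bar>1 - 2 * mass E A\<bar> \<le> 40 / n"
proof -
  \<comment> \<open>Vertices are added one at a time until the mass crosses 1/2; a single vertex has
    mass at most 20 / n.\<close>
  define j where "j = (LEAST j. mass E {..<j} \<ge> 1 / 2)"
  have n1: "mass E {..<n} \<ge> 1 / 2" using sum_stat by (simp add: mass_def)
  hence j: "mass E {..<j} \<ge> 1 / 2" "j \<le> n" unfolding j_def by (auto intro: LeastI Least_le)
  have "j \<noteq> 0" using j(1) by (intro notI) (simp add: mass_def)
  then obtain i where i: "j = Suc i" by (cases j) auto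
  have "\<not> mass E {..<i} \<ge> 1 / 2" using not_less_Least[of i "\<lambda>j. mass E {..<j} \<ge> 1 / 2"] i by (simp add: j_def)
  moreover have "mass E {..<j} = mass E {..<i} + stat E i" by (simp add: i mass_def)
  moreover have "stat E i \<le> 20 / n" using stat_bounds(2)[of i] i j(2) by simp
  ultimately have "\<bar>1 - 2 * mass E {..<j}\<bar> \<le> 40 / n" using j(1) by (simp add: abs_le_iff)
  thus ?thesis using j(2) by (intro exI[of _ "{..<j}"]) auto
qed

text \<open>One round maps a bias d to at most (Q + 1) d + \<tau> with \<tau> = 4 / r^13, which
  collects noise and graph error. Hence a start below \<tau> stays below (Q + 2)^i \<tau>, whereas
  consensus has bias 1.\<close>

lemma slow_consensus:
  assumes t: "(Q + 2) ^ t * (4 / r ^ 13) < 1" "t \<le> n"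
  shows "\<exists>A\<subseteq>{..<n}. \<forall>b\<le>real t. prob_T_ge k n E A b \<ge> 1 - real n powr (- 1)"
proof -
  define \<tau> where "\<tau> = 4 / r ^ 13"
  have \<tau>0: "\<tau> > 0" using r_pos by (simp add: \<tau>_def)
  obtain A where A: "A \<subseteq> {..<n}" "\<bar>1 - 2 * mass E A\<bar> \<le> 40 / n" using balanced_start by blast
  have A\<tau>: "\<bar>1 - 2 * mass E A\<bar> \<le> \<tau>"
  proof -
    have "10 * r ^ 13 \<le> r * r ^ 13" using r16 by (intro mult_right_mono) auto
    also have "\<dots> = r ^ 14" by (simp flip: power_Suc)
    also have "\<dots> \<le> r ^ 32" using r16 by (intro power_increasing) auto
    finally have "10 * r ^ 13 \<le> n" using rn by simp
    hence "40 / n \<le> \<tau>" unfolding \<tau>_def using r_pos(2)[of 13] n_pos by (simp add: field_simps)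
    thus ?thesis using A by simp
  qed
  define G where "G = (\<lambda>i::nat. {B. \<bar>1 - 2 * mass E B\<bar> \<le> (Q + 2) ^ i * \<tau>})"
  have ph: "measure_pmf.prob (chain k n E s A) (G s) \<ge> 1 - s * (2 * real n powr (- 5)) \<and> set_pmf (chain k n E s A) \<subseteq> Pow {..<n}" for s
  proof (rule pmf_chain_phases)
    fix i B assume B: "B \<subseteq> {..<n}" "B \<in> G i"
    let ?d = "\<bar>1 - 2 * mass E B\<bar>"
    let ?S = "{C. mass E C < mean_mass B + noise_level}" and ?T = "{C. mass E C > mean_mass B - noise_level}"
    have "measure_pmf.prob (kern k n E B) {C. \<not> (C \<in> ?S \<and> C \<in> ?T)} \<le> measure_pmf.prob (kern k n E B) ({C. \<not> C \<in> ?S} \<union> {C. \<not> C \<in> ?T})"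
      by (rule prob_mono_support) auto
    also have "\<dots> \<le> measure_pmf.prob (kern k n E B) {C. \<not> C \<in> ?S} + measure_pmf.prob (kern k n E B) {C. \<not> C \<in> ?T}"
      by (rule prob_Un_le)
    also have "\<dots> \<le> 2 * real n powr (- 5)"
      using kern_mass_upper[of B] kern_mass_lower[of B] unfolding prob_not by simp
    finally have "measure_pmf.prob (kern k n E B) {C. C \<in> ?S \<and> C \<in> ?T} \<ge> 1 - 2 * real n powr (- 5)"
      unfolding prob_not by linarith
    thus "measure_pmf.prob (kern k n E B) (G (Suc i)) \<ge> 1 - 2 * real n powr (- 5)"
    proof (rule prob_kern_ge)
      fix C assume "C \<in> {C. C \<in> ?S \<and> C \<in> ?T}"
      hence C: "\<bar>mass E C - mean_mass B\<bar> \<le> noise_level" by (simp add: abs_le_iff)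
      have F: "\<bar>1 - 2 * mean_map k (mass E B)\<bar> \<le> Q * ?d"
        using Q mass_range[OF B(1)] by (simp add: quad_bound_def)
      have small: "(L' + 1) / r ^ m \<le> 1 / 2" if "m \<ge> 1" for m
      proof -
        have "1 / (8 * Q) \<le> 1 / 8" using Q1 by simp
        thus ?thesis using error_small[OF that] growth_rate_pos(2) by linarith
      qed
      have L16: "2 * L' / r ^ 16 \<le> 1"
      proof -
        have "L' / r ^ 16 \<le> (L' + 1) / r ^ 16" using r_pos by (intro divide_right_mono) auto
        moreover have "2 * L' / r ^ 16 = 2 * (L' / r ^ 16)" by (rule times_divide_eq_right[symmetric])
        ultimately show ?thesis using small[of 16] by linarith
      qed
      have L32: "2 * L' / r ^ 32 \<le> 1 / r ^ 13"
      proof -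
        have "L' / r ^ 19 \<le> (L' + 1) / r ^ 19" using r_pos by (intro divide_right_mono) auto
        moreover have "2 * L' / r ^ 19 = 2 * (L' / r ^ 19)" by (rule times_divide_eq_right[symmetric])
        ultimately have "2 * L' / r ^ 19 \<le> 1" using small[of 19] by linarith
        hence "2 * L' / r ^ 19 / r ^ 13 \<le> 1 / r ^ 13" using r_pos by (intro divide_right_mono) auto
        thus ?thesis by (simp flip: power_add)
      qed
      have "\<bar>1 - 2 * mass E C\<bar> \<le> 2 * \<bar>mass E C - mean_mass B\<bar> + 2 * \<bar>mean_mass B - mean_map k (mass E B)\<bar> + \<bar>1 - 2 * mean_map k (mass E B)\<bar>"
      proof -
        have "\<bar>1 - 2 * c\<bar> \<le> 2 * \<bar>c - m\<bar> + 2 * \<bar>m - f\<bar> + \<bar>1 - 2 * f\<bar>" for c m f :: real by (auto simp: abs_if)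
        thus ?thesis .
      qed
      also have "\<dots> \<le> 2 * noise_level + 2 * (L' / r ^ 32 + L' * ?d / r ^ 16) + Q * ?d"
        using C F mean_mass_approx[OF B(1)] by (intro add_mono mult_left_mono) auto
      also have "\<dots> = 2 * noise_level + 2 * L' / r ^ 32 + 2 * L' / r ^ 16 * ?d + Q * ?d" by (simp add: algebra_simps)
      also have "\<dots> \<le> 2 * (1 / r ^ 13) + 1 / r ^ 13 + 1 * ?d + Q * ?d"
        using noise_le L32 L16 by (intro add_mono mult_left_mono mult_right_mono) auto
      also have "\<dots> \<le> \<tau> + (Q + 1) * ?d" using r_pos(2)[of 13] by (simp add: \<tau>_def field_simps)
      also have "\<dots> \<le> (Q + 2) ^ i * \<tau> + (Q + 1) * ((Q + 2) ^ i * \<tau>)"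
      proof (intro add_mono mult_left_mono)
        have "1 * \<tau> \<le> (Q + 2) ^ i * \<tau>" using Q1 \<tau>0 by (intro mult_right_mono one_le_power) auto
        thus "\<tau> \<le> (Q + 2) ^ i * \<tau>" by simp
      qed (use B Q1 in \<open>auto simp: G_def\<close>)
      also have "\<dots> = (Q + 2) ^ Suc i * \<tau>" by (simp add: algebra_simps)
      finally show "C \<in> G (Suc i)" by (simp add: G_def)
    qed
  qed (use A A\<tau> in \<open>auto simp: G_def\<close>)
  have cons: "measure_pmf.prob (chain k n E s A) {{}, {..<n}} \<le> s * (2 * real n powr (- 5))" if s: "s < t" for s
  proof -
    have "measure_pmf.prob (chain k n E s A) {{}, {..<n}} \<le> measure_pmf.prob (chain k n E s A) {B. \<not> B \<in> G s}"
    proof (rule prob_mono_support)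
      fix B assume "B \<in> {{}, {..<n}}"
      hence "\<bar>1 - 2 * mass E B\<bar> = 1" using sum_stat by (auto simp: mass_def)
      moreover have "(Q + 2) ^ s * \<tau> \<le> (Q + 2) ^ t * \<tau>"
        using s Q1 \<tau>0 by (intro mult_right_mono power_increasing) auto
      ultimately show "B \<in> {B. \<not> B \<in> G s}" using t(1) by (simp add: G_def \<tau>_def)
    qed
    also have "\<dots> \<le> s * (2 * real n powr (- 5))" unfolding prob_not using ph[of s] by simp
    finally show ?thesis .
  qed
  have "(\<Sum>s<t. measure_pmf.prob (chain k n E s A) {{}, {..<n}}) \<le> (\<Sum>s<t. real n * (2 * real n powr (- 5)))"
  proof (rule sum_mono)
    fix s assume s: "s \<in> {..<t}"
    have "s * (2 * real n powr (- 5)) \<le> real n * (2 * real n powr (- 5))" using s t(2) by (intro mult_right_mono) auto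
    thus "measure_pmf.prob (chain k n E s A) {{}, {..<n}} \<le> real n * (2 * real n powr (- 5))" using cons[of s] s by simp
  qed
  also have "\<dots> \<le> real n * (real n * (2 * real n powr (- 5)))" using t(2) by (simp add: mult_right_mono)
  also have "\<dots> = 2 * (real n powr 2 * real n powr (- 5))" using n_pos by (simp add: powr_numeral power2_eq_square)
  also have "\<dots> = 2 * real n powr (- 3)" using powr_add[of "real n" 2 "- 5"] by simp
  also have "\<dots> \<le> real n powr 1 * real n powr (- 3)" using n_pos by (intro mult_right_mono) auto
  also have "\<dots> = real n powr (- 2)" using powr_add[of "real n" 1 "- 3"] by simp
  also have "\<dots> \<le> real n powr (- 1)" using n_pos by (intro powr_mono) auto
  finally have S: "(\<Sum>s<t. measure_pmf.prob (chain k n E s A) {{}, {..<n}}) \<le> real n powr (- 1)" .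
  have "prob_T_ge k n E A b \<ge> 1 - real n powr (- 1)" if "b \<le> real t" for b
    using prob_T_ge_ge[OF nonisolated that, of k A] S by linarith
  thus ?thesis using A(1) by blast
qed

end

section \<open>Asymptotics\<close>

lemma eventually_good_voting:
  assumes k: "k \<ge> 2" and L: "smooth_bound k L" and Q: "quad_bound k Q" and \<eta>: "0 < \<eta>" "\<eta> \<le> 1"
    and p: "\<And>n. 0 \<le> p n \<and> p n \<le> 1" and top: "filterlim (\<lambda>n. real n * p n) at_top sequentially"
  shows "\<forall>\<^sub>F n in sequentially. root 32 (real n * p n) \<ge> 16 \<and> (root 32 (real n * p n)) ^ 32 = real n * p n \<and>
    (\<forall>E. good_graph \<eta> n (root 32 (real n * p n)) E \<longrightarrow> good_voting k n L Q (root 32 (real n * p n)) \<eta> E)"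
proof -
  have Q1: "Q \<ge> 1" using Q by (simp add: quad_bound_def)
  have g: "growth_rate k Q > 0" using Q1 by (simp add: growth_rate_def)
  define R where "R = max 16 (max (320 * (16032 * L + 1) / growth_rate k Q) (22 * Q / \<eta>\<^sup>2))"
  have "\<forall>\<^sub>F n in sequentially. real n * p n \<ge> R ^ 32"
    using top unfolding filterlim_at_top by blast
  \<comment> \<open>The \<open>noise\<close> condition in the worst case n p = n, where r^13 =
    n^(13/32).\<close>
  moreover have "\<forall>\<^sub>F n in sequentially. 20 * sqrt (ln (real n) / real n) * (root 32 (real n)) ^ 13 \<le> 1"
  proof -
    have "\<forall>\<^sub>F n in sequentially. 20 * sqrt (ln (real n) / real n) * (real n powr (1 / 32)) ^ 13 \<le> 1" by real_asymp
    thus ?thesis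
    proof eventually_elim
      case (elim n)
      thus ?case by (cases "n = 0") (auto simp: root_powr_inverse)
    qed
  qed
  ultimately show ?thesis using eventually_gt_at_top[of 0]
  proof eventually_elim
    case (elim n)
    let ?r = "root 32 (real n * p n)"
    have np: "0 \<le> real n * p n" using p[of n] by simp
    have r32: "?r ^ 32 = real n * p n" using np by simp
    have "R \<ge> 16" by (simp add: R_def)
    hence "R = root 32 (R ^ 32)" by (simp add: real_root_power_cancel)
    also have "\<dots> \<le> ?r" using elim(1) by simp
    finally have R: "R \<le> ?r" .
    have "real n * p n \<le> real n * 1" using p[of n] by (intro mult_left_mono) auto
    hence rn: "?r ^ 32 \<le> real n" unfolding r32 by simp
    have "?r \<le> root 32 (real n)" using \<open>real n * p n \<le> real n * 1\<close> by simp
    moreover have "0 \<le> ?r" using np by simp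
    ultimately have "?r ^ 13 \<le> (root 32 (real n)) ^ 13" by (intro power_mono)
    hence "20 * sqrt (ln (real n) / real n) * ?r ^ 13 \<le> 20 * sqrt (ln (real n) / real n) * (root 32 (real n)) ^ 13"
      using elim(3) by (intro mult_left_mono) auto
    hence noise: "20 * sqrt (ln (real n) / real n) * ?r ^ 13 \<le> 1" using elim(2) by linarith
    have "320 * (16032 * L + 1) / growth_rate k Q \<le> ?r" "22 * Q / \<eta>\<^sup>2 \<le> ?r" "16 \<le> ?r" using R by (auto simp: R_def)
    hence "320 * (16032 * L + 1) \<le> ?r * growth_rate k Q" "22 * Q \<le> ?r * \<eta>\<^sup>2" "16 \<le> ?r"
      using g \<eta> by (auto simp: pos_divide_le_eq)
    thus ?case using k L Q \<eta> rn noise r32 by (auto intro!: good_voting.intro)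
  qed
qed

lemma gnp_prob_mono:
  assumes "measure_pmf.prob (gnp n p) {E. P E} \<ge> b" "\<And>E. P E \<Longrightarrow> R E"
  shows "measure_pmf.prob (gnp n p) {E. R E} \<ge> b"
proof -
  have "measure_pmf.prob (gnp n p) {E. P E} \<le> measure_pmf.prob (gnp n p) {E. R E}"
    by (rule prob_mono_support) (use assms(2) in auto)
  thus ?thesis using assms(1) by linarith
qed

lemma np_at_top:
  assumes "\<epsilon> > (0::real)" "\<forall>\<^sub>F n in sequentially. p n \<ge> (1 + \<epsilon>) * ln (real n) / real n"
  shows "\<forall>\<^sub>F n in sequentially. real n * p n \<ge> (1 + \<epsilon>) * ln (real n)"
    and "filterlim (\<lambda>n. real n * p n) at_top sequentially"
proof -
  show *: "\<forall>\<^sub>F n in sequentially. real n * p n \<ge> (1 + \<epsilon>) * ln (real n)"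
    using assms(2) eventually_gt_at_top[of 0] by eventually_elim (simp add: field_simps)
  have "filterlim (\<lambda>n. (1 + \<epsilon>) * ln (real n)) at_top sequentially"
    using assms(1) by real_asymp
  thus "filterlim (\<lambda>n. real n * p n) at_top sequentially"
    by (rule filterlim_at_top_mono) (use * in simp)
qed

lemma consensus_time_from_bias:
  assumes k: "k \<ge> 2" and L: "smooth_bound k L" and Q: "quad_bound k Q"
    and p: "\<And>n. 0 \<le> p n \<and> p n \<le> 1"
    and \<epsilon>: "\<epsilon> > (0::real)" "\<forall>\<^sub>F n in sequentially. p n \<ge> (1 + \<epsilon>) * ln (real n) / real n"
  shows "\<exists>K>0. \<exists>c1>0. \<exists>c>0. \<forall>\<^sub>F n in sequentially.
          measure_pmf.prob (gnp n (p n))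
            {E. \<forall>A \<subseteq> {..<n}.
                 \<bar>bias E A\<bar> \<ge> bias_const k L Q
                    * max (1 / (real n * p n)) (sqrt (ln (real n) / real n)) \<longrightarrow>
                 prob_T_le k n E A
                   (K * (ln (ln (real n)) + ln (inverse \<bar>bias E A\<bar>)
                         + ln (real n) / ln (real n * p n)))
                 \<ge> 1 - real n powr (- c1)}
          \<ge> 1 - real n powr (- c)"
proof -
  obtain \<eta> c N where \<eta>: "0 < \<eta>" "\<eta> \<le> 1" and c: "c > 0" and good:
    "\<And>n p r. n \<ge> N \<Longrightarrow> 0 \<le> p \<Longrightarrow> p \<le> 1 \<Longrightarrow> r \<ge> 16 \<Longrightarrow> real n * p = r ^ 32 \<Longrightarrow> real n * p \<ge> (1 + \<epsilon>) * ln n \<Longrightarrow>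
      measure_pmf.prob (gnp n p) {E. good_graph \<eta> n r E} \<ge> 1 - real n powr (- c)"
    using gnp_good[OF \<epsilon>(1)] by metis
  have Q1: "Q \<ge> 1" using Q by (simp add: quad_bound_def)
  have K: "time_const k Q > 0" using Q1 by (auto simp: time_const_def growth_rate_def intro!: add_nonneg_pos)
  note top = np_at_top[OF \<epsilon>]
  have "\<forall>\<^sub>F n in sequentially.
          measure_pmf.prob (gnp n (p n))
            {E. \<forall>A \<subseteq> {..<n}.
                 \<bar>bias E A\<bar> \<ge> bias_const k L Q
                    * max (1 / (real n * p n)) (sqrt (ln (real n) / real n)) \<longrightarrow>
                 prob_T_le k n E A
                   (time_const k Q * (ln (ln (real n)) + ln (inverse \<bar>bias E A\<bar>)
                         + ln (real n) / ln (real n * p n)))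
                 \<ge> 1 - real n powr (- (1 / 2))}
          \<ge> 1 - real n powr (- c)"
    using eventually_good_voting[OF k L Q \<eta> p top(2)] top(1) eventually_ge_at_top[of N]
  proof eventually_elim
    case (elim n)
    let ?r = "root 32 (real n * p n)"
    have "measure_pmf.prob (gnp n (p n)) {E. good_graph \<eta> n ?r E} \<ge> 1 - real n powr (- c)"
      using good[of n "p n" ?r] elim p[of n] by simp
    thus ?case
    proof (rule gnp_prob_mono, intro allI impI)
      fix E A assume gg: "good_graph \<eta> n ?r E" and A: "A \<subseteq> {..<n}"
        and b: "\<bar>bias E A\<bar> \<ge> bias_const k L Q * max (1 / (real n * p n)) (sqrt (ln (real n) / real n))"
      interpret good_voting k n L Q ?r \<eta> E using elim gg by blast
      have r32: "?r ^ 32 = real n * p n" using elim by blast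
      obtain t :: nat where t: "t \<le> time_const k Q * (ln (ln n) + ln (inverse \<bar>bias E A\<bar>) + ln n / ln (?r ^ 32))"
        "cons_prob k n E t A \<ge> 1 - real n powr (- 1 / 2)"
        using consensus_time[OF A] b unfolding r32 by blast
      show "prob_T_le k n E A (time_const k Q * (ln (ln (real n)) + ln (inverse \<bar>bias E A\<bar>)
                         + ln (real n) / ln (real n * p n))) \<ge> 1 - real n powr (- (1 / 2))"
        using prob_T_le_ge[OF nonisolated t(1), of k A] t(2) unfolding r32 cons_prob_def by simp
    qed
  qed
  thus ?thesis using K c by (intro exI[of _ "time_const k Q"] exI[of _ "1 / 2"] exI[of _ c] conjI) auto
qed

lemma consensus_time_logarithmic:
  assumes k: "k \<ge> 2" and p: "\<And>n. 0 \<le> p n \<and> p n \<le> 1" and \<Omega>: "p \<in> \<Omega>(\<lambda>n. real n powr (- 1 / 2))"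
  shows "\<exists>K1>0. \<exists>K2>0. \<exists>c1>0. \<exists>c2>0. \<exists>c>0. \<forall>\<^sub>F n in sequentially.
          measure_pmf.prob (gnp n (p n))
            {E. (\<forall>A \<subseteq> {..<n}.
                   prob_T_le k n E A (K1 * ln (real n)) \<ge> 1 - real n powr (- c1)) \<and>
                (\<exists>A \<subseteq> {..<n}.
                   prob_T_ge k n E A (K2 * ln (real n)) \<ge> 1 - real n powr (- c2))}
          \<ge> 1 - real n powr (- c)"
proof -
  obtain L where L: "smooth_bound k L" using smooth_bound_exists by blast
  obtain Q where Q: "quad_bound k Q" using quad_bound_exists[OF k] by blast
  have Q1: "Q \<ge> 1" using Q by (simp add: quad_bound_def)
  obtain \<eta> c N where \<eta>: "0 < \<eta>" "\<eta> \<le> 1" and c: "c > 0" and good: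
    "\<And>n p r. n \<ge> N \<Longrightarrow> 0 \<le> p \<Longrightarrow> p \<le> 1 \<Longrightarrow> r \<ge> 16 \<Longrightarrow> real n * p = r ^ 32 \<Longrightarrow> real n * p \<ge> (1 + 1) * ln n \<Longrightarrow>
      measure_pmf.prob (gnp n p) {E. good_graph \<eta> n r E} \<ge> 1 - real n powr (- c)"
    using gnp_good[of 1] by (metis zero_less_one)
  obtain a where a: "a > 0" and ev: "\<forall>\<^sub>F n in sequentially. norm (p n) \<ge> a * norm (real n powr (- 1 / 2))"
    using \<Omega> by (elim landau_omega.bigE)
  have big: "\<forall>\<^sub>F n in sequentially. real n * p n \<ge> a * sqrt n"
    using ev eventually_gt_at_top[of 0]
  proof eventually_elim
    case (elim n)
    have "a * real n powr (- 1 / 2) \<le> p n" using elim p[of n] by simp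
    hence "real n * (a * real n powr (- 1 / 2)) \<le> real n * p n" by (intro mult_left_mono) auto
    moreover have "real n * real n powr (- 1 / 2) = sqrt n"
      using powr_add[of "real n" 1 "- 1 / 2"] elim by (simp add: powr_half_sqrt)
    ultimately show ?case by (simp add: mult.left_commute)
  qed
  \<comment> \<open>The dense regime lies far above the connectivity threshold, so \<epsilon> = 1
    serves and \<eta> is absolute.\<close>
  have "\<forall>\<^sub>F n in sequentially. (1 + 1) * ln (real n) \<le> a * sqrt n" using a by real_asymp
  hence "\<forall>\<^sub>F n in sequentially. p n \<ge> (1 + 1) * ln (real n) / real n"
    using big eventually_gt_at_top[of 0] by eventually_elim (simp add: field_simps)
  note top = np_at_top[of 1, OF zero_less_one this]
  define b where "b = 1 / a"
  have b0: "b \<ge> 0" using a by (simp add: b_def)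
  define K1 where "K1 = 3 * time_const k Q + 2 / ln (1 / pot_rate k L Q \<eta> b) + 1"
  have "ln (1 / pot_rate k L Q \<eta> b) > 0"
    using pot_rate_bounds[of k L Q \<eta> b] by (intro ln_gt_zero) auto
  hence K1: "K1 > 0" using Q1 by (auto simp: K1_def time_const_def growth_rate_def intro!: add_nonneg_pos)
  \<comment> \<open>Makes (Q + 2)^t of order n^(1/10), whereas r^13 is at least of order n^(13/64),
    and 13/64 > 1/10.\<close>
  define K2 where "K2 = 1 / (10 * ln (Q + 2))"
  have lQ: "ln (Q + 2) > 0" using Q1 by simp
  hence K2: "K2 > 0" by (simp add: K2_def)
  have e1: "\<forall>\<^sub>F n in sequentially. max b (bias_const k L Q) \<le> sqrt (ln (real n))" by real_asymp
  have e2: "\<forall>\<^sub>F n in sequentially. (80 * tilt k L Q \<eta> b)\<^sup>2 \<le> real n" by real_asymp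
  have e3: "\<forall>\<^sub>F n in sequentially. 2 * real n powr (- 1 / 2) \<le> real n powr (- (1 / 4))" by real_asymp
  have e4: "\<forall>\<^sub>F n in sequentially. K2 * ln (real n) + 1 \<le> real n" by real_asymp
  have e5: "\<forall>\<^sub>F n in sequentially. (Q + 2) * real n powr (1 / 10) * 4 < ((a * sqrt (real n)) powr (1 / 32)) ^ 13"
    using a by real_asymp
  have "\<forall>\<^sub>F n in sequentially.
          measure_pmf.prob (gnp n (p n))
            {E. (\<forall>A \<subseteq> {..<n}.
                   prob_T_le k n E A (K1 * ln (real n)) \<ge> 1 - real n powr (- (1 / 4))) \<and>
                (\<exists>A \<subseteq> {..<n}.
                   prob_T_ge k n E A (K2 * ln (real n)) \<ge> 1 - real n powr (- 1))}
          \<ge> 1 - real n powr (- c)"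
    using eventually_good_voting[OF k L Q \<eta> p top(2)] top(1) big e1 e2 e3 e4 e5 eventually_ge_at_top[of "max N 1"]
  proof eventually_elim
    case (elim n)
    let ?r = "root 32 (real n * p n)"
    have r32: "?r ^ 32 = real n * p n" and r16: "?r \<ge> 16" using elim by blast+
    have n1: "n \<ge> 1" "n \<ge> N" using elim by auto
    have "measure_pmf.prob (gnp n (p n)) {E. good_graph \<eta> n ?r E} \<ge> 1 - real n powr (- c)"
      using good[of n "p n" ?r] elim(2) r32 r16 n1 p[of n] by simp
    thus ?case
    proof (rule gnp_prob_mono, intro conjI allI impI)
      fix E assume gg: "good_graph \<eta> n ?r E"
      interpret good_voting k n L Q ?r \<eta> E using elim(1) gg by blast
      {
        fix A assume A: "A \<subseteq> {..<n}"
        have "sqrt n \<le> b * ?r ^ 32" unfolding r32 b_def using elim(3) a by (simp add: field_simps)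
        hence "\<exists>t::nat. t \<le> K1 * ln n \<and> cons_prob k n E t A \<ge> 1 - 2 * real n powr (- 1 / 2)"
          unfolding K1_def using elim(4,5) by (intro log_consensus A b0) auto
        then obtain t :: nat where t: "t \<le> K1 * ln n" "cons_prob k n E t A \<ge> 1 - 2 * real n powr (- 1 / 2)" by blast
        show "prob_T_le k n E A (K1 * ln (real n)) \<ge> 1 - real n powr (- (1 / 4))"
          using prob_T_le_ge[OF nonisolated t(1), of k A] t(2) elim(6) unfolding cons_prob_def by linarith
      }
      define t where "t = nat \<lceil>K2 * ln (real n)\<rceil>"
      have "0 \<le> K2 * ln (real n)" using K2 n1 by simp
      hence t: "K2 * ln (real n) \<le> t" "t \<le> K2 * ln (real n) + 1" unfolding t_def by linarith+
      have "(Q + 2) ^ t = exp (t * ln (Q + 2))" using Q1 by (simp add: exp_of_nat_mult)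
      also have "\<dots> \<le> exp ((K2 * ln (real n) + 1) * ln (Q + 2))" using t lQ by simp
      also have "(K2 * ln (real n) + 1) * ln (Q + 2) = ln (Q + 2) + 1 / 10 * ln (real n)"
        using lQ by (simp add: K2_def field_simps)
      also have "exp \<dots> = (Q + 2) * real n powr (1 / 10)" using Q1 n1 by (simp add: exp_add powr_def)
      finally have "(Q + 2) ^ t * 4 \<le> (Q + 2) * real n powr (1 / 10) * 4" by simp
      also have "\<dots> < ((a * sqrt (real n)) powr (1 / 32)) ^ 13" by (rule elim(8))
      also have "\<dots> \<le> ?r ^ 13"
      proof (rule power_mono)
        have "root 32 (a * sqrt n) \<le> ?r" using elim(3) by simp
        moreover have "root 32 (a * sqrt n) = (a * sqrt n) powr (1 / 32)" using a n1 by (simp add: root_powr_inverse)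
        ultimately show "(a * sqrt n) powr (1 / 32) \<le> ?r" by simp
      qed simp
      finally have "(Q + 2) ^ t * (4 / ?r ^ 13) < 1" using r_pos(2)[of 13] by (simp add: field_simps)
      moreover have "t \<le> n" using t(2) elim(7) by linarith
      ultimately show "\<exists>A \<subseteq> {..<n}. prob_T_ge k n E A (K2 * ln (real n)) \<ge> 1 - real n powr (- 1)"
        using slow_consensus[of t] t(1) by blast
    qed
  qed
  thus ?thesis using K1 K2 c
    by (intro exI[of _ K1] exI[of _ K2] exI[of _ "1 / 4"] exI[of _ 1] exI[of _ c] conjI) auto
qed

theorem corollary1p8:
  "\<exists>C :: (real \<Rightarrow> real) \<Rightarrow> real. \<forall>k::nat. k \<ge> 2 \<longrightarrow> C (vote_fun k) > 0 \<and>
    (\<forall>p :: nat \<Rightarrow> real. (\<forall>n. 0 \<le> p n \<and> p n \<le> 1) \<longrightarrow>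
      (p \<in> \<Omega>(\<lambda>n. real n powr (- 1 / 2)) \<longrightarrow>
        (\<exists>K1>0. \<exists>K2>0. \<exists>c1>0. \<exists>c2>0. \<exists>c>0. \<forall>\<^sub>F n in sequentially.
          measure_pmf.prob (gnp n (p n))
            {E. (\<forall>A \<subseteq> {..<n}.
                   prob_T_le k n E A (K1 * ln (real n)) \<ge> 1 - real n powr (- c1)) \<and>
                (\<exists>A \<subseteq> {..<n}.
                   prob_T_ge k n E A (K2 * ln (real n)) \<ge> 1 - real n powr (- c2))}
          \<ge> 1 - real n powr (- c))) \<and>
      (\<forall>\<epsilon>>0. (\<forall>\<^sub>F n in sequentially. p n \<ge> (1 + \<epsilon>) * ln (real n) / real n) \<longrightarrow>
        (\<exists>K>0. \<exists>c1>0. \<exists>c>0. \<forall>\<^sub>F n in sequentially.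
          measure_pmf.prob (gnp n (p n))
            {E. \<forall>A \<subseteq> {..<n}.
                 \<bar>bias E A\<bar> \<ge> C (vote_fun k)
                    * max (1 / (real n * p n)) (sqrt (ln (real n) / real n)) \<longrightarrow>
                 prob_T_le k n E A
                   (K * (ln (ln (real n)) + ln (inverse \<bar>bias E A\<bar>)
                         + ln (real n) / ln (real n * p n)))
                 \<ge> 1 - real n powr (- c1)}
          \<ge> 1 - real n powr (- c))))"
proof -
  define cst where "cst = (\<lambda>k. bias_const k (SOME L. smooth_bound k L) (SOME Q. quad_bound k Q))"
  \<comment> \<open>The unique \<open>k\<close> with the given switching function is recovered by
    \<open>vote_fun_inj\<close>; thus the constant is a function of f chosen before the density and
    \<epsilon>.\<close>
  define C where "C = (\<lambda>f. cst (THE k. k \<ge> 2 \<and> vote_fun k = f))"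
  have C: "C (vote_fun k) = cst k" if "k \<ge> 2" for k
  proof -
    have "(THE j. j \<ge> 2 \<and> vote_fun j = vote_fun k) = k"
      by (rule the_equality) (use that vote_fun_inj in auto)
    thus ?thesis by (simp add: C_def)
  qed
  have const: "\<exists>L Q. smooth_bound k L \<and> quad_bound k Q \<and> C (vote_fun k) = bias_const k L Q" if k: "k \<ge> 2" for k
    using someI_ex[OF smooth_bound_exists] someI_ex[OF quad_bound_exists[OF k]] C[OF k] unfolding cst_def by blast
  show ?thesis
  proof (rule exI[of _ C], intro allI impI conjI, goal_cases)
    case (1 k)
    then obtain L Q where "smooth_bound k L" "quad_bound k Q" "C (vote_fun k) = bias_const k L Q" using const by blast
    thus ?case by (simp add: smooth_bound_def quad_bound_def bias_const_def growth_rate_def add_nonneg_pos)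
  next
    case (2 k p)
    thus ?case using consensus_time_logarithmic[of k p] by blast
  next
    case (3 k p \<epsilon>)
    then obtain L Q where LQ: "smooth_bound k L" "quad_bound k Q" and Ck: "C (vote_fun k) = bias_const k L Q" using const by blast
    show ?case unfolding Ck by (rule consensus_time_from_bias) (use 3 LQ in auto)
  qed
qed

end
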